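(* Let $(E,\mathcal{P})$ be a random locally convex module over $\mathbb{R}$ with base $(\Omega,\mathcal{F},P)$ and $f:E\to\bar L^0(\mathcal{F})$ a proper $\mathcal{T}_{\varepsilon,\lambda}$-lower semicontinuous $L^0$-convex function. Then $f^{\ast\ast}_{\varepsilon,\lambda}=f$.
   Context: $(\Omega,\mathcal{F},P)$ is a probability space. $L^0(\mathcal{F})$ (resp. $\bar L^0(\mathcal{F})$) is the set of equivalence classes (a.s. equality) of real (resp. extended real)-valued $\mathcal{F}$-measurable random variables, with the a.s. order; $\bar L^0(\mathcal{F})$ is a complete lattice, with suprema $\bigvee$ and infima $\bigwedge$. $L^0_+(\mathcal{F})=\{\xi\in L^0(\mathcal{F}):\xi\ge0\}$. "$\xi<\eta$ on $A$" means $\xi(\omega)<\eta(\omega)$ for $P$-almost all $\omega\in A$. Random locally convex module over $\mathbb{R}$ with base $(\Omega,\mathcal{F},P)$: a pair $(E,\mathcal{P})$ with $E$ an $L^0(\mathcal{F})$-module and $\mathcal{P}$ a family of $L^0$-seminorms on $E$ (maps $\|\cdot\|:E\to L^0_+(\mathcal{F})$ with $\|\xi x\|=|\xi|\|x\|$ for $\xi\in L^0(\mathcal{F})$ and $\|x+y\|\le\|x\|+\|y\|$) such that $\bigvee\{\|x\|:\|\cdot\|\in\mathcal{P}\}=0$ iff $x=\theta$ (null element). $\mathcal{P}_f$ is the family of (nonempty) finite subsets of $\mathcal{P}$, and $\|x\|_{\mathcal{Q}}=\bigvee\{\|x\|:\|\cdot\|\in\mathcal{Q}\}$. The $(\varepsilon,\lambda)$-topology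 $\mathcal{T}_{\varepsilon,\lambda}$ on $E$ is the linear topology with local base at $\theta$: $\{x: P(\|x\|_{\mathcal{Q}}<\varepsilon)>1-\lambda\}$, $\mathcal{Q}\in\mathcal{P}_f$, real $\varepsilon>0$, $0<\lambda<1$; on $L^0(\mathcal{F})$, $\mathcal{T}_{\varepsilon,\lambda}$ (from $|\cdot|$) is the topology of convergence in probability. $E^\ast_{\varepsilon,\lambda}$ is the set of continuous module homomorphisms from $(E,\mathcal{T}_{\varepsilon,\lambda})$ to $(L^0(\mathcal{F}),\mathcal{T}_{\varepsilon,\lambda})$. For $f:E\to\bar L^0(\mathcal{F})$: $dom(f)=\{x\in E: f(x)<+\infty\text{ on }\Omega\}$, $epi(f)=\{(x,r)\in E\times L^0(\mathcal{F}):f(x)\le r\}$. $f$ is proper if $dom(f)\ne\emptyset$ and $f(x)>-\infty$ on $\Omega$ for all $x\in E$. $f$ is $L^0$-convex if $f(\xi x+(1-\xi)y)\le\xi f(x)+(1-\xi)f(y)$ for all $x,y\in E$, $\xi\in L^0_+(\mathcal{F})$ with $0\le\xi\le1$, with the conventions $0\cdot(\pm\infty)=0$ and $+\infty\pm(\pm\infty)=+\infty$. A proper $L^0$-convex $f$ is $\mathcal{T}_{\varepsilon,\lambda}$-lower semicontinuous if $epi(f)$ is closed in $(E,\mathcal{T}_{\varepsilon,\lambda})\times(L^0(\mathcal{F}),\mathcal{T}_{\varepsilon,\lambda})$. $f^\ast_{\varepsilon,\lambda}(g)=\bigvee\{g(x)-f(x):x\in E\}$ for $g\in E^\ast_{\varepsilon,\lambda}$,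 and $f^{\ast\ast}_{\varepsilon,\lambda}(x)=\bigvee\{g(x)-f^\ast_{\varepsilon,\lambda}(g):g\in E^\ast_{\varepsilon,\lambda}\}$ for $x\in E$. *)

theory Defs
  imports
    "HOL-Probability.Probability"
    "HOL-Algebra.Module"
    "HOL-Algebra.Complete_Lattice"
begin

section \<open>Random variables modulo almost sure equality\<close>

definition ae_eq :: "'w measure \<Rightarrow> (('w \<Rightarrow> 'b::topological_space) \<times> ('w \<Rightarrow> 'b)) set" where
  "ae_eq M = {(x, y). x \<in> borel_measurable M \<and> y \<in> borel_measurable M \<and> (AE w in M. x w = y w)}"

definition ae_classes :: "'w measure \<Rightarrow> ('w \<Rightarrow> 'b::topological_space) set set" where
  "ae_classes M = borel_measurable M // ae_eq M"

definition ae_class :: "'w measure \<Rightarrow> ('w \<Rightarrow> 'b::topological_space) \<Rightarrow> ('w \<Rightarrow> 'b) set" where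
  "ae_class M x = ae_eq M `` {x}"

definition ae_rep :: "('w \<Rightarrow> 'b) set \<Rightarrow> 'w \<Rightarrow> 'b" where
  "ae_rep X = (SOME x. x \<in> X)"

text \<open>Pointwise operations and the almost sure order, computed on representatives. They do not
  depend on the choice made by \<^const>\<open>ae_rep\<close>, see \<open>ae_lift1_class\<close>, \<open>ae_lift2_class\<close> and
  \<open>ae_le_class\<close> below.\<close>

definition ae_lift1 ::
  "'w measure \<Rightarrow> ('b \<Rightarrow> 'c) \<Rightarrow> ('w \<Rightarrow> 'b) set \<Rightarrow> ('w \<Rightarrow> 'c::topological_space) set" where
  "ae_lift1 M h X = ae_class M (\<lambda>w. h (ae_rep X w))"

definition ae_lift2 ::
  "'w measure \<Rightarrow> ('b \<Rightarrow> 'c \<Rightarrow> 'd) \<Rightarrow> ('w \<Rightarrow> 'b) set \<Rightarrow> ('w \<Rightarrow> 'c) set \<Rightarrow> ('w \<Rightarrow> 'd::topological_space) set"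
  where "ae_lift2 M h X Y = ae_class M (\<lambda>w. h (ae_rep X w) (ae_rep Y w))"

definition ae_le :: "'w measure \<Rightarrow> ('w \<Rightarrow> 'b::ord) set \<Rightarrow> ('w \<Rightarrow> 'b) set \<Rightarrow> bool" where
  "ae_le M X Y \<longleftrightarrow> (AE w in M. ae_rep X w \<le> ae_rep Y w)"

text \<open>\<open>L0 M\<close> is at once the ring of scalars and the ring regarded as a module over itself.\<close>

definition L0 :: "'w measure \<Rightarrow> (('w \<Rightarrow> real) set, ('w \<Rightarrow> real) set) module" where
  "L0 M = \<lparr>carrier = ae_classes M, mult = ae_lift2 M (*), one = ae_class M (\<lambda>_. 1),
           zero = ae_class M (\<lambda>_. 0), add = ae_lift2 M (+), smult = ae_lift2 M (*)\<rparr>"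

definition L0bar :: "'w measure \<Rightarrow> ('w \<Rightarrow> ereal) set gorder" where
  "L0bar M = \<lparr>carrier = ae_classes M, eq = (=), le = ae_le M\<rparr>"

abbreviation of_L0 :: "'w measure \<Rightarrow> ('w \<Rightarrow> real) set \<Rightarrow> ('w \<Rightarrow> ereal) set" where
  "of_L0 M \<equiv> ae_lift1 M ereal"

section \<open>Random locally convex modules\<close>

definition L0_seminorm ::
  "'w measure \<Rightarrow> (('w \<Rightarrow> real) set, 'e, 'm) module_scheme \<Rightarrow> ('e \<Rightarrow> ('w \<Rightarrow> real) set) \<Rightarrow> bool" where
  "L0_seminorm M E n \<longleftrightarrow>
     (\<forall>x\<in>carrier E. n x \<in> carrier (L0 M) \<and> ae_le M \<zero>\<^bsub>L0 M\<^esub> (n x)) \<and>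
     (\<forall>\<xi>\<in>carrier (L0 M). \<forall>x\<in>carrier E. n (\<xi> \<odot>\<^bsub>E\<^esub> x) = ae_lift1 M abs \<xi> \<otimes>\<^bsub>L0 M\<^esub> n x) \<and>
     (\<forall>x\<in>carrier E. \<forall>y\<in>carrier E. ae_le M (n (x \<oplus>\<^bsub>E\<^esub> y)) (n x \<oplus>\<^bsub>L0 M\<^esub> n y))"

text \<open>The supremum is taken in the complete lattice \<^const>\<open>L0bar\<close>; it is meant for arbitrary, not
  only finite, families of seminorms.\<close>

definition sup_norm ::
  "'w measure \<Rightarrow> ('e \<Rightarrow> ('w \<Rightarrow> real) set) set \<Rightarrow> 'e \<Rightarrow> ('w \<Rightarrow> ereal) set" where
  "sup_norm M Q x = \<Squnion>\<^bsub>L0bar M\<^esub> ((\<lambda>n. of_L0 M (n x)) ` Q)"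

locale random_locally_convex_module =
  prob_space M + Module.module "L0 M" E
  for M :: "'w measure" and E :: "(('w \<Rightarrow> real) set, 'e, 'm) module_scheme" +
  fixes P :: "('e \<Rightarrow> ('w \<Rightarrow> real) set) set"
  assumes seminorms: "n \<in> P \<Longrightarrow> L0_seminorm M E n"
    and separating:
      "x \<in> carrier E \<Longrightarrow> sup_norm M P x = of_L0 M \<zero>\<^bsub>L0 M\<^esub> \<longleftrightarrow> x = \<zero>\<^bsub>E\<^esub>"

definition el_nhd ::
  "'w measure \<Rightarrow> (('w \<Rightarrow> real) set, 'e, 'm) module_scheme \<Rightarrow> ('e \<Rightarrow> ('w \<Rightarrow> real) set) set \<Rightarrow>
   real \<Rightarrow> real \<Rightarrow> 'e set" where
  "el_nhd M E Q \<epsilon> \<delta> =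
     {x \<in> carrier E. measure M {w \<in> space M. ae_rep (sup_norm M Q x) w < ereal \<epsilon>} > 1 - \<delta>}"

text \<open>The \<open>(\<epsilon>, \<lambda>)\<close>-topology on the carrier of \<open>E\<close>. That the condition on \<open>U\<close> defines a
  topology is \<open>istopology_el\<close> below.\<close>

definition el_topology ::
  "'w measure \<Rightarrow> (('w \<Rightarrow> real) set, 'e, 'm) module_scheme \<Rightarrow> ('e \<Rightarrow> ('w \<Rightarrow> real) set) set \<Rightarrow>
   'e topology" where
  "el_topology M E P = topology (\<lambda>U. U \<subseteq> carrier E \<and>
     (\<forall>x\<in>U. \<exists>Q \<epsilon> \<delta>. Q \<subseteq> P \<and> finite Q \<and> Q \<noteq> {} \<and> 0 < \<epsilon> \<and> 0 < \<delta> \<and> \<delta> < 1 \<and>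
        (\<forall>z\<in>el_nhd M E Q \<epsilon> \<delta>. x \<oplus>\<^bsub>E\<^esub> z \<in> U)))"

abbreviation L0_topology :: "'w measure \<Rightarrow> ('w \<Rightarrow> real) set topology" where
  "L0_topology M \<equiv> el_topology M (L0 M) {ae_lift1 M abs}"

definition el_dual ::
  "'w measure \<Rightarrow> (('w \<Rightarrow> real) set, 'e, 'm) module_scheme \<Rightarrow> ('e \<Rightarrow> ('w \<Rightarrow> real) set) set \<Rightarrow>
   ('e \<Rightarrow> ('w \<Rightarrow> real) set) set" where
  "el_dual M E P = {g \<in> carrier E \<rightarrow> carrier (L0 M).
     (\<forall>x\<in>carrier E. \<forall>y\<in>carrier E. g (x \<oplus>\<^bsub>E\<^esub> y) = g x \<oplus>\<^bsub>L0 M\<^esub> g y) \<and>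
     (\<forall>\<xi>\<in>carrier (L0 M). \<forall>x\<in>carrier E. g (\<xi> \<odot>\<^bsub>E\<^esub> x) = \<xi> \<otimes>\<^bsub>L0 M\<^esub> g x) \<and>
     continuous_map (el_topology M E P) (L0_topology M) g}"

section \<open>Extended real valued functions on a module\<close>

definition L0_dom ::
  "'w measure \<Rightarrow> (('w \<Rightarrow> real) set, 'e, 'm) module_scheme \<Rightarrow> ('e \<Rightarrow> ('w \<Rightarrow> ereal) set) \<Rightarrow> 'e set" where
  "L0_dom M E f = {x \<in> carrier E. AE w in M. ae_rep (f x) w < \<infinity>}"

definition L0_epi ::
  "'w measure \<Rightarrow> (('w \<Rightarrow> real) set, 'e, 'm) module_scheme \<Rightarrow> ('e \<Rightarrow> ('w \<Rightarrow> ereal) set) \<Rightarrow>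
   ('e \<times> ('w \<Rightarrow> real) set) set" where
  "L0_epi M E f = {(x, r). x \<in> carrier E \<and> r \<in> carrier (L0 M) \<and> f x \<sqsubseteq>\<^bsub>L0bar M\<^esub> of_L0 M r}"

definition L0_proper ::
  "'w measure \<Rightarrow> (('w \<Rightarrow> real) set, 'e, 'm) module_scheme \<Rightarrow> ('e \<Rightarrow> ('w \<Rightarrow> ereal) set) \<Rightarrow> bool" where
  "L0_proper M E f \<longleftrightarrow> L0_dom M E f \<noteq> {} \<and> (\<forall>x\<in>carrier E. AE w in M. ae_rep (f x) w > -\<infinity>)"

text \<open>The arithmetic of \<^typ>\<open>ereal\<close> obeys the conventions \<open>0 \<cdot> (\<plusminus>\<infinity>) = 0\<close> and
  \<open>\<infinity> \<plusminus> (\<plusminus>\<infinity>) = \<infinity>\<close> of convex analysis, so it can be lifted as it stands.\<close>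

definition L0_convex ::
  "'w measure \<Rightarrow> (('w \<Rightarrow> real) set, 'e, 'm) module_scheme \<Rightarrow> ('e \<Rightarrow> ('w \<Rightarrow> ereal) set) \<Rightarrow> bool" where
  "L0_convex M E f \<longleftrightarrow>
     (\<forall>x\<in>carrier E. \<forall>y\<in>carrier E. \<forall>\<xi>\<in>carrier (L0 M).
        ae_le M \<zero>\<^bsub>L0 M\<^esub> \<xi> \<and> ae_le M \<xi> \<one>\<^bsub>L0 M\<^esub> \<longrightarrow>
        f (\<xi> \<odot>\<^bsub>E\<^esub> x \<oplus>\<^bsub>E\<^esub> (\<one>\<^bsub>L0 M\<^esub> \<ominus>\<^bsub>L0 M\<^esub> \<xi>) \<odot>\<^bsub>E\<^esub> y) \<sqsubseteq>\<^bsub>L0bar M\<^esub>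
          ae_lift2 M (+) (ae_lift2 M (*) (of_L0 M \<xi>) (f x))
                         (ae_lift2 M (*) (of_L0 M (\<one>\<^bsub>L0 M\<^esub> \<ominus>\<^bsub>L0 M\<^esub> \<xi>)) (f y)))"

definition el_lsc ::
  "'w measure \<Rightarrow> (('w \<Rightarrow> real) set, 'e, 'm) module_scheme \<Rightarrow> ('e \<Rightarrow> ('w \<Rightarrow> real) set) set \<Rightarrow>
   ('e \<Rightarrow> ('w \<Rightarrow> ereal) set) \<Rightarrow> bool" where
  "el_lsc M E P f \<longleftrightarrow>
     closedin (prod_topology (el_topology M E P) (L0_topology M)) (L0_epi M E f)"

definition el_conjugate ::
  "'w measure \<Rightarrow> (('w \<Rightarrow> real) set, 'e, 'm) module_scheme \<Rightarrow> ('e \<Rightarrow> ('w \<Rightarrow> ereal) set) \<Rightarrow>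
   ('e \<Rightarrow> ('w \<Rightarrow> real) set) \<Rightarrow> ('w \<Rightarrow> ereal) set" where
  "el_conjugate M E f g = \<Squnion>\<^bsub>L0bar M\<^esub> {ae_lift2 M (-) (of_L0 M (g x)) (f x) | x. x \<in> carrier E}"

definition el_biconjugate ::
  "'w measure \<Rightarrow> (('w \<Rightarrow> real) set, 'e, 'm) module_scheme \<Rightarrow> ('e \<Rightarrow> ('w \<Rightarrow> real) set) set \<Rightarrow>
   ('e \<Rightarrow> ('w \<Rightarrow> ereal) set) \<Rightarrow> 'e \<Rightarrow> ('w \<Rightarrow> ereal) set" where
  "el_biconjugate M E P f x =
     \<Squnion>\<^bsub>L0bar M\<^esub> {ae_lift2 M (-) (of_L0 M (g x)) (el_conjugate M E f g) | g. g \<in> el_dual M E P}"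

section \<open>Well-definedness\<close>

lemma equiv_ae_eq: "equiv (borel_measurable M) (ae_eq M)"
  unfolding equiv_def refl_on_def sym_def trans_def ae_eq_def by (auto elim: AE_mp)

lemma ae_class_in [simp]: "x \<in> borel_measurable M \<Longrightarrow> ae_class M x \<in> ae_classes M"
  by (simp add: ae_class_def ae_classes_def quotientI)

lemma ae_classesE:
  assumes "X \<in> ae_classes M"
  obtains x where "x \<in> borel_measurable M" "X = ae_class M x"
  using assms unfolding ae_classes_def ae_class_def by (auto elim: quotientE)

lemma ae_rep_class:
  assumes "x \<in> borel_measurable M"
  shows "ae_rep (ae_class M x) \<in> borel_measurable M" "AE w in M. ae_rep (ae_class M x) w = x w"
proof -
  have "x \<in> ae_class M x"
    using assms by (simp add: ae_class_def ae_eq_def)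
  then have "ae_rep (ae_class M x) \<in> ae_class M x"
    unfolding ae_rep_def by (metis someI)
  then show "ae_rep (ae_class M x) \<in> borel_measurable M" "AE w in M. ae_rep (ae_class M x) w = x w"
    by (auto simp: ae_class_def ae_eq_def elim: AE_mp)
qed

lemma ae_class_eqI:
  assumes "x \<in> borel_measurable M" "y \<in> borel_measurable M" "AE w in M. x w = y w"
  shows "ae_class M x = ae_class M y"
  unfolding ae_class_def using equiv_class_eq[OF equiv_ae_eq, of x y M] assms by (simp add: ae_eq_def)

lemma ae_lift1_class:
  assumes "x \<in> borel_measurable M" "h \<in> borel_measurable borel"
  shows "ae_lift1 M h (ae_class M x) = ae_class M (\<lambda>w. h (x w))"
  unfolding ae_lift1_def using ae_rep_class[OF assms(1)] assms
  by (intro ae_class_eqI) (auto intro: measurable_compose elim: AE_mp)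

lemma ae_lift2_class:
  assumes "x \<in> borel_measurable M" "y \<in> borel_measurable M"
    and "\<And>u v. u \<in> borel_measurable M \<Longrightarrow> v \<in> borel_measurable M \<Longrightarrow>
      (\<lambda>w. h (u w) (v w)) \<in> borel_measurable M"
  shows "ae_lift2 M h (ae_class M x) (ae_class M y) = ae_class M (\<lambda>w. h (x w) (y w))"
  unfolding ae_lift2_def
proof (intro ae_class_eqI assms(3) ae_rep_class assms(1,2))
  show "AE w in M. h (ae_rep (ae_class M x) w) (ae_rep (ae_class M y) w) = h (x w) (y w)"
    using ae_rep_class(2)[OF assms(1)] ae_rep_class(2)[OF assms(2)] by eventually_elim simp
qed

lemma ae_le_class:
  assumes "x \<in> borel_measurable M" "y \<in> borel_measurable M"
  shows "ae_le M (ae_class M x) (ae_class M y) \<longleftrightarrow> (AE w in M. x w \<le> y w)"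
proof -
  have "AE w in M. (ae_rep (ae_class M x) w \<le> ae_rep (ae_class M y) w) = (x w \<le> y w)"
    using ae_rep_class(2)[OF assms(1)] ae_rep_class(2)[OF assms(2)] by eventually_elim simp
  then show ?thesis unfolding ae_le_def by (intro iffI) (auto elim: AE_mp)
qed

lemma ae_class_rep:
  assumes "X \<in> ae_classes M"
  shows "ae_rep X \<in> borel_measurable M" "ae_class M (ae_rep X) = X"
proof -
  obtain x where x: "x \<in> borel_measurable M" "X = ae_class M x"
    using assms by (rule ae_classesE)
  show "ae_rep X \<in> borel_measurable M" "ae_class M (ae_rep X) = X"
    using ae_rep_class[OF x(1)] x ae_class_eqI by metis+
qed

lemma L0_simps [simp]:
  "carrier (L0 M) = ae_classes M" "mult (L0 M) = ae_lift2 M (*)" "one (L0 M) = ae_class M (\<lambda>_. 1)"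
  "zero (L0 M) = ae_class M (\<lambda>_. 0)" "add (L0 M) = ae_lift2 M (+)" "smult (L0 M) = ae_lift2 M (*)"
  by (simp_all add: L0_def)

lemma L0bar_simps [simp]:
  "carrier (L0bar M) = ae_classes M" "eq (L0bar M) = (=)" "le (L0bar M) = ae_le M"
  by (simp_all add: L0bar_def)

lemma cring_L0: "cring (L0 M)"
proof (intro cringI abelian_groupI comm_monoidI)
  fix X assume "X \<in> carrier (L0 M)"
  then obtain x where x: "x \<in> borel_measurable M" "X = ae_class M x" by (auto elim: ae_classesE)
  then have "ae_class M (\<lambda>w. - x w) \<oplus>\<^bsub>L0 M\<^esub> X = \<zero>\<^bsub>L0 M\<^esub>" by (simp add: ae_lift2_class)
  then show "\<exists>Y\<in>carrier (L0 M). Y \<oplus>\<^bsub>L0 M\<^esub> X = \<zero>\<^bsub>L0 M\<^esub>" using x(1) by force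
qed (auto elim!: ae_classesE simp: ae_lift2_class algebra_simps)

lemma module_L0: "Module.module (L0 M) (L0 M)"
proof -
  interpret cring "L0 M" by (rule cring_L0)
  show ?thesis
    using m_assoc l_distr r_distr l_one
    by (intro moduleI cring_L0 is_abelian_group) (simp_all, use m_closed in simp)
qed

lemma partial_order_L0bar: "partial_order (L0bar M)"
proof unfold_locales
  show "eq (L0bar M) = (=)" by simp
next
  fix X Y assume "X \<in> carrier (L0bar M)" "Y \<in> carrier (L0bar M)" "X \<sqsubseteq>\<^bsub>L0bar M\<^esub> Y" "Y \<sqsubseteq>\<^bsub>L0bar M\<^esub> X"
  moreover from this obtain x y where "x \<in> borel_measurable M" "X = ae_class M x"
      "y \<in> borel_measurable M" "Y = ae_class M y"
    by (auto elim!: ae_classesE)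
  ultimately show "X .=\<^bsub>L0bar M\<^esub> Y"
    by (simp add: ae_le_class) (rule ae_class_eqI, auto)
next
  fix X Y Z
  assume "X \<sqsubseteq>\<^bsub>L0bar M\<^esub> Y" "Y \<sqsubseteq>\<^bsub>L0bar M\<^esub> Z"
  then show "X \<sqsubseteq>\<^bsub>L0bar M\<^esub> Z" by (auto simp: ae_le_def elim: AE_mp)
qed (auto simp: ae_le_def)

definition squash :: "ereal \<Rightarrow> real" where
  "squash e = (if e = \<infinity> then 2 else if e = -\<infinity> then -2 else arctan (real_of_ereal e))"

lemma squash_less: "a < b \<Longrightarrow> squash a < squash b"
  using arctan_bounded pi_less_4
  by (cases a; cases b)
    (auto simp: squash_def arctan_less_iff intro: less_trans[of _ "pi/2"] order_less_trans[of "-2" "-(pi/2)"])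

lemma squash_le_iff: "squash a \<le> squash b \<longleftrightarrow> a \<le> b"
  using squash_less[of a b] squash_less[of b a] by (metis linorder_not_le order_le_less)

lemma squash_bound: "\<bar>squash a\<bar> \<le> 2"
  using squash_le_iff[of a \<infinity>] squash_le_iff[of "-\<infinity>" a] by (simp add: squash_def abs_le_iff)

lemma squash_measurable [measurable]: "squash \<in> borel_measurable borel"
  unfolding squash_def by measurable

lemma (in finite_measure) ess_sup_exists:
  fixes A :: "('a \<Rightarrow> ereal) set"
  assumes A: "A \<subseteq> borel_measurable M"
  obtains s where "s \<in> borel_measurable M" "\<And>x. x \<in> A \<Longrightarrow> AE w in M. x w \<le> s w"
    "\<And>u. \<forall>x\<in>A. AE w in M. x w \<le> u w \<Longrightarrow> AE w in M. s w \<le> u w"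
proof -
  define V where "V = (\<lambda>C (w::'a). SUP x\<in>C. (x w :: ereal))"
  define I where "I = (\<lambda>C. \<integral>w. squash (V C w) \<partial>M)"
  define K where "K = {C. countable C \<and> C \<subseteq> A}"
  have V_meas: "V C \<in> borel_measurable M" if "C \<in> K" for C
    using that A unfolding V_def K_def by (intro borel_measurable_SUP) auto
  have V_int: "integrable M (\<lambda>w. squash (V C w))" if "C \<in> K" for C
    using V_meas[OF that] squash_bound by (intro integrable_const_bound[where B = 2]) auto
  have I_mono: "I C \<le> I D" if "C \<in> K" "D \<in> K" "C \<subseteq> D" for C D
    unfolding I_def
    by (intro integral_mono V_int that) (auto simp: V_def squash_le_iff intro!: SUP_subset_mono that)
  have I_bound: "I C \<le> 2 * measure M (space M)" if "C \<in> K" for C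
  proof -
    have "I C \<le> (\<integral>w. 2 \<partial>M)"
      unfolding I_def using squash_bound by (intro integral_mono V_int that) (auto simp: abs_le_iff)
    then show ?thesis by (simp add: mult.commute)
  qed
  have bdd: "bdd_above (I ` K)" using I_bound by (auto simp: bdd_above_def)
  have ne: "I ` K \<noteq> {}" by (auto simp: K_def)
  define S where "S = Sup (I ` K)"
  have "\<exists>C\<in>K. I C > S - 1 / Suc n" for n
  proof -
    have "S - 1 / Suc n < S" by simp
    then obtain y where "y \<in> I ` K" "S - 1 / Suc n < y"
      using less_cSup_iff[OF ne bdd, of "S - 1 / Suc n"] unfolding S_def[symmetric] by blast
    then show ?thesis by blast
  qed
  then have "\<forall>n. \<exists>C. C \<in> K \<and> I C > S - 1 / Suc n" by blast
  from choice[OF this] obtain c where c: "\<And>n. c n \<in> K" "\<And>n. I (c n) > S - 1 / Suc n"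
    by blast
  define D where "D = (\<Union>n. c n)"
  have D: "D \<in> K" using c(1) by (auto simp: D_def K_def)
  have "S - 1 / Suc n \<le> I D" for n
  proof -
    have "c n \<subseteq> D" by (auto simp: D_def)
    from I_mono[OF c(1) D this] c(2)[of n] show ?thesis by linarith
  qed
  moreover have "(\<lambda>n. S - 1 / real (Suc n)) \<longlonglongrightarrow> S - 0"
    by (intro tendsto_diff tendsto_const LIMSEQ_inverse_real_of_nat[unfolded inverse_eq_divide])
  ultimately have "S - 0 \<le> I D" by (intro LIMSEQ_le_const2) blast+
  then have ID: "S \<le> I D" by simp
  show thesis
  proof (rule that[of "V D"])
    show "V D \<in> borel_measurable M" by (rule V_meas[OF D])
    fix x assume x: "x \<in> A"
    then have D': "insert x D \<in> K" using D by (auto simp: K_def)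
    have "I (insert x D) \<le> I D"
      using cSup_upper[OF _ bdd, of "I (insert x D)"] D' ID by (auto simp: S_def)
    moreover have "I D \<le> I (insert x D)" by (rule I_mono[OF D D']) auto
    ultimately have "I D = I (insert x D)" by simp
    then have "AE w in M. squash (V D w) = squash (V (insert x D) w)"
      unfolding I_def
      by (intro integral_ineq_eq_0_then_AE V_int D D' AE_I2)
        (auto simp: V_def squash_le_iff intro!: SUP_subset_mono)
    then show "AE w in M. x w \<le> V D w"
    proof eventually_elim
      case (elim w)
      have "x w \<le> V (insert x D) w" by (simp add: V_def)
      also have "\<dots> \<le> V D w" using elim by (simp flip: squash_le_iff)
      finally show ?case .
    qed
  next
    fix u assume "\<forall>x\<in>A. AE w in M. x w \<le> u w"
    then have "AE w in M. \<forall>x\<in>D. x w \<le> u w"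
      using D by (subst AE_ball_countable) (auto simp: K_def)
    then show "AE w in M. V D w \<le> u w" by eventually_elim (auto simp: V_def SUP_le_iff)
  qed
qed

lemma (in finite_measure) complete_lattice_L0bar: "complete_lattice (L0bar M)"
proof -
  interpret partial_order "L0bar M" by (rule partial_order_L0bar)
  have sup: "\<exists>s. least (L0bar M) s (Upper (L0bar M) A)" if A: "A \<subseteq> carrier (L0bar M)" for A
  proof -
    have "ae_rep ` A \<subseteq> borel_measurable M" using A ae_class_rep by auto
    then obtain s where s: "s \<in> borel_measurable M"
        "\<And>x. x \<in> ae_rep ` A \<Longrightarrow> AE w in M. x w \<le> s w"
        "\<And>u. \<forall>x\<in>ae_rep ` A. AE w in M. x w \<le> u w \<Longrightarrow> AE w in M. s w \<le> u w"
      by (rule ess_sup_exists) blast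
    have "X \<sqsubseteq>\<^bsub>L0bar M\<^esub> ae_class M s" if "X \<in> A" for X
      using s(2)[of "ae_rep X"] that ae_rep_class(2)[OF s(1)] unfolding L0bar_simps ae_le_def
      by (auto elim: AE_mp)
    moreover have "ae_class M s \<sqsubseteq>\<^bsub>L0bar M\<^esub> U" if "U \<in> Upper (L0bar M) A" for U
    proof -
      have "AE w in M. s w \<le> ae_rep U w"
        using that A by (intro s(3)) (auto simp: Upper_def ae_le_def)
      with ae_rep_class(2)[OF s(1)] show ?thesis unfolding L0bar_simps ae_le_def
        by eventually_elim simp
    qed
    ultimately have "least (L0bar M) (ae_class M s) (Upper (L0bar M) A)"
      using A s(1) by (intro least_UpperI) auto
    then show ?thesis ..
  qed
  have top: "greatest (L0bar M) (ae_class M (\<lambda>_. \<infinity>)) (carrier (L0bar M))"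
    by (auto simp: greatest_def ae_le_class elim!: ae_classesE)
  show ?thesis
  proof (rule complete_latticeI)
    fix A assume A: "A \<subseteq> carrier (L0bar M)"
    obtain i where i: "least (L0bar M) i (Upper (L0bar M) (Lower (L0bar M) A))"
      using sup[OF Lower_closed] by blast
    have "greatest (L0bar M) i (Lower (L0bar M) A)"
    proof (rule greatest_LowerI)
      show "i \<sqsubseteq>\<^bsub>L0bar M\<^esub> X" if "X \<in> A" for X
        using that A by (intro least_le[OF i]) (auto simp: Upper_def Lower_def)
      show "Y \<sqsubseteq>\<^bsub>L0bar M\<^esub> i" if "Y \<in> Lower (L0bar M) A" for Y
        using least_Upper_above[OF i that Lower_closed] .
      show "A \<subseteq> carrier (L0bar M)" "i \<in> carrier (L0bar M)"
        using A least_closed[OF i] by auto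
    qed
    then show "\<exists>i. greatest (L0bar M) i (Lower (L0bar M) A)" ..
  qed (rule sup)
qed

lemma (in prob_space) istopology_el:
  assumes P: "\<And>n. n \<in> P \<Longrightarrow> L0_seminorm M E n"
  shows "istopology (\<lambda>U. U \<subseteq> carrier E \<and>
     (\<forall>x\<in>U. \<exists>Q \<epsilon> \<delta>. Q \<subseteq> P \<and> finite Q \<and> Q \<noteq> {} \<and> 0 < \<epsilon> \<and> 0 < \<delta> \<and> \<delta> < 1 \<and>
        (\<forall>z\<in>el_nhd M E Q \<epsilon> \<delta>. x \<oplus>\<^bsub>E\<^esub> z \<in> U)))"
    (is "istopology (\<lambda>U. _ \<and> (\<forall>x\<in>U. ?nh U x))")
proof -
  interpret complete_lattice "L0bar M" by (rule complete_lattice_L0bar)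
  have sub: "(\<lambda>n. of_L0 M (n z)) ` Q \<subseteq> carrier (L0bar M)" if "Q \<subseteq> P" "z \<in> carrier E" for Q z
  proof -
    have "of_L0 M (n z) \<in> carrier (L0bar M)" if "n \<in> Q" for n
    proof -
      have "n z \<in> ae_classes M"
        using P[of n] that \<open>Q \<subseteq> P\<close> \<open>z \<in> carrier E\<close> by (auto simp: L0_seminorm_def)
      then show ?thesis by (auto simp: ae_lift1_class elim!: ae_classesE)
    qed
    then show ?thesis by blast
  qed
  have mono: "el_nhd M E Q \<epsilon> \<delta> \<subseteq> el_nhd M E Q' \<epsilon>' \<delta>'"
    if "Q \<subseteq> P" "Q' \<subseteq> Q" "\<epsilon> \<le> \<epsilon>'" "\<delta> \<le> \<delta>'" for Q Q' and \<epsilon> \<epsilon>' \<delta> \<delta>' :: real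
  proof
    fix z assume z: "z \<in> el_nhd M E Q \<epsilon> \<delta>"
    then have zE: "z \<in> carrier E" by (simp add: el_nhd_def)
    note s = sub[OF that(1) zE] sub[OF subset_trans[OF that(2,1)] zE]
    have "sup_norm M Q' z \<sqsubseteq>\<^bsub>L0bar M\<^esub> sup_norm M Q z"
      unfolding sup_norm_def
    proof (rule sup_least[OF s(2)])
      show "\<Squnion>\<^bsub>L0bar M\<^esub> ((\<lambda>n. of_L0 M (n z)) ` Q) \<in> carrier (L0bar M)" by (rule sup_closed[OF s(1)])
      show "X \<sqsubseteq>\<^bsub>L0bar M\<^esub> \<Squnion>\<^bsub>L0bar M\<^esub> ((\<lambda>n. of_L0 M (n z)) ` Q)"
        if "X \<in> (\<lambda>n. of_L0 M (n z)) ` Q'" for X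
        by (rule sup_upper[OF s(1)]) (use that \<open>Q' \<subseteq> Q\<close> in blast)
    qed
    then have le: "AE w in M. ae_rep (sup_norm M Q' z) w \<le> ae_rep (sup_norm M Q z) w"
      by (simp add: ae_le_def)
    have [measurable]: "ae_rep (sup_norm M Q z) \<in> borel_measurable M"
        "ae_rep (sup_norm M Q' z) \<in> borel_measurable M"
      using sup_closed[OF s(1)] sup_closed[OF s(2)] by (auto simp: sup_norm_def intro!: ae_class_rep)
    have "prob {w \<in> space M. ae_rep (sup_norm M Q z) w < ereal \<epsilon>} \<le>
        prob {w \<in> space M. ae_rep (sup_norm M Q' z) w < ereal \<epsilon>'}"
    proof (rule finite_measure_mono_AE)
      show "AE w in M. w \<in> {w \<in> space M. ae_rep (sup_norm M Q z) w < ereal \<epsilon>} \<longrightarrow>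
          w \<in> {w \<in> space M. ae_rep (sup_norm M Q' z) w < ereal \<epsilon>'}"
        using le
      proof eventually_elim
        case (elim w)
        have "ereal \<epsilon> \<le> ereal \<epsilon>'" using that by simp
        with elim show ?case
          using le_less_trans[OF elim] less_le_trans[OF _ \<open>ereal \<epsilon> \<le> ereal \<epsilon>'\<close>] by blast
      qed
    qed measurable
    then show "z \<in> el_nhd M E Q' \<epsilon>' \<delta>'" using z that(4) by (auto simp: el_nhd_def)
  qed
  have inter: "?nh (U \<inter> V) x" if U: "?nh U x" and V: "?nh V x" for U V x
  proof -
    obtain Q1 e1 d1 where 1: "Q1 \<subseteq> P" "finite Q1" "Q1 \<noteq> {}" "0 < e1" "0 < d1" "d1 < 1"
        "\<forall>z\<in>el_nhd M E Q1 e1 d1. x \<oplus>\<^bsub>E\<^esub> z \<in> U"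
      using U by blast
    obtain Q2 e2 d2 where 2: "Q2 \<subseteq> P" "finite Q2" "Q2 \<noteq> {}" "0 < e2" "0 < d2" "d2 < 1"
        "\<forall>z\<in>el_nhd M E Q2 e2 d2. x \<oplus>\<^bsub>E\<^esub> z \<in> V"
      using V by blast
    have "el_nhd M E (Q1 \<union> Q2) (min e1 e2) (min d1 d2) \<subseteq> el_nhd M E Q1 e1 d1"
         "el_nhd M E (Q1 \<union> Q2) (min e1 e2) (min d1 d2) \<subseteq> el_nhd M E Q2 e2 d2"
      using 1 2 by (intro mono; auto)+
    then show ?thesis using 1 2
      by (intro exI[of _ "Q1 \<union> Q2"] exI[of _ "min e1 e2"] exI[of _ "min d1 d2"]) auto
  qed
  have union: "?nh (\<Union> \<U>) x" if "U \<in> \<U>" "?nh U x" for \<U> U x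
    using that by blast
  show ?thesis
    unfolding istopology_def
  proof (rule conjI; intro allI impI)
    fix U V
    assume U: "U \<subseteq> carrier E \<and> (\<forall>x\<in>U. ?nh U x)" and V: "V \<subseteq> carrier E \<and> (\<forall>x\<in>V. ?nh V x)"
    have "?nh (U \<inter> V) x" if "x \<in> U \<inter> V" for x
      by (rule inter) (use U V that in blast)+
    then show "U \<inter> V \<subseteq> carrier E \<and> (\<forall>x\<in>U \<inter> V. ?nh (U \<inter> V) x)" using U by blast
  next
    fix \<U>
    assume \<U>: "\<forall>U\<in>\<U>. U \<subseteq> carrier E \<and> (\<forall>x\<in>U. ?nh U x)"
    have "?nh (\<Union>\<U>) x" if x: "x \<in> \<Union>\<U>" for x
    proof -
      obtain U where "U \<in> \<U>" "x \<in> U" using x by blast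
      then show ?thesis by (intro union[of U]) (use \<U> in blast)+
    qed
    then show "\<Union>\<U> \<subseteq> carrier E \<and> (\<forall>x\<in>\<Union>\<U>. ?nh (\<Union>\<U>) x)" using \<U> by blast
  qed
qed

lemma (in prob_space) openin_el_topology:
  assumes "\<And>n. n \<in> P \<Longrightarrow> L0_seminorm M E n"
  shows "openin (el_topology M E P) U \<longleftrightarrow> U \<subseteq> carrier E \<and>
     (\<forall>x\<in>U. \<exists>Q \<epsilon> \<delta>. Q \<subseteq> P \<and> finite Q \<and> Q \<noteq> {} \<and> 0 < \<epsilon> \<and> 0 < \<delta> \<and> \<delta> < 1 \<and>
        (\<forall>z\<in>el_nhd M E Q \<epsilon> \<delta>. x \<oplus>\<^bsub>E\<^esub> z \<in> U))"
  unfolding el_topology_def by (subst topology_inverse'[OF istopology_el[OF assms]]) auto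

lemma L0_seminorm_abs: "L0_seminorm M (L0 M) (ae_lift1 M abs)"
  unfolding L0_seminorm_def
  by (auto elim!: ae_classesE simp: ae_lift1_class ae_lift2_class ae_le_class abs_mult)

lemma (in random_locally_convex_module) topspace_el_topology:
  "topspace (el_topology M E P) = carrier E"
proof -
  have "P \<noteq> {}"
  proof
    assume "P = {}"
    interpret L: complete_lattice "L0bar M" by (rule complete_lattice_L0bar)
    have "of_L0 M \<zero>\<^bsub>L0 M\<^esub> = \<Squnion>\<^bsub>L0bar M\<^esub> {}"
      using separating[of "\<zero>\<^bsub>E\<^esub>"] \<open>P = {}\<close> by (simp add: sup_norm_def)
    also have "\<dots> \<sqsubseteq>\<^bsub>L0bar M\<^esub> ae_class M (\<lambda>_. -\<infinity>)" by (rule L.sup_least) auto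
    finally show False by (simp add: ae_lift1_class ae_le_class)
  qed
  then obtain n where n: "n \<in> P" by auto
  have "\<exists>Q \<epsilon> \<delta>. Q \<subseteq> P \<and> finite Q \<and> Q \<noteq> {} \<and> 0 < \<epsilon> \<and> 0 < \<delta> \<and> \<delta> < 1 \<and>
      (\<forall>z\<in>el_nhd M E Q \<epsilon> \<delta>. x \<oplus>\<^bsub>E\<^esub> z \<in> carrier E)" if "x \<in> carrier E" for x
    using n that by (intro exI[of _ "{n}"] exI[of _ "1::real"] exI[of _ "1/2::real"]) (auto simp: el_nhd_def)
  then have "openin (el_topology M E P) (carrier E)"
    by (subst openin_el_topology[OF seminorms]) auto
  moreover have "U \<subseteq> carrier E" if "openin (el_topology M E P) U" for U
    using that openin_el_topology[OF seminorms, where U = U] by blast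
  ultimately show ?thesis by (metis openin_subset openin_topspace subset_antisym)
qed

end

(*
  Fenchel-Young gives f** <= f. If the inequality were strict somewhere, a constant q would separate
  f**(x) and f(x) on a set of positive probability. Closedness of the epigraph and an exhaustion of
  the sets on which some y near x has f(y) < q give a smaller set of positive probability on which
  f >= q near x. Used once more at a point of the domain, where convexity turns the local lower
  bound into a global one, this yields q <= f(y) + K ||y - x||_Q for all y on a set A of positive
  probability, with a constant K. A sandwich theorem over L0 produces a linear g with
  g <= 1_A K ||.||_Q and g(y - x) <= f(y) - q on A. Such a g is continuous, and
  f*(g) <= g(x) - q on A, so f**(x) >= q on A, a contradiction. The sandwich theorem rests on
  Zorn's lemma: a minimal sublinear map into L0 is linear. All suprema and infima are
  essential ones.
*)
theory Submission
  imports Defs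
begin

section \<open>Sublinear maps and the sandwich theorem\<close>

text \<open>The topology controls seminorms only off an event of small probability: its
  neighbourhoods need not be convex, so no gauge of a neighbourhood is at hand for separation, and a
  pair outside the epigraph fails the inequality on some event whose place is not given. The remedy
  is locality. Indicators are admissible coefficients, so L0-convexity makes \<open>f\<close> on an
  event depend only on the point on that event, and points can be glued along events. Gluing with a
  domain point \<open>y0\<close> puts the failure inside a prescribed event, and the probability
  margin of the neighbourhood bounds from below what the exhaustion leaves over. The lower bound at
  \<open>x\<close> cannot be spread along segments from \<open>x\<close>, since \<open>f\<close> may
  be infinite there; at \<open>y0\<close> it is finite. The minorant obtained from \<open>y0\<close>
  has linear growth, so a steep enough multiple of the distance from \<open>x\<close> makes up for
  it away from \<open>x\<close>, while the first bound serves close to \<open>x\<close>. Constants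
  replace random factors because a real random variable is bounded on a subset of positive
  probability, and shrinking the event costs nothing: any positive probability gives the
  contradiction.\<close>

definition is_ess_inf :: "'w measure \<Rightarrow> ('w \<Rightarrow> real) set \<Rightarrow> ('w \<Rightarrow> real) \<Rightarrow> bool" where
  "is_ess_inf M A s \<longleftrightarrow> s \<in> borel_measurable M \<and> (\<forall>x\<in>A. AE w in M. s w \<le> x w) \<and>
     (\<forall>u\<in>borel_measurable M. (\<forall>x\<in>A. AE w in M. u w \<le> x w) \<longrightarrow> (AE w in M. u w \<le> s w))"

lemma is_ess_inf_lower: "is_ess_inf M A s \<Longrightarrow> x \<in> A \<Longrightarrow> AE w in M. s w \<le> x w"
  by (simp add: is_ess_inf_def)

text \<open>Minus the essential supremum of the negated family, formed in \<open>ereal\<close>. A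
  member of \<open>A\<close> bounds that supremum from below and \<open>-l\<close> bounds it from
  above, so it is real almost everywhere.\<close>

lemma (in finite_measure) ess_inf_exists:
  fixes A :: "('a \<Rightarrow> real) set"
  assumes A: "A \<subseteq> borel_measurable M" "A \<noteq> {}"
    and l: "l \<in> borel_measurable M" "\<And>x. x \<in> A \<Longrightarrow> AE w in M. l w \<le> x w"
  obtains s where "is_ess_inf M A s"
proof -
  have "(\<lambda>x w. ereal (- x w)) ` A \<subseteq> borel_measurable M"
    using A by auto
  then obtain S where S: "S \<in> borel_measurable M"
    "\<And>x. x \<in> (\<lambda>x w. ereal (- x w)) ` A \<Longrightarrow> AE w in M. x w \<le> S w"
    "\<And>u. \<forall>x\<in>(\<lambda>x w. ereal (- x w)) ` A. AE w in M. x w \<le> u w \<Longrightarrow> AE w in M. S w \<le> u w"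
    by (rule ess_sup_exists) blast
  obtain a where a: "a \<in> A" using A by blast
  have "AE w in M. ereal (- a w) \<le> S w" using a by (intro S(2)) auto
  moreover have "AE w in M. S w \<le> ereal (- l w)"
    by (intro S(3)) (auto intro: AE_mp[OF l(2)])
  ultimately have fin: "AE w in M. S w = ereal (real_of_ereal (S w))"
  proof eventually_elim
    case (elim w)
    then show ?case by (cases "S w") auto
  qed
  have "is_ess_inf M A (\<lambda>w. - real_of_ereal (S w))"
    unfolding is_ess_inf_def
  proof (intro conjI ballI impI)
    show "(\<lambda>w. - real_of_ereal (S w)) \<in> borel_measurable M" using S(1) by measurable
    fix x assume "x \<in> A"
    then have "AE w in M. ereal (- x w) \<le> S w" by (intro S(2)) auto
    with fin show "AE w in M. - real_of_ereal (S w) \<le> x w"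
    proof eventually_elim
      case (elim w)
      then show ?case by (cases "S w") auto
    qed
  next
    fix u assume u: "\<forall>x\<in>A. AE w in M. u w \<le> x w"
    have "AE w in M. S w \<le> ereal (- u w)"
      by (intro S(3)) (use u in auto)
    with fin show "AE w in M. u w \<le> - real_of_ereal (S w)"
    proof eventually_elim
      case (elim w)
      then show ?case by (cases "S w") auto
    qed
  qed
  then show thesis by (rule that)
qed

text \<open>Separate from \<open>random_locally_convex_module\<close>, so that the sandwich theorem
  is purely algebraic and the neighbourhood lemmas also apply to \<open>L0 M\<close> as a module
  over itself.\<close>

locale L0_module = prob_space M + Module.module "L0 M" E
  for M :: "'w measure" and E :: "(('w \<Rightarrow> real) set, 'e, 'm) module_scheme"
begin

text \<open>Scalars are measurable functions rather than classes, so that indicators, quotients and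
  positive parts can be written pointwise. Measurable functions that are equal almost everywhere act
  alike.\<close>

definition sc :: "('w \<Rightarrow> real) \<Rightarrow> 'e \<Rightarrow> 'e" (infixr "\<star>" 75) where
  "t \<star> x = ae_class M t \<odot>\<^bsub>E\<^esub> x"

abbreviation rv :: "('w \<Rightarrow> real) \<Rightarrow> bool" where
  "rv t \<equiv> t \<in> borel_measurable M"

lemma sc_closed [simp, intro]: "rv t \<Longrightarrow> x \<in> carrier E \<Longrightarrow> t \<star> x \<in> carrier E"
  unfolding sc_def by (rule smult_closed) auto

lemma sc_add_left:
  assumes "rv s" "rv t" "x \<in> carrier E"
  shows "(\<lambda>w. s w + t w) \<star> x = s \<star> x \<oplus>\<^bsub>E\<^esub> t \<star> x"
  using smult_l_distr[of "ae_class M s" "ae_class M t" x] assms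
  by (simp add: sc_def ae_lift2_class)

lemma sc_add_right:
  assumes "rv s" "x \<in> carrier E" "y \<in> carrier E"
  shows "s \<star> (x \<oplus>\<^bsub>E\<^esub> y) = s \<star> x \<oplus>\<^bsub>E\<^esub> s \<star> y"
  using smult_r_distr[of "ae_class M s" x y] assms by (simp add: sc_def)

lemma sc_sc:
  assumes "rv s" "rv t" "x \<in> carrier E"
  shows "s \<star> t \<star> x = (\<lambda>w. s w * t w) \<star> x"
  using smult_assoc1[of "ae_class M s" "ae_class M t" x] assms
  by (simp add: sc_def ae_lift2_class)

lemma sc_one [simp]: "x \<in> carrier E \<Longrightarrow> (\<lambda>_. 1) \<star> x = x"
  using smult_one[of x] by (simp add: sc_def)

lemma sc_zero [simp]: "x \<in> carrier E \<Longrightarrow> (\<lambda>_. 0) \<star> x = \<zero>\<^bsub>E\<^esub>"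
  using smult_l_null[of x] by (simp add: sc_def)

lemma sc_zero_right [simp]: "rv t \<Longrightarrow> t \<star> \<zero>\<^bsub>E\<^esub> = \<zero>\<^bsub>E\<^esub>"
  using smult_r_null[of "ae_class M t"] by (simp add: sc_def)

lemma sc_minus:
  assumes "rv t" "x \<in> carrier E"
  shows "(\<lambda>w. - t w) \<star> x = \<ominus>\<^bsub>E\<^esub> (t \<star> x)"
proof -
  have "(\<lambda>w. - t w) \<star> x \<oplus>\<^bsub>E\<^esub> t \<star> x = (\<lambda>w. - t w + t w) \<star> x"
    using assms by (intro sc_add_left[symmetric]) auto
  also have "\<dots> = \<zero>\<^bsub>E\<^esub>" using assms by simp
  finally show ?thesis using assms by (metis M.minus_equality sc_closed borel_measurable_uminus)
qed

text \<open>Values are functions and all laws hold almost everywhere, which spares forming classes.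
  Homogeneity is only an inequality because that form passes easily to essential infima;
  \<open>sublinear_scale\<close> recovers equality.\<close>

definition sublinear :: "('e \<Rightarrow> 'w \<Rightarrow> real) \<Rightarrow> bool" where
  "sublinear p \<longleftrightarrow> (\<forall>x\<in>carrier E. rv (p x)) \<and>
     (\<forall>x\<in>carrier E. \<forall>y\<in>carrier E. AE w in M. p (x \<oplus>\<^bsub>E\<^esub> y) w \<le> p x w + p y w) \<and>
     (\<forall>t x. rv t \<longrightarrow> x \<in> carrier E \<longrightarrow> (\<forall>w. 0 \<le> t w) \<longrightarrow> (AE w in M. p (t \<star> x) w \<le> t w * p x w))"

definition linear :: "('e \<Rightarrow> 'w \<Rightarrow> real) \<Rightarrow> bool" where
  "linear g \<longleftrightarrow> (\<forall>x\<in>carrier E. rv (g x)) \<and>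
     (\<forall>x\<in>carrier E. \<forall>y\<in>carrier E. AE w in M. g (x \<oplus>\<^bsub>E\<^esub> y) w = g x w + g y w) \<and>
     (\<forall>t x. rv t \<longrightarrow> x \<in> carrier E \<longrightarrow> (AE w in M. g (t \<star> x) w = t w * g x w))"

text \<open>Only a preorder: maps that agree almost everywhere dominate each other. Minimality is
  therefore stated below as domination in return, not as equality.\<close>

definition dominated :: "('e \<Rightarrow> 'w \<Rightarrow> real) \<Rightarrow> ('e \<Rightarrow> 'w \<Rightarrow> real) \<Rightarrow> bool" where
  "dominated p q \<longleftrightarrow> (\<forall>x\<in>carrier E. AE w in M. p x w \<le> q x w)"

lemma dominated_refl: "dominated p p"
  by (simp add: dominated_def)

lemma dominated_trans: "dominated p q \<Longrightarrow> dominated q r \<Longrightarrow> dominated p r"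
  unfolding dominated_def
proof (intro ballI)
  fix x assume *: "\<forall>x\<in>carrier E. AE w in M. p x w \<le> q x w" "\<forall>x\<in>carrier E. AE w in M. q x w \<le> r x w"
    and x: "x \<in> carrier E"
  from *(1)[rule_format, OF x] *(2)[rule_format, OF x] show "AE w in M. p x w \<le> r x w"
    by eventually_elim simp
qed

lemma sublinear_rv: "sublinear p \<Longrightarrow> x \<in> carrier E \<Longrightarrow> rv (p x)"
  by (simp add: sublinear_def)

lemma sublinear_add:
  "sublinear p \<Longrightarrow> x \<in> carrier E \<Longrightarrow> y \<in> carrier E \<Longrightarrow> AE w in M. p (x \<oplus>\<^bsub>E\<^esub> y) w \<le> p x w + p y w"
  by (simp add: sublinear_def)

lemma sublinear_zero:
  assumes p: "sublinear p"
  shows "AE w in M. p \<zero>\<^bsub>E\<^esub> w = 0"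
proof -
  have "AE w in M. p ((\<lambda>_. 0) \<star> \<zero>\<^bsub>E\<^esub>) w \<le> 0 * p \<zero>\<^bsub>E\<^esub> w"
    using p[unfolded sublinear_def, THEN conjunct2, THEN conjunct2, rule_format, of "\<lambda>_. 0" "\<zero>\<^bsub>E\<^esub>"]
    by simp
  moreover have "AE w in M. p (\<zero>\<^bsub>E\<^esub> \<oplus>\<^bsub>E\<^esub> \<zero>\<^bsub>E\<^esub>) w \<le> p \<zero>\<^bsub>E\<^esub> w + p \<zero>\<^bsub>E\<^esub> w"
    using p by (intro sublinear_add) auto
  ultimately show ?thesis by eventually_elim simp
qed

lemma sublinear_minus:
  assumes p: "sublinear p" and x: "x \<in> carrier E"
  shows "AE w in M. 0 \<le> p x w + p (\<ominus>\<^bsub>E\<^esub> x) w"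
proof -
  have "AE w in M. p (x \<oplus>\<^bsub>E\<^esub> \<ominus>\<^bsub>E\<^esub> x) w \<le> p x w + p (\<ominus>\<^bsub>E\<^esub> x) w"
    using p x by (intro sublinear_add) auto
  then show ?thesis using sublinear_zero[OF p]
    by eventually_elim (use x in \<open>simp add: M.r_neg\<close>)
qed

text \<open>A scalar \<open>t\<close> with zeros cannot be inverted, but \<open>1 + t\<close> can.
  Scaling back from \<open>(1 + t) x\<close> gives \<open>(1 + t) * p x <= p ((1 + t) x)\<close>,
  and subadditivity bounds the right side by \<open>p x + p (t x)\<close>.\<close>

lemma sublinear_scale:
  assumes p: "sublinear p" and t: "rv t" "\<And>w. 0 \<le> t w" and x: "x \<in> carrier E"
  shows "AE w in M. p (t \<star> x) w = t w * p x w"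
proof -
  have up: "AE w in M. p (s \<star> y) w \<le> s w * p y w" if "rv s" "\<And>w. 0 \<le> s w" "y \<in> carrier E" for s y
    using p that by (auto simp: sublinear_def)
  let ?s = "\<lambda>w. 1 + t w"
  have pos: "0 < ?s w" for w using t(2)[of w] by linarith
  have s: "rv ?s" "rv (\<lambda>w. 1 / ?s w)" using t(1) by measurable
  have "(\<lambda>w. 1 / ?s w) \<star> ?s \<star> x = (\<lambda>w. 1 / ?s w * ?s w) \<star> x"
    using s x by (intro sc_sc) auto
  also have "\<dots> = (\<lambda>_. 1) \<star> x" using pos by (metis less_numeral_extra(3) nonzero_divide_eq_eq)
  finally have "x = (\<lambda>w. 1 / ?s w) \<star> ?s \<star> x" using x by simp
  moreover have "AE w in M. p ((\<lambda>w. 1 / ?s w) \<star> ?s \<star> x) w \<le> 1 / ?s w * p (?s \<star> x) w"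
    using s x pos by (intro up) (auto simp: less_imp_le)
  ultimately have 1: "AE w in M. p x w \<le> 1 / ?s w * p (?s \<star> x) w" by simp
  have "?s \<star> x = x \<oplus>\<^bsub>E\<^esub> t \<star> x"
    using sc_add_left[of "\<lambda>_. 1" t x] t x by simp
  then have 2: "AE w in M. p (?s \<star> x) w \<le> p x w + p (t \<star> x) w"
    using p t x by (auto intro: sublinear_add)
  show ?thesis
    using 1 2 up[OF t x]
  proof eventually_elim
    case (elim w)
    have "?s w * p x w \<le> p (?s \<star> x) w"
      using elim(1) pos[of w] by (simp add: field_simps)
    with elim show ?case by (simp add: algebra_simps)
  qed
qed

text \<open>Infima of candidate values are needed three times: along a chain, in one direction
  \<open>z\<close>, and in an infimal convolution. It is enough that candidates can be added and
  scaled up to domination; the bound \<open>l\<close> keeps the infimum real.\<close>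

lemma sublinear_ess_inf:
  fixes \<Phi> :: "'e \<Rightarrow> ('w \<Rightarrow> real) set"
  assumes rv: "\<And>x. x \<in> carrier E \<Longrightarrow> \<Phi> x \<subseteq> borel_measurable M"
    and ne: "\<And>x. x \<in> carrier E \<Longrightarrow> \<Phi> x \<noteq> {}"
    and l: "\<And>x. x \<in> carrier E \<Longrightarrow> rv (l x)"
      "\<And>x a. x \<in> carrier E \<Longrightarrow> a \<in> \<Phi> x \<Longrightarrow> AE w in M. l x w \<le> a w"
    and add: "\<And>x y a b. x \<in> carrier E \<Longrightarrow> y \<in> carrier E \<Longrightarrow> a \<in> \<Phi> x \<Longrightarrow> b \<in> \<Phi> y \<Longrightarrow>
      \<exists>c\<in>\<Phi> (x \<oplus>\<^bsub>E\<^esub> y). AE w in M. c w \<le> a w + b w"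
    and scale: "\<And>x t a. x \<in> carrier E \<Longrightarrow> rv t \<Longrightarrow> (\<And>w. 0 \<le> t w) \<Longrightarrow> a \<in> \<Phi> x \<Longrightarrow>
      \<exists>c\<in>\<Phi> (t \<star> x). AE w in M. c w \<le> t w * a w"
  obtains m where "sublinear m" "\<And>x. x \<in> carrier E \<Longrightarrow> is_ess_inf M (\<Phi> x) (m x)"
proof -
  have "\<exists>s. is_ess_inf M (\<Phi> x) s" if "x \<in> carrier E" for x
    using that ess_inf_exists[OF rv ne l] by metis
  then have "\<forall>x\<in>carrier E. \<exists>s. is_ess_inf M (\<Phi> x) s" by blast
  from bchoice[OF this] obtain m where m: "\<And>x. x \<in> carrier E \<Longrightarrow> is_ess_inf M (\<Phi> x) (m x)"
    by blast
  note mD = m[unfolded is_ess_inf_def]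
  have lower: "AE w in M. m x w \<le> a w" if "x \<in> carrier E" "a \<in> \<Phi> x" for x a
    using mD that by blast
  have great: "AE w in M. u w \<le> m x w" if "x \<in> carrier E" "rv u" "\<And>a. a \<in> \<Phi> x \<Longrightarrow> AE w in M. u w \<le> a w" for x u
    using mD that by blast
  have mrv: "rv (m x)" if "x \<in> carrier E" for x using mD that by blast
  have below: "AE w in M. m x w \<le> b w" if x: "x \<in> carrier E" and ex: "\<exists>c\<in>\<Phi> x. AE w in M. c w \<le> b w" for x b
  proof -
    from ex obtain c where c: "c \<in> \<Phi> x" "AE w in M. c w \<le> b w" by blast
    from lower[OF x c(1)] c(2) show ?thesis by eventually_elim simp
  qed
  have "sublinear m"
    unfolding sublinear_def
  proof (intro conjI ballI allI impI mrv)
    fix x y assume x: "x \<in> carrier E" and y: "y \<in> carrier E"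
    have xy: "x \<oplus>\<^bsub>E\<^esub> y \<in> carrier E" using x y by simp
    \<comment> \<open>The two arguments are treated one at a time: for fixed \<open>b\<close>,
      \<open>m (x + y) - b\<close> is a lower bound of the candidates at \<open>x\<close>, hence at
      most \<open>m x\<close>; then \<open>m (x + y) - m x\<close> is a lower bound of the
      candidates at \<open>y\<close>.\<close>
    have 1: "AE w in M. m (x \<oplus>\<^bsub>E\<^esub> y) w - b w \<le> m x w" if b: "b \<in> \<Phi> y" for b
    proof (rule great[OF x])
      show "rv (\<lambda>w. m (x \<oplus>\<^bsub>E\<^esub> y) w - b w)" using mrv[OF xy] rv[OF y] b by (intro borel_measurable_diff) auto
      fix a assume "a \<in> \<Phi> x"
      from below[OF xy add[OF x y this b]]
      show "AE w in M. m (x \<oplus>\<^bsub>E\<^esub> y) w - b w \<le> a w" by eventually_elim simp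
    qed
    have "AE w in M. m (x \<oplus>\<^bsub>E\<^esub> y) w - m x w \<le> b w" if "b \<in> \<Phi> y" for b
      using 1[OF that] by eventually_elim simp
    then have "AE w in M. m (x \<oplus>\<^bsub>E\<^esub> y) w - m x w \<le> m y w"
      using mrv[OF xy] mrv[OF x] by (intro great[OF y]) auto
    then show "AE w in M. m (x \<oplus>\<^bsub>E\<^esub> y) w \<le> m x w + m y w" by eventually_elim simp
  next
    fix t x assume t: "rv t" "\<forall>w. 0 \<le> t w" and x: "x \<in> carrier E"
    have tx: "t \<star> x \<in> carrier E" using t x by simp
    have le: "AE w in M. m (t \<star> x) w \<le> t w * a w" if "a \<in> \<Phi> x" for a
      using below[OF tx scale[OF x t(1) _ that]] t(2) by blast
    \<comment> \<open>Where \<open>t\<close> vanishes, division gives nothing. The filler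
      \<open>m x\<close> keeps the function a lower bound there, and on that event \<open>le\<close>
      with any single candidate already gives \<open>m (t x) <= 0\<close>.\<close>
    have 1: "AE w in M. (if 0 < t w then m (t \<star> x) w / t w else m x w) \<le> m x w"
    proof (rule great[OF x])
      show "rv (\<lambda>w. if 0 < t w then m (t \<star> x) w / t w else m x w)"
        using mrv[OF x] mrv[OF tx] t(1) by measurable
      fix a assume a: "a \<in> \<Phi> x"
      from le[OF a] lower[OF x a]
      show "AE w in M. (if 0 < t w then m (t \<star> x) w / t w else m x w) \<le> a w"
        by eventually_elim (auto simp: field_simps)
    qed
    obtain a where a: "a \<in> \<Phi> x" using ne[OF x] by blast
    from 1 le[OF a] show "AE w in M. m (t \<star> x) w \<le> t w * m x w"
    proof eventually_elim
      case (elim w)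
      show ?case
      proof (cases "0 < t w")
        case True
        with elim(1) show ?thesis by (simp add: field_simps)
      next
        case False
        then have "t w = 0" using t(2) by (meson antisym_conv2 not_le)
        with elim(2) show ?thesis by simp
      qed
    qed
  qed
  then show thesis using m by (rule that)
qed

text \<open>A maximal chain \<open>C\<close> below \<open>p0\<close> has an essential infimum that
  is again sublinear. It is minimal, because a sublinear map below it can be added to
  \<open>C\<close> and so belongs to \<open>C\<close>.\<close>

lemma minimal_sublinear_exists:
  assumes p0: "sublinear p0"
  obtains m where "sublinear m" "dominated m p0" "\<And>p. sublinear p \<Longrightarrow> dominated p m \<Longrightarrow> dominated m p"
proof -
  let ?A = "{p. sublinear p \<and> dominated p p0}"
  obtain C where C: "pred_on.maxchain ?A dominated C"
    using pred_on.Hausdorff by blast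
  then have chain: "pred_on.chain ?A dominated C"
    by (simp add: pred_on.maxchain_def)
  then have CA: "C \<subseteq> ?A" by (simp add: pred_on.chain_def)
  have tot: "dominated p q \<or> dominated q p" if "p \<in> C" "q \<in> C" for p q
    using pred_on.chain_total[OF chain that] dominated_refl by auto
  have max: "p \<in> C" if p: "p \<in> ?A" "\<And>q. q \<in> C \<Longrightarrow> dominated p q" for p
  proof -
    have "pred_on.chain ?A dominated (insert p C)"
      unfolding pred_on.chain_def using CA p tot dominated_refl by blast
    then show ?thesis using C unfolding pred_on.maxchain_def by blast
  qed
  \<comment> \<open>For an empty chain the second condition of \<open>max\<close> is vacuous, so
    \<open>p0\<close> itself would be a member.\<close>
  have ne: "C \<noteq> {}"
    using max[of p0] p0 dominated_refl by auto
  have add: "\<exists>c\<in>(\<lambda>p. p (x \<oplus>\<^bsub>E\<^esub> y)) ` C. AE w in M. c w \<le> a w + b w"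
    if x: "x \<in> carrier E" and y: "y \<in> carrier E" and a: "a \<in> (\<lambda>p. p x) ` C" and b: "b \<in> (\<lambda>p. p y) ` C"
    for x y a b
  proof -
    from a obtain p where p: "p \<in> C" "a = p x" by blast
    from b obtain q where q: "q \<in> C" "b = q y" by blast
    \<comment> \<open>In a chain one of \<open>p\<close> and \<open>q\<close> lies below both, and
      its subadditivity is inherited by the infimum.\<close>
    from tot[OF p(1) q(1)] obtain r where r: "r \<in> C" "dominated r p" "dominated r q"
      using p q dominated_refl by blast
    then have "sublinear r" using CA by blast
    from sublinear_add[OF this x y] have "AE w in M. r (x \<oplus>\<^bsub>E\<^esub> y) w \<le> r x w + r y w" .
    moreover have "AE w in M. r x w \<le> a w" "AE w in M. r y w \<le> b w"
      using r p q x y by (auto simp: dominated_def)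
    ultimately have "AE w in M. r (x \<oplus>\<^bsub>E\<^esub> y) w \<le> a w + b w"
      by eventually_elim simp
    then show ?thesis using r(1) by blast
  qed
  obtain m where m: "sublinear m" "\<And>x. x \<in> carrier E \<Longrightarrow> is_ess_inf M ((\<lambda>p. p x) ` C) (m x)"
  proof (rule sublinear_ess_inf[of "\<lambda>x. (\<lambda>p. p x) ` C" "\<lambda>x w. - p0 (\<ominus>\<^bsub>E\<^esub> x) w"])
    \<comment> \<open>The bound is common to the whole chain, since \<open>0 <= p x + p (-x)\<close>
      and \<open>p (-x) <= p0 (-x)\<close>.\<close>
    show "AE w in M. - p0 (\<ominus>\<^bsub>E\<^esub> x) w \<le> a w" if x: "x \<in> carrier E" and a: "a \<in> (\<lambda>p. p x) ` C" for x a
    proof -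
      from a obtain p where p: "p \<in> C" "a = p x" by blast
      then have sp: "sublinear p" "dominated p p0" using CA by auto
      then have "AE w in M. p (\<ominus>\<^bsub>E\<^esub> x) w \<le> p0 (\<ominus>\<^bsub>E\<^esub> x) w" using x by (auto simp: dominated_def)
      with sublinear_minus[OF sp(1) x] show ?thesis unfolding p(2) by eventually_elim simp
    qed
    show "\<exists>c\<in>(\<lambda>p. p (t \<star> x)) ` C. AE w in M. c w \<le> t w * a w"
      if "x \<in> carrier E" "rv t" "\<And>w. 0 \<le> t w" "a \<in> (\<lambda>p. p x) ` C" for x t a
    proof -
      from that(4) obtain p where p: "p \<in> C" "a = p x" by blast
      then have "sublinear p" using CA by blast
      from sublinear_scale[OF this that(2,3,1)]
      have "AE w in M. p (t \<star> x) w \<le> t w * a w" unfolding p(2) by eventually_elim simp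
      with p(1) show ?thesis by blast
    qed
  qed (use CA ne p0 add sublinear_rv in \<open>auto simp: subset_iff\<close>)
  have dom: "dominated m p" if "p \<in> C" for p
    using m(2) that by (auto simp: dominated_def is_ess_inf_def)
  show thesis
  proof (rule that[OF m(1)])
    show "dominated m p0"
      using ne dom CA dominated_trans by blast
    fix p assume p: "sublinear p" "dominated p m"
    have "p \<in> C"
      using p dom ne CA dominated_trans by (intro max) blast+
    then show "dominated m p" by (rule dom)
  qed
qed

text \<open>Minimality is tested against the infimum \<open>p x\<close> of
  \<open>m (x + t z) - t * m z\<close> over \<open>t >= 0\<close>. It is sublinear and below
  \<open>m\<close> by \<open>t = 0\<close>, so \<open>m\<close> is below \<open>p\<close>, and
  \<open>t = 1\<close> gives the inequality that subadditivity lacks.\<close>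

lemma minimal_sublinear_additive:
  assumes m: "sublinear m" and min: "\<And>p. sublinear p \<Longrightarrow> dominated p m \<Longrightarrow> dominated m p"
    and x: "x \<in> carrier E" and z: "z \<in> carrier E"
  shows "AE w in M. m (x \<oplus>\<^bsub>E\<^esub> z) w = m x w + m z w"
proof -
  define \<Phi> where "\<Phi> = (\<lambda>x. {\<lambda>w. m (x \<oplus>\<^bsub>E\<^esub> t \<star> z) w - t w * m z w | t. rv t \<and> (\<forall>w. 0 \<le> t w)})"
  have \<Phi>I: "(\<lambda>w. m (x \<oplus>\<^bsub>E\<^esub> t \<star> z) w - t w * m z w) \<in> \<Phi> x" if "rv t" "\<And>w. 0 \<le> t w" for x t
    using that by (auto simp: \<Phi>_def)
  have rv: "\<Phi> x \<subseteq> borel_measurable M" if "x \<in> carrier E" for x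
    using that z sublinear_rv[OF m] by (auto simp: \<Phi>_def intro!: borel_measurable_diff borel_measurable_times)
  have low: "AE w in M. - m (\<ominus>\<^bsub>E\<^esub> x) w \<le> a w" if x: "x \<in> carrier E" and a: "a \<in> \<Phi> x" for x a
  proof -
    from a obtain t where t: "rv t" "\<And>w. 0 \<le> t w" "a = (\<lambda>w. m (x \<oplus>\<^bsub>E\<^esub> t \<star> z) w - t w * m z w)"
      unfolding \<Phi>_def by auto
    have tz: "t \<star> z \<in> carrier E" using t z by simp
    have "(x \<oplus>\<^bsub>E\<^esub> t \<star> z) \<oplus>\<^bsub>E\<^esub> \<ominus>\<^bsub>E\<^esub> x = t \<star> z"
      using x tz by (simp add: M.a_ac M.r_neg2)
    then have "AE w in M. m (t \<star> z) w \<le> m (x \<oplus>\<^bsub>E\<^esub> t \<star> z) w + m (\<ominus>\<^bsub>E\<^esub> x) w"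
      using sublinear_add[OF m, of "x \<oplus>\<^bsub>E\<^esub> t \<star> z" "\<ominus>\<^bsub>E\<^esub> x"] x tz by simp
    with sublinear_scale[OF m t(1,2) z] show ?thesis unfolding t(3) by eventually_elim simp
  qed
  have add: "\<exists>c\<in>\<Phi> (x \<oplus>\<^bsub>E\<^esub> y). AE w in M. c w \<le> a w + b w"
    if x: "x \<in> carrier E" and y: "y \<in> carrier E" and a: "a \<in> \<Phi> x" and b: "b \<in> \<Phi> y" for x y a b
  proof -
    from a obtain t where t: "rv t" "\<And>w. 0 \<le> t w" "a = (\<lambda>w. m (x \<oplus>\<^bsub>E\<^esub> t \<star> z) w - t w * m z w)"
      unfolding \<Phi>_def by auto
    from b obtain s where s: "rv s" "\<And>w. 0 \<le> s w" "b = (\<lambda>w. m (y \<oplus>\<^bsub>E\<^esub> s \<star> z) w - s w * m z w)"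
      unfolding \<Phi>_def by auto
    have "(x \<oplus>\<^bsub>E\<^esub> y) \<oplus>\<^bsub>E\<^esub> (\<lambda>w. t w + s w) \<star> z = (x \<oplus>\<^bsub>E\<^esub> t \<star> z) \<oplus>\<^bsub>E\<^esub> (y \<oplus>\<^bsub>E\<^esub> s \<star> z)"
      using x y z t s by (simp add: sc_add_left M.a_ac)
    then have "AE w in M. m ((x \<oplus>\<^bsub>E\<^esub> y) \<oplus>\<^bsub>E\<^esub> (\<lambda>w. t w + s w) \<star> z) w
        \<le> m (x \<oplus>\<^bsub>E\<^esub> t \<star> z) w + m (y \<oplus>\<^bsub>E\<^esub> s \<star> z) w"
      using sublinear_add[OF m, of "x \<oplus>\<^bsub>E\<^esub> t \<star> z" "y \<oplus>\<^bsub>E\<^esub> s \<star> z"] x y z t s by simp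
    then have "AE w in M. m ((x \<oplus>\<^bsub>E\<^esub> y) \<oplus>\<^bsub>E\<^esub> (\<lambda>w. t w + s w) \<star> z) w - (t w + s w) * m z w \<le> a w + b w"
      unfolding t(3) s(3) by eventually_elim (simp add: algebra_simps)
    moreover have "(\<lambda>w. m ((x \<oplus>\<^bsub>E\<^esub> y) \<oplus>\<^bsub>E\<^esub> (\<lambda>w. t w + s w) \<star> z) w - (t w + s w) * m z w) \<in> \<Phi> (x \<oplus>\<^bsub>E\<^esub> y)"
      using t(1,2) s(1,2) by (intro \<Phi>I) (auto intro: add_nonneg_nonneg)
    ultimately show ?thesis by - (rule bexI)
  qed
  have scale: "\<exists>c\<in>\<Phi> (s \<star> x). AE w in M. c w \<le> s w * a w"
    if x: "x \<in> carrier E" and s: "rv s" "\<And>w. 0 \<le> s w" and a: "a \<in> \<Phi> x" for x s a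
  proof -
    from a obtain t where t: "rv t" "\<And>w. 0 \<le> t w" "a = (\<lambda>w. m (x \<oplus>\<^bsub>E\<^esub> t \<star> z) w - t w * m z w)"
      unfolding \<Phi>_def by auto
    have "s \<star> x \<oplus>\<^bsub>E\<^esub> (\<lambda>w. s w * t w) \<star> z = s \<star> (x \<oplus>\<^bsub>E\<^esub> t \<star> z)"
      using x z t s by (simp add: sc_add_right sc_sc)
    then have "AE w in M. m (s \<star> x \<oplus>\<^bsub>E\<^esub> (\<lambda>w. s w * t w) \<star> z) w = s w * m (x \<oplus>\<^bsub>E\<^esub> t \<star> z) w"
      using sublinear_scale[OF m s, of "x \<oplus>\<^bsub>E\<^esub> t \<star> z"] x z t s by simp
    then have "AE w in M. m (s \<star> x \<oplus>\<^bsub>E\<^esub> (\<lambda>w. s w * t w) \<star> z) w - (s w * t w) * m z w \<le> s w * a w"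
      unfolding t(3) by eventually_elim (simp add: algebra_simps)
    moreover have "(\<lambda>w. m (s \<star> x \<oplus>\<^bsub>E\<^esub> (\<lambda>w. s w * t w) \<star> z) w - (s w * t w) * m z w) \<in> \<Phi> (s \<star> x)"
      using t(1,2) s by (intro \<Phi>I) auto
    ultimately show ?thesis by - (rule bexI)
  qed
  obtain p where p: "sublinear p" "\<And>x. x \<in> carrier E \<Longrightarrow> is_ess_inf M (\<Phi> x) (p x)"
  proof (rule sublinear_ess_inf[of \<Phi> "\<lambda>x w. - m (\<ominus>\<^bsub>E\<^esub> x) w"])
    show "\<Phi> x \<noteq> {}" for x using \<Phi>I[of "\<lambda>_. 0"] by auto
    show "rv (\<lambda>w. - m (\<ominus>\<^bsub>E\<^esub> x) w)" if "x \<in> carrier E" for x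
      using that sublinear_rv[OF m] by auto
  qed (rule rv low add scale that; assumption)+
  have upper: "AE w in M. p x w \<le> m (x \<oplus>\<^bsub>E\<^esub> t \<star> z) w - t w * m z w"
    if "x \<in> carrier E" "rv t" "\<And>w. 0 \<le> t w" for x t
    by (rule is_ess_inf_lower[OF p(2)[OF that(1)] \<Phi>I[OF that(2,3)]])
  have "dominated p m"
    unfolding dominated_def
  proof
    fix x assume "x \<in> carrier E"
    then show "AE w in M. p x w \<le> m x w" using upper[of x "\<lambda>_. 0"] z by simp
  qed
  then have "dominated m p" by (rule min[OF p(1)])
  then have "AE w in M. m x w \<le> p x w" using x by (simp add: dominated_def)
  moreover have "AE w in M. p x w \<le> m (x \<oplus>\<^bsub>E\<^esub> z) w - m z w"
    using upper[OF x, of "\<lambda>_. 1"] z by simp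
  ultimately show ?thesis
    using sublinear_add[OF m x z] by eventually_elim simp
qed

text \<open>Additivity gives \<open>m (-x) = - m x\<close>, and a scalar of any sign is the
  difference of its positive and negative parts, to which \<open>sublinear_scale\<close>
  applies.\<close>

lemma additive_sublinear_linear:
  assumes m: "sublinear m"
    and add: "\<And>x y. x \<in> carrier E \<Longrightarrow> y \<in> carrier E \<Longrightarrow> AE w in M. m (x \<oplus>\<^bsub>E\<^esub> y) w = m x w + m y w"
  shows "linear m"
  unfolding linear_def
proof (intro conjI ballI allI impI add sublinear_rv[OF m])
  fix t x assume t: "rv t" and x: "x \<in> carrier E"
  let ?u = "\<lambda>w. max 0 (t w)" and ?v = "\<lambda>w. max 0 (- t w)"
  have uv: "rv ?u" "rv ?v" using t by measurable
  have "AE w in M. m (x \<oplus>\<^bsub>E\<^esub> \<ominus>\<^bsub>E\<^esub> x) w = m x w + m (\<ominus>\<^bsub>E\<^esub> x) w" using x by (intro add) auto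
  with sublinear_zero[OF m] have neg: "AE w in M. m (\<ominus>\<^bsub>E\<^esub> x) w = - m x w"
    by eventually_elim (use x in \<open>simp add: M.r_neg\<close>)
  have "?v \<star> (\<ominus>\<^bsub>E\<^esub> x) = (\<lambda>w. - ?v w) \<star> x"
    using sc_sc[OF uv(2), of "\<lambda>_. -1" x] sc_minus[of "\<lambda>_. 1" x] x by simp
  then have "?u \<star> x \<oplus>\<^bsub>E\<^esub> ?v \<star> (\<ominus>\<^bsub>E\<^esub> x) = (\<lambda>w. ?u w + - ?v w) \<star> x"
    using sc_add_left[of ?u "\<lambda>w. - ?v w" x] uv x by simp
  also have "(\<lambda>w. ?u w + - ?v w) = t" by (auto simp: max_def)
  finally have "AE w in M. m (t \<star> x) w = m (?u \<star> x) w + m (?v \<star> (\<ominus>\<^bsub>E\<^esub> x)) w"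
    using add[of "?u \<star> x" "?v \<star> (\<ominus>\<^bsub>E\<^esub> x)"] uv x by simp
  moreover have "AE w in M. m (?u \<star> x) w = ?u w * m x w"
    using uv x by (intro sublinear_scale[OF m]) auto
  moreover have "AE w in M. m (?v \<star> (\<ominus>\<^bsub>E\<^esub> x)) w = ?v w * m (\<ominus>\<^bsub>E\<^esub> x) w"
    using uv x by (intro sublinear_scale[OF m]) auto
  ultimately show "AE w in M. m (t \<star> x) w = t w * m x w"
    using neg by eventually_elim (auto simp: max_def)
qed

text \<open>Hahn-Banach in the form that extends nothing; in \<open>sandwich\<close> the constraint
  on \<open>C\<close> is built into the sublinear map instead.\<close>

lemma linear_below_sublinear:
  assumes "sublinear p"
  obtains g where "linear g" "dominated g p"
proof -
  obtain m where m: "sublinear m" "dominated m p" "\<And>p. sublinear p \<Longrightarrow> dominated p m \<Longrightarrow> dominated m p"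
    using minimal_sublinear_exists[OF assms] by blast
  have "linear m"
    using m(1) minimal_sublinear_additive[OF m(1,3)] by (rule additive_sublinear_linear)
  then show thesis using m(2) by (rule that)
qed

text \<open>The infimum \<open>p z\<close> of \<open>s * h y + p0 (z - s y)\<close> over
  \<open>s >= 0\<close> and \<open>y\<close> in \<open>C\<close> is the infimal convolution of
  \<open>p0\<close> with the conical hull of \<open>h\<close>. The hypothesis \<open>nonneg\<close>
  bounds it below by \<open>-p0 (-z)\<close>. A linear map below \<open>p\<close> is below
  \<open>p0\<close> (take \<open>s = 0\<close>) and below \<open>h\<close> on \<open>C\<close> (take
  \<open>s = 1\<close> and \<open>z = y\<close>).\<close>

theorem sandwich:
  assumes p0: "sublinear p0"
    and C: "C \<subseteq> carrier E" "C \<noteq> {}"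
      "\<And>x y t. x \<in> C \<Longrightarrow> y \<in> C \<Longrightarrow> rv t \<Longrightarrow> (\<And>w. 0 \<le> t w \<and> t w \<le> 1) \<Longrightarrow>
         t \<star> x \<oplus>\<^bsub>E\<^esub> (\<lambda>w. 1 - t w) \<star> y \<in> C"
    and h: "\<And>x. x \<in> C \<Longrightarrow> rv (h x)"
      "\<And>x y t. x \<in> C \<Longrightarrow> y \<in> C \<Longrightarrow> rv t \<Longrightarrow> (\<And>w. 0 \<le> t w \<and> t w \<le> 1) \<Longrightarrow>
         AE w in M. h (t \<star> x \<oplus>\<^bsub>E\<^esub> (\<lambda>w. 1 - t w) \<star> y) w \<le> t w * h x w + (1 - t w) * h y w"
    and nonneg: "\<And>y. y \<in> C \<Longrightarrow> AE w in M. 0 \<le> h y w + p0 (\<ominus>\<^bsub>E\<^esub> y) w"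
  obtains g where "linear g" "dominated g p0" "\<And>y. y \<in> C \<Longrightarrow> AE w in M. g y w \<le> h y w"
proof -
  define \<Phi> where "\<Phi> = (\<lambda>z. {\<lambda>w. s w * h y w + p0 (z \<oplus>\<^bsub>E\<^esub> s \<star> (\<ominus>\<^bsub>E\<^esub> y)) w | s y.
    rv s \<and> (\<forall>w. 0 \<le> s w) \<and> y \<in> C})"
  have \<Phi>I: "(\<lambda>w. s w * h y w + p0 (z \<oplus>\<^bsub>E\<^esub> s \<star> (\<ominus>\<^bsub>E\<^esub> y)) w) \<in> \<Phi> z"
    if "rv s" "\<And>w. 0 \<le> s w" "y \<in> C" for s y z
    using that by (auto simp: \<Phi>_def)
  have CE: "y \<in> carrier E" if "y \<in> C" for y using that C by blast
  have rv: "\<Phi> z \<subseteq> borel_measurable M" if "z \<in> carrier E" for z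
    using that CE h(1) sublinear_rv[OF p0]
    by (auto simp: \<Phi>_def intro!: borel_measurable_add borel_measurable_times)
  have low: "AE w in M. - p0 (\<ominus>\<^bsub>E\<^esub> z) w \<le> a w" if z: "z \<in> carrier E" and a: "a \<in> \<Phi> z" for z a
  proof -
    from a obtain s y where s: "rv s" "\<And>w. 0 \<le> s w" and y: "y \<in> C"
      and a_eq: "a = (\<lambda>w. s w * h y w + p0 (z \<oplus>\<^bsub>E\<^esub> s \<star> (\<ominus>\<^bsub>E\<^esub> y)) w)"
      unfolding \<Phi>_def by auto
    have sy: "s \<star> (\<ominus>\<^bsub>E\<^esub> y) \<in> carrier E" using s y CE by simp
    have "(z \<oplus>\<^bsub>E\<^esub> s \<star> (\<ominus>\<^bsub>E\<^esub> y)) \<oplus>\<^bsub>E\<^esub> \<ominus>\<^bsub>E\<^esub> z = s \<star> (\<ominus>\<^bsub>E\<^esub> y)"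
      using z sy by (simp add: M.a_ac M.r_neg2)
    then have "AE w in M. p0 (s \<star> (\<ominus>\<^bsub>E\<^esub> y)) w \<le> p0 (z \<oplus>\<^bsub>E\<^esub> s \<star> (\<ominus>\<^bsub>E\<^esub> y)) w + p0 (\<ominus>\<^bsub>E\<^esub> z) w"
      using sublinear_add[OF p0, of "z \<oplus>\<^bsub>E\<^esub> s \<star> (\<ominus>\<^bsub>E\<^esub> y)" "\<ominus>\<^bsub>E\<^esub> z"] z sy by simp
    moreover have "AE w in M. p0 (s \<star> (\<ominus>\<^bsub>E\<^esub> y)) w = s w * p0 (\<ominus>\<^bsub>E\<^esub> y) w"
      using s CE[OF y] by (intro sublinear_scale[OF p0]) auto
    ultimately show ?thesis using nonneg[OF y] unfolding a_eq
    proof eventually_elim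
      case (elim w)
      have "0 \<le> s w * (h y w + p0 (\<ominus>\<^bsub>E\<^esub> y) w)" using elim(3) s(2) by simp
      then have "0 \<le> s w * h y w + s w * p0 (\<ominus>\<^bsub>E\<^esub> y) w" by (simp add: distrib_left)
      with elim show ?case by linarith
    qed
  qed
  have add: "\<exists>c\<in>\<Phi> (u \<oplus>\<^bsub>E\<^esub> v). AE w in M. c w \<le> a w + b w"
    if u: "u \<in> carrier E" and v: "v \<in> carrier E" and a: "a \<in> \<Phi> u" and b: "b \<in> \<Phi> v" for u v a b
  proof -
    from a obtain s x where s: "rv s" "\<And>w. 0 \<le> s w" and x: "x \<in> C"
      and a_eq: "a = (\<lambda>w. s w * h x w + p0 (u \<oplus>\<^bsub>E\<^esub> s \<star> (\<ominus>\<^bsub>E\<^esub> x)) w)"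
      unfolding \<Phi>_def by auto
    from b obtain t y where t: "rv t" "\<And>w. 0 \<le> t w" and y: "y \<in> C"
      and b_eq: "b = (\<lambda>w. t w * h y w + p0 (v \<oplus>\<^bsub>E\<^esub> t \<star> (\<ominus>\<^bsub>E\<^esub> y)) w)"
      unfolding \<Phi>_def by auto
    \<comment> \<open>Two conical multiples merge into one: \<open>s x + t y\<close> is
      \<open>s + t\<close> times a convex combination of \<open>x\<close> and \<open>y\<close>, and
      convexity of \<open>C\<close> and \<open>h\<close> makes it a candidate.\<close>
    let ?r = "\<lambda>w. s w + t w" and ?q = "\<lambda>w. s w / (s w + t w)"
    \<comment> \<open>Where \<open>s + t = 0\<close> the quotient is \<open>0\<close>, and both identities below still hold.\<close>
    let ?z = "?q \<star> x \<oplus>\<^bsub>E\<^esub> (\<lambda>w. 1 - ?q w) \<star> y"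
    have r: "rv ?r" "\<And>w. 0 \<le> ?r w" using s t by auto
    have q: "rv ?q" "\<And>w. 0 \<le> ?q w \<and> ?q w \<le> 1"
      using s t by (auto simp: divide_le_eq_1 intro!: divide_nonneg_nonneg add_nonneg_nonneg)
         (use s(2) t(2) in \<open>smt (verit)\<close>)+
    have rq: "?r w * ?q w = s w" "?r w * (1 - ?q w) = t w" for w
      using s(2)[of w] t(2)[of w] by (cases "s w + t w = 0"; simp add: field_simps)+
    have z: "?z \<in> C" using x y q by (rule C(3))
    have "\<ominus>\<^bsub>E\<^esub> ?z = ?q \<star> (\<ominus>\<^bsub>E\<^esub> x) \<oplus>\<^bsub>E\<^esub> (\<lambda>w. 1 - ?q w) \<star> (\<ominus>\<^bsub>E\<^esub> y)"
    proof -
      have "\<ominus>\<^bsub>E\<^esub> (k \<star> e) = k \<star> (\<ominus>\<^bsub>E\<^esub> e)" if k: "rv k" and e: "e \<in> carrier E" for k e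
        using sc_sc[OF k, of "\<lambda>_. -1" e] sc_minus[of "\<lambda>_. 1" e] sc_minus[OF k e] e by simp
      then show ?thesis using q x y CE by (simp add: M.minus_add)
    qed
    then have "?r \<star> (\<ominus>\<^bsub>E\<^esub> ?z)
        = (\<lambda>w. ?r w * ?q w) \<star> (\<ominus>\<^bsub>E\<^esub> x) \<oplus>\<^bsub>E\<^esub> (\<lambda>w. ?r w * (1 - ?q w)) \<star> (\<ominus>\<^bsub>E\<^esub> y)"
      using q r x y CE by (simp add: sc_add_right sc_sc)
    then have "?r \<star> (\<ominus>\<^bsub>E\<^esub> ?z) = s \<star> (\<ominus>\<^bsub>E\<^esub> x) \<oplus>\<^bsub>E\<^esub> t \<star> (\<ominus>\<^bsub>E\<^esub> y)"
      by (simp only: rq)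
    then have eq: "(u \<oplus>\<^bsub>E\<^esub> v) \<oplus>\<^bsub>E\<^esub> ?r \<star> (\<ominus>\<^bsub>E\<^esub> ?z)
        = (u \<oplus>\<^bsub>E\<^esub> s \<star> (\<ominus>\<^bsub>E\<^esub> x)) \<oplus>\<^bsub>E\<^esub> (v \<oplus>\<^bsub>E\<^esub> t \<star> (\<ominus>\<^bsub>E\<^esub> y))"
      using u v x y CE s t by (simp add: M.a_ac)
    have "AE w in M. p0 ((u \<oplus>\<^bsub>E\<^esub> v) \<oplus>\<^bsub>E\<^esub> ?r \<star> (\<ominus>\<^bsub>E\<^esub> ?z)) w
        \<le> p0 (u \<oplus>\<^bsub>E\<^esub> s \<star> (\<ominus>\<^bsub>E\<^esub> x)) w + p0 (v \<oplus>\<^bsub>E\<^esub> t \<star> (\<ominus>\<^bsub>E\<^esub> y)) w"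
      unfolding eq using u v x y CE s t by (intro sublinear_add[OF p0]) auto
    moreover have "AE w in M. h ?z w \<le> ?q w * h x w + (1 - ?q w) * h y w"
      using x y q by (rule h(2))
    ultimately have "AE w in M. ?r w * h ?z w + p0 ((u \<oplus>\<^bsub>E\<^esub> v) \<oplus>\<^bsub>E\<^esub> ?r \<star> (\<ominus>\<^bsub>E\<^esub> ?z)) w \<le> a w + b w"
      unfolding a_eq b_eq
    proof eventually_elim
      case (elim w)
      have "?r w * h ?z w \<le> ?r w * (?q w * h x w + (1 - ?q w) * h y w)"
        using elim(2) r(2)[of w] by (rule mult_left_mono)
      also have "\<dots> = (?r w * ?q w) * h x w + (?r w * (1 - ?q w)) * h y w"
        by (simp only: distrib_left mult.assoc)
      also have "\<dots> = s w * h x w + t w * h y w" by (simp only: rq)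
      finally show ?case using elim(1) by linarith
    qed
    then show ?thesis using \<Phi>I[OF r z] by - (rule bexI)
  qed
  have scale: "\<exists>c\<in>\<Phi> (t \<star> z). AE w in M. c w \<le> t w * a w"
    if z: "z \<in> carrier E" and t: "rv t" "\<And>w. 0 \<le> t w" and a: "a \<in> \<Phi> z" for z t a
  proof -
    from a obtain s y where s: "rv s" "\<And>w. 0 \<le> s w" and y: "y \<in> C"
      and a_eq: "a = (\<lambda>w. s w * h y w + p0 (z \<oplus>\<^bsub>E\<^esub> s \<star> (\<ominus>\<^bsub>E\<^esub> y)) w)"
      unfolding \<Phi>_def by auto
    have "t \<star> z \<oplus>\<^bsub>E\<^esub> (\<lambda>w. t w * s w) \<star> (\<ominus>\<^bsub>E\<^esub> y) = t \<star> (z \<oplus>\<^bsub>E\<^esub> s \<star> (\<ominus>\<^bsub>E\<^esub> y))"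
      using z y CE t s by (simp add: sc_add_right sc_sc)
    then have "AE w in M. p0 (t \<star> z \<oplus>\<^bsub>E\<^esub> (\<lambda>w. t w * s w) \<star> (\<ominus>\<^bsub>E\<^esub> y)) w = t w * p0 (z \<oplus>\<^bsub>E\<^esub> s \<star> (\<ominus>\<^bsub>E\<^esub> y)) w"
      using sublinear_scale[OF p0 t, of "z \<oplus>\<^bsub>E\<^esub> s \<star> (\<ominus>\<^bsub>E\<^esub> y)"] z y CE t s by simp
    then have "AE w in M. (t w * s w) * h y w + p0 (t \<star> z \<oplus>\<^bsub>E\<^esub> (\<lambda>w. t w * s w) \<star> (\<ominus>\<^bsub>E\<^esub> y)) w \<le> t w * a w"
      unfolding a_eq by eventually_elim (simp add: algebra_simps)
    moreover have "(\<lambda>w. (t w * s w) * h y w + p0 (t \<star> z \<oplus>\<^bsub>E\<^esub> (\<lambda>w. t w * s w) \<star> (\<ominus>\<^bsub>E\<^esub> y)) w) \<in> \<Phi> (t \<star> z)"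
      using t s y by (intro \<Phi>I) auto
    ultimately show ?thesis by - (rule bexI)
  qed
  obtain p where p: "sublinear p" "\<And>x. x \<in> carrier E \<Longrightarrow> is_ess_inf M (\<Phi> x) (p x)"
  proof (rule sublinear_ess_inf[of \<Phi> "\<lambda>x w. - p0 (\<ominus>\<^bsub>E\<^esub> x) w"])
    show "\<Phi> x \<noteq> {}" for x using \<Phi>I[of "\<lambda>_. 0"] C(2) by auto
    show "rv (\<lambda>w. - p0 (\<ominus>\<^bsub>E\<^esub> x) w)" if "x \<in> carrier E" for x
      using that sublinear_rv[OF p0] by auto
  qed (rule rv low add scale that; assumption)+
  have upper: "AE w in M. p z w \<le> s w * h y w + p0 (z \<oplus>\<^bsub>E\<^esub> s \<star> (\<ominus>\<^bsub>E\<^esub> y)) w"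
    if "z \<in> carrier E" "rv s" "\<And>w. 0 \<le> s w" "y \<in> C" for z s y
    by (rule is_ess_inf_lower[OF p(2)[OF that(1)] \<Phi>I[OF that(2-4)]])
  obtain y0 where y0: "y0 \<in> C" using C(2) by blast
  have "dominated p p0"
    unfolding dominated_def
  proof
    fix x assume "x \<in> carrier E"
    then show "AE w in M. p x w \<le> p0 x w" using upper[of x "\<lambda>_. 0" y0] y0 CE by simp
  qed
  moreover have "AE w in M. p y w \<le> h y w" if y: "y \<in> C" for y
  proof -
    have "AE w in M. p y w \<le> h y w + p0 \<zero>\<^bsub>E\<^esub> w"
      using upper[of y "\<lambda>_. 1" y] y CE by (simp add: M.r_neg)
    with sublinear_zero[OF p0] show ?thesis by eventually_elim simp
  qed
  moreover obtain g where g: "linear g" "dominated g p"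
    using linear_below_sublinear[OF p(1)] .
  ultimately show thesis
  proof (intro that[of g])
    assume *: "\<And>y. y \<in> C \<Longrightarrow> AE w in M. p y w \<le> h y w"
    fix y assume y: "y \<in> C"
    have "AE w in M. g y w \<le> p y w" using g(2) CE[OF y] by (simp add: dominated_def)
    with *[OF y] show "AE w in M. g y w \<le> h y w" by eventually_elim simp
  qed (use dominated_trans in blast)+
qed

end

section \<open>Seminorms, neighbourhoods and the dual\<close>

lemma (in finite_measure) L0bar_sup:
  assumes A: "A \<subseteq> ae_classes M"
  shows L0bar_sup_closed: "\<Squnion>\<^bsub>L0bar M\<^esub> A \<in> ae_classes M"
    and L0bar_sup_upper: "X \<in> A \<Longrightarrow> AE w in M. ae_rep X w \<le> ae_rep (\<Squnion>\<^bsub>L0bar M\<^esub> A) w"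
    and L0bar_sup_least: "u \<in> borel_measurable M \<Longrightarrow> (\<And>X. X \<in> A \<Longrightarrow> AE w in M. ae_rep X w \<le> u w) \<Longrightarrow>
      AE w in M. ae_rep (\<Squnion>\<^bsub>L0bar M\<^esub> A) w \<le> u w"
proof -
  interpret L: complete_lattice "L0bar M" by (rule complete_lattice_L0bar)
  have A': "A \<subseteq> carrier (L0bar M)" using A by simp
  show "\<Squnion>\<^bsub>L0bar M\<^esub> A \<in> ae_classes M" using L.sup_closed[OF A'] by simp
  show "AE w in M. ae_rep X w \<le> ae_rep (\<Squnion>\<^bsub>L0bar M\<^esub> A) w" if "X \<in> A"
    using L.sup_upper[OF A' that] by (simp add: ae_le_def)
  show "AE w in M. ae_rep (\<Squnion>\<^bsub>L0bar M\<^esub> A) w \<le> u w"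
    if u: "u \<in> borel_measurable M" "\<And>X. X \<in> A \<Longrightarrow> AE w in M. ae_rep X w \<le> u w"
  proof -
    note ru = ae_rep_class[OF u(1)]
    have "ae_le M X (ae_class M u)" if "X \<in> A" for X
      using u(2)[OF that] ru(2) unfolding ae_le_def by eventually_elim simp
    then have "ae_le M (\<Squnion>\<^bsub>L0bar M\<^esub> A) (ae_class M u)"
      using L.sup_least[OF A', of "ae_class M u"] u(1) by simp
    then show ?thesis using ru(2) unfolding ae_le_def by eventually_elim simp
  qed
qed

lemma ae_lift1_rep:
  assumes "X \<in> ae_classes M" "h \<in> borel_measurable borel"
  shows "AE w in M. ae_rep (ae_lift1 M h X) w = h (ae_rep X w)"
  unfolding ae_lift1_def
  using assms ae_class_rep(1)[OF assms(1)] by (intro ae_rep_class(2)) (auto intro: measurable_compose)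

lemma ae_lift1_in:
  assumes "X \<in> ae_classes M" "h \<in> borel_measurable borel"
  shows "ae_lift1 M h X \<in> ae_classes M"
  unfolding ae_lift1_def
  using assms ae_class_rep(1)[OF assms(1)] by (intro ae_class_in) (auto intro: measurable_compose)

lemma ae_lift2_rep:
  assumes "X \<in> ae_classes M" "Y \<in> ae_classes M"
    and "\<And>u v. u \<in> borel_measurable M \<Longrightarrow> v \<in> borel_measurable M \<Longrightarrow>
      (\<lambda>w. h (u w) (v w)) \<in> borel_measurable M"
  shows "AE w in M. ae_rep (ae_lift2 M h X Y) w = h (ae_rep X w) (ae_rep Y w)"
  unfolding ae_lift2_def
  using assms ae_class_rep(1)[OF assms(1)] ae_class_rep(1)[OF assms(2)] by (intro ae_rep_class(2)) auto

lemma ae_lift2_in: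
  assumes "X \<in> ae_classes M" "Y \<in> ae_classes M"
    and "\<And>u v. u \<in> borel_measurable M \<Longrightarrow> v \<in> borel_measurable M \<Longrightarrow>
      (\<lambda>w. h (u w) (v w)) \<in> borel_measurable M"
  shows "ae_lift2 M h X Y \<in> ae_classes M"
  unfolding ae_lift2_def
  using assms ae_class_rep(1)[OF assms(1)] ae_class_rep(1)[OF assms(2)] by (intro ae_class_in) auto

lemma ae_class_minus:
  assumes "s \<in> borel_measurable M" "t \<in> borel_measurable M"
  shows "ae_class M s \<ominus>\<^bsub>L0 M\<^esub> ae_class M t = ae_class M (\<lambda>w. s w - t w :: real)"
proof -
  interpret cring "L0 M" by (rule cring_L0)
  have "ae_class M (\<lambda>w. - t w) \<oplus>\<^bsub>L0 M\<^esub> ae_class M t = \<zero>\<^bsub>L0 M\<^esub>"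
    using assms by (simp add: ae_lift2_class)
  then have "\<ominus>\<^bsub>L0 M\<^esub> ae_class M t = ae_class M (\<lambda>w. - t w)"
    using assms by (intro minus_equality) auto
  then show ?thesis using assms by (simp add: a_minus_def ae_lift2_class)
qed

section \<open>Seminorms and basic neighbourhoods through representatives\<close>

context L0_module
begin

lemma seminorm_rv:
  assumes "L0_seminorm M E n" "x \<in> carrier E"
  shows "n x \<in> ae_classes M" "rv (ae_rep (n x))"
  using assms ae_class_rep(1)[of "n x" M] by (auto simp: L0_seminorm_def)

lemma seminorm_nonneg:
  assumes n: "L0_seminorm M E n" "x \<in> carrier E"
  shows "AE w in M. 0 \<le> ae_rep (n x) w"
proof -
  have "ae_le M (ae_class M (\<lambda>_. 0)) (n x)" using n by (simp add: L0_seminorm_def)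
  moreover have "AE w in M. ae_rep (ae_class M (\<lambda>_. 0::real)) w = 0"
    by (rule ae_rep_class(2)) simp
  ultimately show ?thesis unfolding ae_le_def by eventually_elim simp
qed

lemma seminorm_scale:
  assumes n: "L0_seminorm M E n" "x \<in> carrier E" and t: "rv t"
  shows "AE w in M. ae_rep (n (t \<star> x)) w = \<bar>t w\<bar> * ae_rep (n x) w"
proof -
  have "n (t \<star> x) = ae_lift1 M abs (ae_class M t) \<otimes>\<^bsub>L0 M\<^esub> n x"
    using n t unfolding sc_def L0_seminorm_def by simp
  also have "\<dots> = ae_lift2 M (*) (ae_class M (\<lambda>w. \<bar>t w\<bar>)) (n x)"
    using t by (simp add: ae_lift1_class)
  finally have "AE w in M. ae_rep (n (t \<star> x)) w = ae_rep (ae_class M (\<lambda>w. \<bar>t w\<bar>)) w * ae_rep (n x) w"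
    using ae_lift2_rep[of "ae_class M (\<lambda>w. \<bar>t w\<bar>)" M "n x" "(*)"] seminorm_rv[OF n] t by simp
  moreover have "AE w in M. ae_rep (ae_class M (\<lambda>w. \<bar>t w\<bar>)) w = \<bar>t w\<bar>"
    using t by (intro ae_rep_class(2)) simp
  ultimately show ?thesis by eventually_elim simp
qed

lemma seminorm_triangle:
  assumes n: "L0_seminorm M E n" and x: "x \<in> carrier E" and y: "y \<in> carrier E"
  shows "AE w in M. ae_rep (n (x \<oplus>\<^bsub>E\<^esub> y)) w \<le> ae_rep (n x) w + ae_rep (n y) w"
proof -
  have "ae_le M (n (x \<oplus>\<^bsub>E\<^esub> y)) (ae_lift2 M (+) (n x) (n y))"
    using n x y by (simp add: L0_seminorm_def)
  moreover have "AE w in M. ae_rep (ae_lift2 M (+) (n x) (n y)) w = ae_rep (n x) w + ae_rep (n y) w"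
    using seminorm_rv[OF n x] seminorm_rv[OF n y] by (intro ae_lift2_rep) auto
  ultimately show ?thesis unfolding ae_le_def by eventually_elim simp
qed

lemma minus_as_scale: "x \<in> carrier E \<Longrightarrow> \<ominus>\<^bsub>E\<^esub> x = (\<lambda>_. -1) \<star> x"
  using sc_minus[of "\<lambda>_. 1" x] by simp

lemma seminorm_minus:
  assumes n: "L0_seminorm M E n" "x \<in> carrier E"
  shows "AE w in M. ae_rep (n (\<ominus>\<^bsub>E\<^esub> x)) w = ae_rep (n x) w"
  using seminorm_scale[OF n, of "\<lambda>_. -1"] n(2) by (simp add: minus_as_scale)

text \<open>For a finite nonempty \<open>Q\<close> the essential supremum in \<open>sup_norm\<close>
  is a pointwise maximum, so it is below \<epsilon> exactly where every seminorm in \<open>Q\<close>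
  is.\<close>

lemma in_el_nhd_iff:
  assumes Q: "finite Q" "Q \<noteq> {}" "\<And>n. n \<in> Q \<Longrightarrow> L0_seminorm M E n" and x: "x \<in> carrier E"
  shows "x \<in> el_nhd M E Q \<epsilon> \<delta> \<longleftrightarrow> 1 - \<delta> < prob {w \<in> space M. \<forall>n\<in>Q. ae_rep (n x) w < \<epsilon>}"
proof -
  let ?N = "\<lambda>w. Max ((\<lambda>n. ae_rep (n x) w) ` Q)"
  let ?A = "(\<lambda>n. of_L0 M (n x)) ` Q"
  have rvn: "n x \<in> ae_classes M" "rv (ae_rep (n x))" if "n \<in> Q" for n
    using seminorm_rv[OF Q(3)[OF that] x] .
  have A: "?A \<subseteq> ae_classes M" using rvn by (auto intro!: ae_lift1_in)
  have N: "rv ?N" using rvn Q(1) by (intro borel_measurable_Max) auto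
  have rep: "AE w in M. ae_rep (of_L0 M (n x)) w = ereal (ae_rep (n x) w)" if "n \<in> Q" for n
    using rvn[OF that] by (intro ae_lift1_rep) auto
  have "AE w in M. ae_rep (sup_norm M Q x) w \<le> ereal (?N w)"
    unfolding sup_norm_def
  proof (rule L0bar_sup_least[OF A])
    fix X assume "X \<in> ?A"
    then obtain n where n: "n \<in> Q" "X = of_L0 M (n x)" by blast
    from rep[OF n(1)] show "AE w in M. ae_rep X w \<le> ereal (?N w)"
      unfolding n(2) by eventually_elim (use Q(1) n(1) in simp)
  qed (use N in simp)
  moreover have "AE w in M. \<forall>n\<in>Q. ereal (ae_rep (n x) w) \<le> ae_rep (sup_norm M Q x) w"
    unfolding sup_norm_def
  proof (rule AE_finite_allI[OF Q(1)])
    fix n assume n: "n \<in> Q"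
    then have "of_L0 M (n x) \<in> ?A" by blast
    from L0bar_sup_upper[OF A this] rep[OF n]
    show "AE w in M. ereal (ae_rep (n x) w) \<le> ae_rep (\<Squnion>\<^bsub>L0bar M\<^esub> ?A) w" by eventually_elim simp
  qed
  ultimately have "AE w in M. ae_rep (sup_norm M Q x) w < ereal \<epsilon> \<longleftrightarrow> (\<forall>n\<in>Q. ae_rep (n x) w < \<epsilon>)"
  proof eventually_elim
    case (elim w)
    have "(\<forall>n\<in>Q. ae_rep (n x) w < \<epsilon>) \<longleftrightarrow> ereal (?N w) < ereal \<epsilon>"
      using Q(1,2) by simp
    moreover have "ereal (?N w) \<le> ae_rep (sup_norm M Q x) w"
    proof -
      have "?N w \<in> (\<lambda>n. ae_rep (n x) w) ` Q" using Q(1,2) by (intro Max_in) auto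
      then show ?thesis using elim(2) by auto
    qed
    ultimately show ?case using elim(1) by (metis order_antisym)
  qed
  then have "prob {w \<in> space M. ae_rep (sup_norm M Q x) w < ereal \<epsilon>}
      = prob {w \<in> space M. \<forall>n\<in>Q. ae_rep (n x) w < \<epsilon>}"
  proof (rule prob_eq_AE)
    have [measurable]: "ae_rep (sup_norm M Q x) \<in> borel_measurable M"
      unfolding sup_norm_def by (rule ae_class_rep(1)[OF L0bar_sup_closed[OF A]])
    show "{w \<in> space M. ae_rep (sup_norm M Q x) w < ereal \<epsilon>} \<in> events" by measurable
    have "{w \<in> space M. ae_rep (n x) w < \<epsilon>} \<in> events" if "n \<in> Q" for n
      using rvn(2)[OF that] by measurable
    then show "{w \<in> space M. \<forall>n\<in>Q. ae_rep (n x) w < \<epsilon>} \<in> events"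
      using Q(1,2) by (intro sets.sets_Collect_finite_All') auto
  qed
  then show ?thesis using x by (simp add: el_nhd_def)
qed

text \<open>Stated for a bare family of seminorms, so that it can be applied to \<open>L0 M\<close>
  with the absolute value as its only seminorm.\<close>

lemma openin_carrier:
  assumes "n \<in> P" "\<And>n. n \<in> P \<Longrightarrow> L0_seminorm M E n"
  shows "openin (el_topology M E P) (carrier E)"
proof (subst openin_el_topology)
  show "\<And>n. n \<in> P \<Longrightarrow> L0_seminorm M E n" by (rule assms)
next
  show "carrier E \<subseteq> carrier E \<and> (\<forall>x\<in>carrier E. \<exists>Q \<epsilon> \<delta>. Q \<subseteq> P \<and> finite Q \<and> Q \<noteq> {} \<and>
      0 < \<epsilon> \<and> 0 < \<delta> \<and> \<delta> < 1 \<and> (\<forall>z\<in>el_nhd M E Q \<epsilon> \<delta>. x \<oplus>\<^bsub>E\<^esub> z \<in> carrier E))"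
  proof (intro conjI ballI subset_refl)
  fix x assume "x \<in> carrier E"
  then show "\<exists>Q \<epsilon> \<delta>. Q \<subseteq> P \<and> finite Q \<and> Q \<noteq> {} \<and> 0 < \<epsilon> \<and> 0 < \<delta> \<and> \<delta> < 1 \<and>
      (\<forall>z\<in>el_nhd M E Q \<epsilon> \<delta>. x \<oplus>\<^bsub>E\<^esub> z \<in> carrier E)"
    using assms(1)
    by (intro exI[of _ "{n}"] exI[of _ "1::real"] exI[of _ "1/2::real"]) (auto simp: el_nhd_def)
  qed
qed

end

section \<open>Convergence in probability on \<open>L0 M\<close>\<close>

context prob_space
begin

lemma L0_module_L0: "L0_module M (L0 M)"
  by (intro L0_module.intro prob_space_axioms module_L0)

text \<open>A nonempty subset of a singleton is that singleton, so the quantifier over finite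
  families of seminorms disappears.\<close>

lemma openin_L0_topology:
  "openin (L0_topology M) U \<longleftrightarrow> U \<subseteq> ae_classes M \<and>
     (\<forall>X\<in>U. \<exists>\<epsilon> \<delta>. 0 < \<epsilon> \<and> 0 < \<delta> \<and> \<delta> < 1 \<and>
        (\<forall>Z\<in>el_nhd M (L0 M) {ae_lift1 M abs} \<epsilon> \<delta>. ae_lift2 M (+) X Z \<in> U))"
proof -
  have single: "(\<exists>Q \<epsilon> \<delta>. Q \<subseteq> {a} \<and> finite Q \<and> Q \<noteq> {} \<and> R Q \<epsilon> \<delta>) \<longleftrightarrow> (\<exists>\<epsilon> \<delta>. R {a} \<epsilon> \<delta>)"
    for a :: "('a \<Rightarrow> real) set \<Rightarrow> ('a \<Rightarrow> real) set" and R :: "_ \<Rightarrow> real \<Rightarrow> real \<Rightarrow> bool"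
  proof
    assume "\<exists>Q \<epsilon> \<delta>. Q \<subseteq> {a} \<and> finite Q \<and> Q \<noteq> {} \<and> R Q \<epsilon> \<delta>"
    then obtain Q \<epsilon> \<delta> where "Q \<subseteq> {a}" "Q \<noteq> {}" "R Q \<epsilon> \<delta>" by blast
    moreover from this have "Q = {a}" by blast
    ultimately show "\<exists>\<epsilon> \<delta>. R {a} \<epsilon> \<delta>" by blast
  qed blast
  show ?thesis
    by (subst openin_el_topology) (simp_all only: single singleton_iff L0_seminorm_abs L0_simps)
qed

lemma in_L0_nhd_iff:
  assumes t: "t \<in> borel_measurable M"
  shows "ae_class M t \<in> el_nhd M (L0 M) {ae_lift1 M abs} \<epsilon> \<delta> \<longleftrightarrow>
    1 - \<delta> < prob {w \<in> space M. \<bar>t w\<bar> < \<epsilon>}"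
proof -
  interpret L: L0_module M "L0 M" by (rule L0_module_L0)
  have eq: "ae_lift1 M abs (ae_class M t) = ae_class M (\<lambda>w. \<bar>t w\<bar>)"
    using t by (simp add: ae_lift1_class)
  have [measurable]: "(\<lambda>w. \<bar>t w\<bar>) \<in> borel_measurable M" using t by measurable
  have [measurable]: "ae_rep (ae_class M (\<lambda>w. \<bar>t w\<bar>)) \<in> borel_measurable M"
    by (rule ae_rep_class) measurable
  have "ae_class M t \<in> el_nhd M (L0 M) {ae_lift1 M abs} \<epsilon> \<delta> \<longleftrightarrow>
      1 - \<delta> < prob {w \<in> space M. \<forall>n\<in>{ae_lift1 M abs}. ae_rep (n (ae_class M t)) w < \<epsilon>}"
    using t by (intro L.in_el_nhd_iff) (auto simp: L0_seminorm_abs)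
  also have "{w \<in> space M. \<forall>n\<in>{ae_lift1 M abs}. ae_rep (n (ae_class M t)) w < \<epsilon>}
      = {w \<in> space M. ae_rep (ae_class M (\<lambda>w. \<bar>t w\<bar>)) w < \<epsilon>}"
    by (simp add: eq)
  also have "prob \<dots> = prob {w \<in> space M. \<bar>t w\<bar> < \<epsilon>}"
  proof (rule prob_eq_AE)
    have "AE w in M. ae_rep (ae_class M (\<lambda>w. \<bar>t w\<bar>)) w = \<bar>t w\<bar>"
      by (rule ae_rep_class) measurable
    then show "AE w in M. (ae_rep (ae_class M (\<lambda>w. \<bar>t w\<bar>)) w < \<epsilon>) = (\<bar>t w\<bar> < \<epsilon>)"
      by eventually_elim simp
  qed measurable
  finally show ?thesis .
qed

end

sublocale random_locally_convex_module \<subseteq> L0_module M E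
  by unfold_locales

section \<open>Membership in the dual, and the complement of the epigraph\<close>

context random_locally_convex_module
begin

lemma openin_el_iff:
  "openin (el_topology M E P) U \<longleftrightarrow> U \<subseteq> carrier E \<and>
     (\<forall>x\<in>U. \<exists>Q \<epsilon> \<delta>. Q \<subseteq> P \<and> finite Q \<and> Q \<noteq> {} \<and> 0 < \<epsilon> \<and> 0 < \<delta> \<and> \<delta> < 1 \<and>
        (\<forall>z\<in>el_nhd M E Q \<epsilon> \<delta>. x \<oplus>\<^bsub>E\<^esub> z \<in> U))"
  by (rule openin_el_topology) (rule seminorms)

text \<open>The one-sided bound, applied to \<open>-z\<close> as well, bounds the absolute value of
  \<open>g z\<close>. Small seminorms on an event thus force a small \<open>g z\<close> on the same
  event, and additivity carries this continuity at the null element to every point.\<close>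

lemma linear_in_el_dual:
  assumes g: "linear g" and Q: "Q \<subseteq> P" "finite Q" "Q \<noteq> {}" and K: "0 \<le> K"
    and le: "\<And>x. x \<in> carrier E \<Longrightarrow> AE w in M. g x w \<le> K * (\<Sum>n\<in>Q. ae_rep (n x) w)"
  shows "(\<lambda>x. ae_class M (g x)) \<in> el_dual M E P"
proof -
  let ?G = "\<lambda>x. ae_class M (g x)"
  have grv: "rv (g x)" if "x \<in> carrier E" for x using g that by (simp add: linear_def)
  have gadd: "AE w in M. g (x \<oplus>\<^bsub>E\<^esub> y) w = g x w + g y w" if "x \<in> carrier E" "y \<in> carrier E" for x y
    using g that by (simp add: linear_def)
  have gsc: "AE w in M. g (t \<star> x) w = t w * g x w" if "x \<in> carrier E" "rv t" for x t
    using g that by (simp add: linear_def)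
  have Gadd: "?G (x \<oplus>\<^bsub>E\<^esub> y) = ae_lift2 M (+) (?G x) (?G y)" if "x \<in> carrier E" "y \<in> carrier E" for x y
  proof -
    have "?G (x \<oplus>\<^bsub>E\<^esub> y) = ae_class M (\<lambda>w. g x w + g y w)"
      using that gadd[OF that] grv by (intro ae_class_eqI) auto
    then show ?thesis using that grv by (simp add: ae_lift2_class)
  qed
  have Gsc: "?G (\<xi> \<odot>\<^bsub>E\<^esub> x) = ae_lift2 M (*) \<xi> (?G x)" if xi: "\<xi> \<in> ae_classes M" and x: "x \<in> carrier E" for \<xi> x
  proof -
    obtain t where t: "rv t" "\<xi> = ae_class M t" using xi by (rule ae_classesE)
    have "?G (t \<star> x) = ae_class M (\<lambda>w. t w * g x w)"
      using t x grv gsc[OF x t(1)] by (intro ae_class_eqI) auto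
    then show ?thesis using t grv[OF x] by (simp add: sc_def ae_lift2_class)
  qed
  have bound: "AE w in M. \<bar>g z w\<bar> \<le> K * (\<Sum>n\<in>Q. ae_rep (n z) w)" if z: "z \<in> carrier E" for z
  proof -
    have "AE w in M. \<forall>n\<in>Q. ae_rep (n (\<ominus>\<^bsub>E\<^esub> z)) w = ae_rep (n z) w"
      using Q seminorms z by (intro AE_finite_allI seminorm_minus) auto
    moreover have "AE w in M. g (\<ominus>\<^bsub>E\<^esub> z) w = - g z w"
      using gsc[OF z, of "\<lambda>_. -1"] z by (simp add: minus_as_scale)
    moreover have "AE w in M. g (\<ominus>\<^bsub>E\<^esub> z) w \<le> K * (\<Sum>n\<in>Q. ae_rep (n (\<ominus>\<^bsub>E\<^esub> z)) w)"
      using z by (intro le) simp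
    ultimately show ?thesis using le[OF z]
    proof eventually_elim
      case (elim w)
      have "(\<Sum>n\<in>Q. ae_rep (n (\<ominus>\<^bsub>E\<^esub> z)) w) = (\<Sum>n\<in>Q. ae_rep (n z) w)"
        using elim(1) by (intro sum.cong) auto
      with elim show ?case by simp
    qed
  qed
  have cont: "continuous_map (el_topology M E P) (L0_topology M) ?G"
    unfolding continuous_map
  proof (intro conjI allI impI)
    have "openin (L0_topology M) (carrier (L0 M))"
      by (rule L0_module.openin_carrier[OF L0_module_L0, of "ae_lift1 M abs"]) (auto simp: L0_seminorm_abs)
    then have "ae_classes M \<subseteq> topspace (L0_topology M)" using openin_subset by fastforce
    then show "?G ` topspace (el_topology M E P) \<subseteq> topspace (L0_topology M)"
      using grv by (auto simp: topspace_el_topology)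
    fix U assume "openin (L0_topology M) U"
    then have U: "\<And>X. X \<in> U \<Longrightarrow> \<exists>\<epsilon> \<delta>. 0 < \<epsilon> \<and> 0 < \<delta> \<and> \<delta> < 1 \<and>
        (\<forall>Z\<in>el_nhd M (L0 M) {ae_lift1 M abs} \<epsilon> \<delta>. ae_lift2 M (+) X Z \<in> U)"
      by (simp add: openin_L0_topology)
    show "openin (el_topology M E P) {x \<in> topspace (el_topology M E P). ?G x \<in> U}"
      unfolding openin_el_iff topspace_el_topology
    proof (intro conjI ballI)
      fix x assume "x \<in> {x \<in> carrier E. ?G x \<in> U}"
      then have x: "x \<in> carrier E" "?G x \<in> U" by auto
      obtain \<epsilon> \<delta> where ed: "0 < \<epsilon>" "0 < \<delta>" "\<delta> < 1"
        and GU: "\<And>Z. Z \<in> el_nhd M (L0 M) {ae_lift1 M abs} \<epsilon> \<delta> \<Longrightarrow> ae_lift2 M (+) (?G x) Z \<in> U"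
        using U[OF x(2)] by blast
      have cQ: "0 < real (card Q)" using Q by (simp add: card_gt_0_iff)
      \<comment> \<open>The factor \<open>card Q\<close> passes from single seminorms to their sum;
        \<open>K + 1\<close> instead of \<open>K\<close> avoids division by zero and makes the final
        inequality strict.\<close>
      define \<epsilon>' where "\<epsilon>' = \<epsilon> / ((K + 1) * card Q)"
      have e': "0 < \<epsilon>'" using ed K cQ by (simp add: \<epsilon>'_def)
      have "x \<oplus>\<^bsub>E\<^esub> z \<in> {x \<in> carrier E. ?G x \<in> U}" if zQ: "z \<in> el_nhd M E Q \<epsilon>' \<delta>" for z
      proof -
        have z: "z \<in> carrier E" using zQ by (simp add: el_nhd_def)
        have sem: "\<And>n. n \<in> Q \<Longrightarrow> L0_seminorm M E n" using Q seminorms by blast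
        have [measurable]: "rv (g z)" by (rule grv[OF z])
        have "1 - \<delta> < prob {w \<in> space M. \<forall>n\<in>Q. ae_rep (n z) w < \<epsilon>'}"
          using zQ in_el_nhd_iff[OF Q(2,3) sem z] by blast
        also have "\<dots> \<le> prob {w \<in> space M. \<bar>g z w\<bar> < \<epsilon>}"
        proof (rule finite_measure_mono_AE)
          show "AE w in M. w \<in> {w \<in> space M. \<forall>n\<in>Q. ae_rep (n z) w < \<epsilon>'} \<longrightarrow>
              w \<in> {w \<in> space M. \<bar>g z w\<bar> < \<epsilon>}"
            using bound[OF z]
          proof eventually_elim
            case (elim w)
            have "\<bar>g z w\<bar> < \<epsilon>" if "\<forall>n\<in>Q. ae_rep (n z) w < \<epsilon>'"
            proof -
              have "(\<Sum>n\<in>Q. ae_rep (n z) w) \<le> (\<Sum>n\<in>Q. \<epsilon>')"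
                using that by (intro sum_mono) auto
              then have "K * (\<Sum>n\<in>Q. ae_rep (n z) w) \<le> K * (card Q * \<epsilon>')"
                using K by (intro mult_left_mono) auto
              also have "\<dots> < (K + 1) * (card Q * \<epsilon>')" using cQ e' by simp
              also have "\<dots> = ((K + 1) * card Q) * \<epsilon>'" by (simp only: mult.assoc)
              also have "\<dots> = \<epsilon>"
                using mult_pos_pos[of "K + 1", OF _ cQ] K unfolding \<epsilon>'_def
                by (intro nonzero_mult_div_cancel_left[THEN trans[OF times_divide_eq_right]]) linarith
              finally show ?thesis using elim by linarith
            qed
            then show ?case by simp
          qed
        qed measurable
        finally have "?G z \<in> el_nhd M (L0 M) {ae_lift1 M abs} \<epsilon> \<delta>"
          by (subst in_L0_nhd_iff) measurable
        then have "ae_lift2 M (+) (?G x) (?G z) \<in> U" by (rule GU)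
        then show ?thesis using Gadd[OF x(1) z] x(1) z by simp
      qed
      then show "\<exists>Q \<epsilon> \<delta>. Q \<subseteq> P \<and> finite Q \<and> Q \<noteq> {} \<and> 0 < \<epsilon> \<and> 0 < \<delta> \<and> \<delta> < 1 \<and>
          (\<forall>z\<in>el_nhd M E Q \<epsilon> \<delta>. x \<oplus>\<^bsub>E\<^esub> z \<in> {x \<in> carrier E. ?G x \<in> U})"
        using Q e' ed by blast
    qed auto
  qed
  show ?thesis
    unfolding el_dual_def using Gadd Gsc cont grv by auto
qed

text \<open>A product neighbourhood inside the complement of the epigraph yields one \<epsilon> and
  one \<delta> for both factors, by taking minima. The conclusion only says that the inequality
  fails somewhere; locating the failure is left to \<open>separation\<close>.\<close>

lemma lsc_epi:
  assumes lsc: "el_lsc M E P f" and f: "f \<in> carrier E \<rightarrow> carrier (L0bar M)"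
    and x: "x \<in> carrier E" and r: "rv r" and notle: "\<not> (AE w in M. ae_rep (f x) w \<le> ereal (r w))"
  obtains Q \<epsilon> \<delta> where "Q \<subseteq> P" "finite Q" "Q \<noteq> {}" "0 < \<epsilon>" "0 < \<delta>" "\<delta> < 1"
    "\<And>y s. y \<in> carrier E \<Longrightarrow> rv s \<Longrightarrow>
      1 - \<delta> < prob {w \<in> space M. \<forall>n\<in>Q. ae_rep (n (y \<ominus>\<^bsub>E\<^esub> x)) w < \<epsilon>} \<Longrightarrow>
      1 - \<delta> < prob {w \<in> space M. \<bar>s w - r w\<bar> < \<epsilon>} \<Longrightarrow>
      \<not> (AE w in M. ae_rep (f y) w \<le> ereal (s w))"
proof -
  let ?T = "prod_topology (el_topology M E P) (L0_topology M)"
  let ?W = "topspace ?T - L0_epi M E f"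
  have epi: "(y, ae_class M s) \<in> L0_epi M E f \<longleftrightarrow> (AE w in M. ae_rep (f y) w \<le> ereal (s w))"
    if y: "y \<in> carrier E" and s: "rv s" for y s
  proof -
    have fy: "f y = ae_class M (ae_rep (f y))" "ae_rep (f y) \<in> borel_measurable M"
      using f y ae_class_rep[of "f y" M] by auto
    have "ae_le M (f y) (of_L0 M (ae_class M s)) \<longleftrightarrow> (AE w in M. ae_rep (f y) w \<le> ereal (s w))"
      using s fy(2) by (subst fy(1)) (simp add: ae_lift1_class ae_le_class)
    then show ?thesis using y s by (simp add: L0_epi_def)
  qed
  have tops: "(y, ae_class M s) \<in> topspace ?T" if "y \<in> carrier E" "rv s" for y s
  proof -
    have "openin (L0_topology M) (carrier (L0 M))"
      by (rule L0_module.openin_carrier[OF L0_module_L0, of "ae_lift1 M abs"]) (auto simp: L0_seminorm_abs)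
    then have "ae_classes M \<subseteq> topspace (L0_topology M)" using openin_subset by fastforce
    then show ?thesis using that by (auto simp: topspace_el_topology)
  qed
  have "openin ?T ?W" using lsc by (simp add: el_lsc_def closedin_def)
  moreover have "(x, ae_class M r) \<in> ?W" using tops[OF x r] epi[OF x r] notle by blast
  ultimately obtain U V where UV: "openin (el_topology M E P) U" "openin (L0_topology M) V"
      "x \<in> U" "ae_class M r \<in> V" "U \<times> V \<subseteq> ?W"
    unfolding openin_prod_topology_alt by metis
  from UV(1,3) obtain Q \<epsilon>1 \<delta>1 where Q: "Q \<subseteq> P" "finite Q" "Q \<noteq> {}" "0 < \<epsilon>1" "0 < \<delta>1" "\<delta>1 < 1"
      "\<forall>z\<in>el_nhd M E Q \<epsilon>1 \<delta>1. x \<oplus>\<^bsub>E\<^esub> z \<in> U"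
    unfolding openin_el_iff by meson
  from UV(2,4) obtain \<epsilon>2 \<delta>2 where V: "0 < \<epsilon>2" "0 < \<delta>2"
      "\<forall>Z\<in>el_nhd M (L0 M) {ae_lift1 M abs} \<epsilon>2 \<delta>2. ae_lift2 M (+) (ae_class M r) Z \<in> V"
    unfolding openin_L0_topology by meson
  show thesis
  proof (rule that[OF Q(1-3), of "min \<epsilon>1 \<epsilon>2" "min \<delta>1 \<delta>2"])
    fix y s assume y: "y \<in> carrier E" and s: "rv s"
      and near: "1 - min \<delta>1 \<delta>2 < prob {w \<in> space M. \<forall>n\<in>Q. ae_rep (n (y \<ominus>\<^bsub>E\<^esub> x)) w < min \<epsilon>1 \<epsilon>2}"
        "1 - min \<delta>1 \<delta>2 < prob {w \<in> space M. \<bar>s w - r w\<bar> < min \<epsilon>1 \<epsilon>2}"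
    have sem: "\<And>n. n \<in> Q \<Longrightarrow> L0_seminorm M E n" using Q seminorms by blast
    have z: "y \<ominus>\<^bsub>E\<^esub> x \<in> carrier E" using x y by simp
    have "{w \<in> space M. \<forall>n\<in>Q. ae_rep (n (y \<ominus>\<^bsub>E\<^esub> x)) w < \<epsilon>1} \<in> events"
    proof -
      have "{w \<in> space M. ae_rep (n (y \<ominus>\<^bsub>E\<^esub> x)) w < \<epsilon>1} \<in> events" if "n \<in> Q" for n
        using seminorm_rv(2)[OF sem[OF that] z] by measurable
      then show ?thesis using Q(2,3) by (intro sets.sets_Collect_finite_All') auto
    qed
    then have "prob {w \<in> space M. \<forall>n\<in>Q. ae_rep (n (y \<ominus>\<^bsub>E\<^esub> x)) w < min \<epsilon>1 \<epsilon>2}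
        \<le> prob {w \<in> space M. \<forall>n\<in>Q. ae_rep (n (y \<ominus>\<^bsub>E\<^esub> x)) w < \<epsilon>1}"
      by (intro finite_measure_mono) auto
    then have "y \<ominus>\<^bsub>E\<^esub> x \<in> el_nhd M E Q \<epsilon>1 \<delta>1"
      using near(1) by (subst in_el_nhd_iff[OF Q(2,3) sem z]) auto
    then have "x \<oplus>\<^bsub>E\<^esub> (y \<ominus>\<^bsub>E\<^esub> x) \<in> U" using Q(7) by blast
    moreover have "x \<oplus>\<^bsub>E\<^esub> (y \<ominus>\<^bsub>E\<^esub> x) = y" using x y by (simp add: M.minus_eq M.a_lcomm[of x y] M.r_neg)
    ultimately have yU: "y \<in> U" by simp
    have "{w \<in> space M. \<bar>s w - r w\<bar> < \<epsilon>2} \<in> events" using s r by measurable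
    then have "prob {w \<in> space M. \<bar>s w - r w\<bar> < min \<epsilon>1 \<epsilon>2} \<le> prob {w \<in> space M. \<bar>s w - r w\<bar> < \<epsilon>2}"
      by (intro finite_measure_mono) auto
    then have "ae_class M (\<lambda>w. s w - r w) \<in> el_nhd M (L0 M) {ae_lift1 M abs} \<epsilon>2 \<delta>2"
      using near(2) s r by (subst in_L0_nhd_iff) auto
    then have "ae_lift2 M (+) (ae_class M r) (ae_class M (\<lambda>w. s w - r w)) \<in> V" using V(3) by blast
    then have "ae_class M s \<in> V" using s r by (simp add: ae_lift2_class)
    with yU UV(5) have "(y, ae_class M s) \<notin> L0_epi M E f" by blast
    then show "\<not> (AE w in M. ae_rep (f y) w \<le> ereal (s w))" using epi[OF y s] by blast
  qed (use Q V in auto)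
qed

end

section \<open>Separation and lower bounds\<close>

text \<open>\<open>C\<close> is an essential union of \<B>, made of countably many members. Closure
  under finite unions lets it be written as an increasing limit of members, so the bound
  \<open>c\<close> survives, although \<open>C\<close> itself may lie outside \<B>.\<close>

lemma (in finite_measure) exhaustion:
  assumes \<B>: "\<B> \<subseteq> sets M" "{} \<in> \<B>" "\<And>A B. A \<in> \<B> \<Longrightarrow> B \<in> \<B> \<Longrightarrow> A \<union> B \<in> \<B>"
    and c: "\<And>B. B \<in> \<B> \<Longrightarrow> measure M B \<le> c"
  obtains C where "C \<in> sets M" "C \<subseteq> \<Union>\<B>" "measure M C \<le> c" "\<And>B. B \<in> \<B> \<Longrightarrow> measure M (B - C) = 0"
proof -
  define \<alpha> where "\<alpha> = (SUP B\<in>\<B>. measure M B)"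
  have bdd: "bdd_above (measure M ` \<B>)" using c by (auto simp: bdd_above_def)
  have le: "measure M B \<le> \<alpha>" if "B \<in> \<B>" for B
    unfolding \<alpha>_def using that bdd by (intro cSUP_upper)
  have "\<exists>B\<in>\<B>. \<alpha> - 1 / Suc n < measure M B" for n
  proof -
    have "\<alpha> - 1 / Suc n < \<alpha>" by simp
    then show ?thesis using less_cSUP_iff[of \<B> "measure M" "\<alpha> - 1 / Suc n"] \<B>(2) bdd
      unfolding \<alpha>_def[symmetric] by blast
  qed
  then have "\<forall>n. \<exists>B. B \<in> \<B> \<and> \<alpha> - 1 / Suc n < measure M B" by blast
  from choice[OF this] obtain b where b: "\<And>n. b n \<in> \<B>" "\<And>n. \<alpha> - 1 / Suc n < measure M (b n)"
    by blast
  define D where "D = (\<lambda>n. \<Union>i\<le>n. b i)"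
  have D: "D n \<in> \<B>" for n
    by (induction n) (simp_all add: D_def b atMost_Suc \<B>(3))
  have Ds: "D n \<in> sets M" for n using D \<B>(1) by blast
  have "incseq D" by (auto simp: incseq_def D_def intro: order_trans)
  then have "(\<lambda>n. measure M (D n)) \<longlonglongrightarrow> measure M (\<Union>n. D n)"
    using Ds by (intro finite_Lim_measure_incseq) auto
  then have Uc: "measure M (\<Union>n. D n) \<le> c"
    by (rule LIMSEQ_le_const2) (use D c in auto)
  show thesis
  proof (rule that[of "\<Union>n. D n"])
    show "(\<Union>n. D n) \<in> sets M" using Ds by blast
    show "(\<Union>n. D n) \<subseteq> \<Union>\<B>" using D by blast
    show "measure M (\<Union>n. D n) \<le> c" by (rule Uc)
    fix B assume B: "B \<in> \<B>"
    then have Bs: "B \<in> sets M" using \<B>(1) by blast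
    \<comment> \<open>\<open>b n\<close> nearly attains the supremum \<alpha>, and its union with
      \<open>B\<close> cannot exceed \<alpha>, so \<open>B\<close> adds at most
      \<open>1 / Suc n\<close>.\<close>
    have "measure M (B - (\<Union>n. D n)) \<le> 1 / Suc n" for n
    proof -
      have bs: "b n \<in> sets M" using b \<B>(1) by blast
      have "measure M (B - (\<Union>n. D n)) \<le> measure M (B - b n)"
        using Bs bs by (intro finite_measure_mono) (auto simp: D_def)
      also have "\<dots> = measure M (b n \<union> B) - measure M (b n)"
        using Bs bs by (subst finite_measure_Union') auto
      also have "\<dots> \<le> 1 / Suc n" using le[OF \<B>(3)[OF b(1)[of n] B]] b(2)[of n] by linarith
      finally show ?thesis .
    qed
    then have "measure M (B - (\<Union>n. D n)) \<le> 0"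
      by (intro LIMSEQ_le_const[OF LIMSEQ_inverse_real_of_nat[unfolded inverse_eq_divide]]) auto
    then show "measure M (B - (\<Union>n. D n)) = 0" by (simp add: measure_le_0_iff)
  qed
qed

text \<open>The events where \<phi> is below \<open>k\<close> in absolute value increase to
  \<open>D\<close>, so one of them has positive measure.\<close>

lemma (in finite_measure) bounded_on_positive_subset:
  fixes \<phi> :: "'a \<Rightarrow> real"
  assumes D: "D \<in> sets M" "0 < measure M D" and \<phi>: "\<phi> \<in> borel_measurable M"
  obtains k :: nat where "0 < measure M {w \<in> D. \<bar>\<phi> w\<bar> < k}" "{w \<in> D. \<bar>\<phi> w\<bar> < k} \<in> sets M"
proof -
  define B where "B = (\<lambda>k::nat. {w \<in> D. \<bar>\<phi> w\<bar> < k})"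
  have Bs: "B k \<in> sets M" for k
  proof -
    have "{w \<in> space M. \<bar>\<phi> w\<bar> < k} \<in> sets M" using \<phi> by measurable
    moreover have "B k = D \<inter> {w \<in> space M. \<bar>\<phi> w\<bar> < k}" using sets.sets_into_space[OF D(1)] by (auto simp: B_def)
    ultimately show ?thesis using D(1) by auto
  qed
  have "incseq B" by (auto simp: incseq_def B_def intro: less_le_trans)
  then have "(\<lambda>k. measure M (B k)) \<longlonglongrightarrow> measure M (\<Union>k. B k)"
    using Bs by (intro finite_Lim_measure_incseq) auto
  moreover have "(\<Union>k. B k) = D" using reals_Archimedean2 by (auto simp: B_def)
  ultimately have "eventually (\<lambda>k. 0 < measure M (B k)) sequentially"
    using D(2) by (intro order_tendstoD(1)) auto
  then obtain k where "0 < measure M (B k)" by (auto simp: eventually_sequentially)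
  then show thesis using Bs[of k] that[of k] by (auto simp: B_def)
qed

section \<open>Locality: equality on an event and gluing along an event\<close>

context L0_module
begin

text \<open>Elements of \<open>E\<close> are not functions, so equality on the event
  \<open>B\<close> is expressed through the action of its indicator.\<close>

definition agree :: "'w set \<Rightarrow> 'e \<Rightarrow> 'e \<Rightarrow> bool" where
  "agree B x y \<longleftrightarrow> indicator B \<star> x = indicator B \<star> y"

text \<open>Gluing: \<open>x\<close> on \<open>B\<close>, \<open>y\<close> off \<open>B\<close>. The
  coefficients are those of an L0-convex combination, which ties gluing to convexity.\<close>

definition splice :: "'w set \<Rightarrow> 'e \<Rightarrow> 'e \<Rightarrow> 'e" where
  "splice B x y = indicator B \<star> x \<oplus>\<^bsub>E\<^esub> (\<lambda>w. 1 - indicator B w) \<star> y"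

lemma splice_closed [simp]:
  "B \<in> sets M \<Longrightarrow> x \<in> carrier E \<Longrightarrow> y \<in> carrier E \<Longrightarrow> splice B x y \<in> carrier E"
  by (simp add: splice_def)

lemma splice_self:
  assumes "B \<in> sets M" "x \<in> carrier E"
  shows "splice B x x = x"
  using sc_add_left[of "indicator B" "\<lambda>w. 1 - indicator B w" x] assms by (simp add: splice_def)

lemma agree_sym: "agree B x y \<Longrightarrow> agree B y x"
  by (simp add: agree_def)

lemma agree_splice:
  assumes B: "B \<in> sets M" "C \<in> sets M" and x: "x \<in> carrier E" and y: "y \<in> carrier E"
  shows agree_splice_inside: "C \<subseteq> B \<Longrightarrow> agree C (splice B x y) x"
    and agree_splice_outside: "C \<inter> B = {} \<Longrightarrow> agree C (splice B x y) y"
proof -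
  have eq: "indicator C \<star> splice B x y =
      (\<lambda>w. indicator C w * indicator B w) \<star> x \<oplus>\<^bsub>E\<^esub> (\<lambda>w. indicator C w * (1 - indicator B w)) \<star> y"
    using assms by (simp add: splice_def sc_add_right sc_sc)
  show "agree C (splice B x y) x" if "C \<subseteq> B"
  proof -
    have "(\<lambda>w. indicator C w * indicator B w) = (indicator C :: _ \<Rightarrow> real)"
      "(\<lambda>w. indicator C w * (1 - indicator B w)) = (\<lambda>_. 0 :: real)"
      using that by (auto simp: indicator_def fun_eq_iff)
    then show ?thesis using assms by (simp add: agree_def eq)
  qed
  show "agree C (splice B x y) y" if "C \<inter> B = {}"
  proof -
    have "(\<lambda>w. indicator C w * indicator B w) = (\<lambda>_. 0 :: real)"
      "(\<lambda>w. indicator C w * (1 - indicator B w)) = (indicator C :: _ \<Rightarrow> real)"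
      using that by (auto simp: indicator_def fun_eq_iff)
    then show ?thesis using assms by (simp add: agree_def eq)
  qed
qed

lemma agree_add:
  assumes "B \<in> sets M" "x \<in> carrier E" "y \<in> carrier E" "u \<in> carrier E" "v \<in> carrier E"
    and "agree B x u" "agree B y v"
  shows "agree B (x \<oplus>\<^bsub>E\<^esub> y) (u \<oplus>\<^bsub>E\<^esub> v)"
  using assms by (simp add: agree_def sc_add_right)

lemma agree_minus:
  assumes "B \<in> sets M" "x \<in> carrier E" "y \<in> carrier E" "u \<in> carrier E" "v \<in> carrier E"
    and "agree B x u" "agree B y v"
  shows "agree B (x \<ominus>\<^bsub>E\<^esub> y) (u \<ominus>\<^bsub>E\<^esub> v)"
proof -
  have "agree B (\<ominus>\<^bsub>E\<^esub> y) (\<ominus>\<^bsub>E\<^esub> v)"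
  proof -
    have "indicator B \<star> (\<ominus>\<^bsub>E\<^esub> z) = \<ominus>\<^bsub>E\<^esub> (indicator B \<star> z)" if "z \<in> carrier E" for z
      using that assms(1) sc_sc[of "indicator B" "\<lambda>_. -1" z] sc_minus[of "indicator B" z]
      by (simp add: minus_as_scale)
    then show ?thesis using assms by (simp add: agree_def)
  qed
  then show ?thesis using assms unfolding M.minus_eq by (intro agree_add) auto
qed

text \<open>Multiplying by the indicator of \<open>B\<close> forgets everything off
  \<open>B\<close>, so a map that commutes with it is determined on \<open>B\<close> by its argument
  on \<open>B\<close>. Seminorms and linear maps both qualify.\<close>

lemma agree_local:
  assumes B: "B \<in> sets M" and xy: "x \<in> carrier E" "y \<in> carrier E" "agree B x y"
    and hom: "\<And>x. x \<in> carrier E \<Longrightarrow> AE w in M. g (indicator B \<star> x) w = indicator B w * g x w"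
  shows "AE w in M. w \<in> B \<longrightarrow> g x w = (g y w :: real)"
proof -
  from hom[OF xy(1)] hom[OF xy(2)] show ?thesis
    unfolding xy(3)[unfolded agree_def] by eventually_elim (auto simp: indicator_def)
qed

lemma agree_seminorm:
  assumes "L0_seminorm M E n" "B \<in> sets M" "x \<in> carrier E" "y \<in> carrier E" "agree B x y"
  shows "AE w in M. w \<in> B \<longrightarrow> ae_rep (n x) w = ae_rep (n y) w"
proof (rule agree_local[OF assms(2-5)])
  fix x assume "x \<in> carrier E"
  from seminorm_scale[OF assms(1) this, of "indicator B"] assms(2)
  show "AE w in M. ae_rep (n (indicator B \<star> x)) w = indicator B w * ae_rep (n x) w" by simp
qed

lemma agree_linear:
  assumes "linear g" "B \<in> sets M" "x \<in> carrier E" "y \<in> carrier E" "agree B x y"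
  shows "AE w in M. w \<in> B \<longrightarrow> g x w = g y w"
  using assms(1,2) by (intro agree_local[OF assms(2-5)]) (auto simp: linear_def)

end

section \<open>The function \<open>f\<close> through representatives\<close>

locale lsc_convex_function = random_locally_convex_module M E P
  for M :: "'w measure" and E :: "(('w \<Rightarrow> real) set, 'e, 'm) module_scheme"
    and P :: "('e \<Rightarrow> ('w \<Rightarrow> real) set) set" +
  fixes f :: "'e \<Rightarrow> ('w \<Rightarrow> ereal) set"
  assumes f_closed: "f \<in> carrier E \<rightarrow> carrier (L0bar M)"
    and proper: "L0_proper M E f"
    and convex: "L0_convex M E f"
    and lsc: "el_lsc M E P f"
begin

abbreviation F :: "'e \<Rightarrow> 'w \<Rightarrow> ereal" where "F x \<equiv> ae_rep (f x)"

lemma f_in: "x \<in> carrier E \<Longrightarrow> f x \<in> ae_classes M"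
  using f_closed by auto

lemma F_measurable: "x \<in> carrier E \<Longrightarrow> F x \<in> borel_measurable M"
  using f_in by (rule ae_class_rep)

lemma F_not_minf: "x \<in> carrier E \<Longrightarrow> AE w in M. F x w \<noteq> -\<infinity>"
  using proper unfolding L0_proper_def by (auto elim: AE_mp)

lemma dom_nonempty: obtains y where "y \<in> L0_dom M E f"
  using proper unfolding L0_proper_def by auto

lemma dom_closed: "y \<in> L0_dom M E f \<Longrightarrow> y \<in> carrier E"
  by (simp add: L0_dom_def)

lemma F_dom:
  assumes y: "y \<in> L0_dom M E f"
  shows "AE w in M. F y w = ereal (real_of_ereal (F y w))"
proof -
  have "AE w in M. F y w < \<infinity>" using y by (simp add: L0_dom_def)
  with F_not_minf[OF dom_closed[OF y]] show ?thesis
  proof eventually_elim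
    case (elim w)
    then show ?case by (cases "F y w") auto
  qed
qed

lemma F_convex:
  assumes x: "x \<in> carrier E" and y: "y \<in> carrier E" and t: "rv t" "\<And>w. 0 \<le> t w \<and> t w \<le> 1"
  shows "AE w in M. F (t \<star> x \<oplus>\<^bsub>E\<^esub> (\<lambda>w. 1 - t w) \<star> y) w
    \<le> ereal (t w) * F x w + ereal (1 - t w) * F y w"
proof -
  let ?t = "ae_class M t" and ?t' = "ae_class M (\<lambda>w. 1 - t w)"
  have fx: "f x = ae_class M (F x)" "F x \<in> borel_measurable M"
    and fy: "f y = ae_class M (F y)" "F y \<in> borel_measurable M"
    using ae_class_rep[OF f_in[OF x]] ae_class_rep[OF f_in[OF y]] by auto
  have t': "\<one>\<^bsub>L0 M\<^esub> \<ominus>\<^bsub>L0 M\<^esub> ?t = ?t'" using t by (simp add: ae_class_minus)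
  have tx: "ae_lift2 M (*) (of_L0 M (ae_class M s)) (ae_class M u) = ae_class M (\<lambda>w. ereal (s w) * u w)"
    if "rv s" "u \<in> borel_measurable M" for s u
    using that by (simp add: ae_lift1_class ae_lift2_class)
  have "ae_le M (f (?t \<odot>\<^bsub>E\<^esub> x \<oplus>\<^bsub>E\<^esub> ?t' \<odot>\<^bsub>E\<^esub> y))
      (ae_lift2 M (+) (ae_lift2 M (*) (of_L0 M ?t) (f x)) (ae_lift2 M (*) (of_L0 M ?t') (f y)))"
    using convex[unfolded L0_convex_def, rule_format, OF x y, of ?t] t
    unfolding t' by (simp add: ae_le_class)
  also have "ae_lift2 M (+) (ae_lift2 M (*) (of_L0 M ?t) (f x)) (ae_lift2 M (*) (of_L0 M ?t') (f y))
      = ae_class M (\<lambda>w. ereal (t w) * F x w + ereal (1 - t w) * F y w)"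
    using t(1) fx(2) fy(2) by (subst fx(1), subst fy(1)) (simp add: tx ae_lift2_class)
  finally have "AE w in M. F (t \<star> x \<oplus>\<^bsub>E\<^esub> (\<lambda>w. 1 - t w) \<star> y) w
      \<le> ae_rep (ae_class M (\<lambda>w. ereal (t w) * F x w + ereal (1 - t w) * F y w)) w"
    by (simp add: ae_le_def sc_def)
  moreover have "AE w in M. ae_rep (ae_class M (\<lambda>w. ereal (t w) * F x w + ereal (1 - t w) * F y w)) w
      = ereal (t w) * F x w + ereal (1 - t w) * F y w"
    using t(1) fx(2) fy(2)
    by (intro ae_rep_class(2) borel_measurable_ereal_add borel_measurable_ereal_times) auto
  ultimately show ?thesis by eventually_elim simp
qed

text \<open>Locality of \<open>f\<close> is convexity with the coefficient
  \<open>indicator B\<close>: if \<open>x\<close> and \<open>y\<close> agree on \<open>B\<close>,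
  then \<open>x\<close> is \<open>y\<close> on \<open>B\<close> glued with \<open>x\<close> off
  \<open>B\<close>.\<close>

lemma agree_F:
  assumes B: "B \<in> sets M" and x: "x \<in> carrier E" and y: "y \<in> carrier E" and ag: "agree B x y"
  shows "AE w in M. w \<in> B \<longrightarrow> F x w = F y w"
proof -
  have le: "AE w in M. w \<in> B \<longrightarrow> F x w \<le> F y w"
    if x: "x \<in> carrier E" and y: "y \<in> carrier E" and ag: "agree B x y" for x y
  proof -
    have "splice B y x = splice B x x" using ag by (simp add: agree_def splice_def)
    then have "indicator B \<star> y \<oplus>\<^bsub>E\<^esub> (\<lambda>w. 1 - indicator B w) \<star> x = x"
      using splice_self[OF B x] by (simp add: splice_def)
    moreover have "rv (indicator B)" "\<And>w. 0 \<le> (indicator B w :: real) \<and> (indicator B w :: real) \<le> 1"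
      using B by (auto simp: indicator_def)
    ultimately have "AE w in M. F x w \<le> ereal (indicator B w) * F y w + ereal (1 - indicator B w) * F x w"
      using F_convex[OF y x, of "indicator B"] by simp
    \<comment> \<open>On \<open>B\<close> the coefficients are \<open>1\<close> and
      \<open>0\<close>, and \<open>0 * \<infinity> = 0\<close> removes the second term even where
      \<open>F x\<close> is infinite.\<close>
    then show ?thesis by eventually_elim (auto simp: one_ereal_def[symmetric] zero_ereal_def[symmetric])
  qed
  from le[OF x y ag] le[OF y x agree_sym[OF ag]] show ?thesis by eventually_elim auto
qed

text \<open>Call a subset of \<open>D\<close> bad if one \<open>y\<close> is, throughout it, within
  \<epsilon> of \<open>x\<close> with \<open>F y < q\<close>. Bad events are closed under union by
  gluing, and each misses at least probability \<delta> of \<open>D\<close>, for otherwise a glued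
  point near the spliced one would lie in the epigraph. Their essential union \<open>C\<close>
  therefore leaves \<open>A = D - C\<close> with probability at least \<delta>.\<close>

lemma separation:
  assumes x: "x \<in> carrier E" and D: "D \<in> sets M" "0 < prob D"
    and above: "AE w in M. w \<in> D \<longrightarrow> ereal q < F x w"
  obtains A Q \<epsilon> where "A \<in> sets M" "A \<subseteq> D" "0 < prob A" "Q \<subseteq> P" "finite Q" "Q \<noteq> {}" "0 < \<epsilon>"
    "\<And>y. y \<in> carrier E \<Longrightarrow>
      AE w in M. w \<in> A \<longrightarrow> (\<forall>n\<in>Q. ae_rep (n (y \<ominus>\<^bsub>E\<^esub> x)) w < \<epsilon>) \<longrightarrow> ereal q \<le> F y w"
proof -
  obtain y0 where y0: "y0 \<in> L0_dom M E f" by (rule dom_nonempty)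
  note y0E = dom_closed[OF y0]
  have [measurable]: "D \<in> sets M" "F y0 \<in> borel_measurable M" "F x \<in> borel_measurable M"
    using D F_measurable y0E x by auto
  have Dsp: "D \<subseteq> space M" using D(1) by (rule sets.sets_into_space)
  \<comment> \<open>Replacing \<open>x\<close> by \<open>y0\<close> off \<open>D\<close> makes the point lie on the graph there, so that only the
    behaviour on \<open>D\<close> keeps it out of the epigraph.\<close>
  let ?x = "splice D x y0"
  let ?r = "\<lambda>w. if w \<in> D then q else real_of_ereal (F y0 w)"
  have xE: "?x \<in> carrier E" using D x y0E by simp
  have r: "rv ?r" by measurable
  have notle: "\<not> (AE w in M. F ?x w \<le> ereal (?r w))"
  proof
    assume "AE w in M. F ?x w \<le> ereal (?r w)"
    moreover have "AE w in M. w \<in> D \<longrightarrow> F ?x w = F x w"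
      using D x y0E xE by (intro agree_F agree_splice_inside) auto
    ultimately have "AE w in M. w \<notin> D"
      using above by eventually_elim (auto simp: not_less)
    then have "prob D = 0" by (subst prob_eq_0[OF D(1)])
    with D(2) show False by simp
  qed
  obtain Q \<epsilon> \<delta> where Q: "Q \<subseteq> P" "finite Q" "Q \<noteq> {}" "0 < \<epsilon>" "0 < \<delta>" "\<delta> < 1"
    and far: "\<And>y s. y \<in> carrier E \<Longrightarrow> rv s \<Longrightarrow>
      1 - \<delta> < prob {w \<in> space M. \<forall>n\<in>Q. ae_rep (n (y \<ominus>\<^bsub>E\<^esub> ?x)) w < \<epsilon>} \<Longrightarrow>
      1 - \<delta> < prob {w \<in> space M. \<bar>s w - ?r w\<bar> < \<epsilon>} \<Longrightarrow>
      \<not> (AE w in M. F y w \<le> ereal (s w))"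
    by (rule lsc_epi[OF lsc f_closed xE r notle]) (rule that)
  have sem: "\<And>n. n \<in> Q \<Longrightarrow> L0_seminorm M E n" using Q seminorms by blast
  have meas: "{w \<in> space M. \<forall>n\<in>Q. ae_rep (n z) w < \<epsilon>} \<in> sets M" if z: "z \<in> carrier E" for z
  proof -
    have "{w \<in> space M. ae_rep (n z) w < \<epsilon>} \<in> events" if "n \<in> Q" for n
      using seminorm_rv(2)[OF sem[OF that] z] by measurable
    then show ?thesis using Q(2,3) by (intro sets.sets_Collect_finite_All') auto
  qed
  define G where "G = (\<lambda>y w. (\<forall>n\<in>Q. ae_rep (n (y \<ominus>\<^bsub>E\<^esub> x)) w < \<epsilon>) \<and> F y w < ereal q)"
  define \<B> where "\<B> = {B \<in> sets M. B \<subseteq> D \<and> (\<exists>y\<in>carrier E. AE w in M. w \<in> B \<longrightarrow> G y w)}"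
  have agree_G: "AE w in M. w \<in> B \<longrightarrow> G y w = G z w"
    if B: "B \<in> sets M" and y: "y \<in> carrier E" and z: "z \<in> carrier E" and ag: "agree B y z" for B y z
  proof -
    have "AE w in M. \<forall>n\<in>Q. w \<in> B \<longrightarrow> ae_rep (n (y \<ominus>\<^bsub>E\<^esub> x)) w = ae_rep (n (z \<ominus>\<^bsub>E\<^esub> x)) w"
    proof (rule AE_finite_allI[OF Q(2)])
      fix n assume "n \<in> Q"
      have "agree B (y \<ominus>\<^bsub>E\<^esub> x) (z \<ominus>\<^bsub>E\<^esub> x)"
        using B x y z ag by (intro agree_minus) (auto simp: agree_def)
      then show "AE w in M. w \<in> B \<longrightarrow> ae_rep (n (y \<ominus>\<^bsub>E\<^esub> x)) w = ae_rep (n (z \<ominus>\<^bsub>E\<^esub> x)) w"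
        using B x y z by (intro agree_seminorm[OF sem[OF \<open>n \<in> Q\<close>]]) auto
    qed
    with agree_F[OF B y z ag] show ?thesis
      unfolding G_def by eventually_elim auto
  qed
  \<comment> \<open>The competitor \<open>?z\<close> is \<open>y\<close> on \<open>B\<close> and
    \<open>y0\<close> elsewhere. Outside \<open>D - B\<close> it is close to \<open>?x\<close> and
    \<open>?s\<close> equals \<open>?r\<close>, while \<open>F ?z\<close> is at most
    \<open>?s\<close> everywhere; if \<open>D - B\<close> had probability below \<delta>, this would
    contradict \<open>far\<close>.\<close>
  have small: "prob B \<le> prob D - \<delta>" if BB: "B \<in> \<B>" for B
  proof (rule ccontr)
    assume "\<not> prob B \<le> prob D - \<delta>"
    from BB obtain y where B: "B \<in> sets M" "B \<subseteq> D" and y: "y \<in> carrier E"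
      and G: "AE w in M. w \<in> B \<longrightarrow> G y w"
      by (auto simp: \<B>_def)
    note [measurable] = B(1)
    let ?z = "splice B y y0"
    let ?s = "\<lambda>w. if w \<in> B then q else real_of_ereal (F y0 w)"
    let ?C = "B \<union> (space M - D)"
    have zE: "?z \<in> carrier E" using B y y0E by simp
    have "prob (D - B) < \<delta>"
      using \<open>\<not> prob B \<le> prob D - \<delta>\<close> B D by (simp add: finite_measure_Diff)
    moreover have "?C = space M - (D - B)" using B(2) Dsp by auto
    ultimately have C: "1 - \<delta> < prob ?C" using B D by (simp add: prob_compl)
    have "agree B (?z \<ominus>\<^bsub>E\<^esub> ?x) (y \<ominus>\<^bsub>E\<^esub> x)"
      using B D x y y0E by (intro agree_minus agree_splice_inside) auto
    then have 1: "AE w in M. w \<in> B \<longrightarrow> ae_rep (n (?z \<ominus>\<^bsub>E\<^esub> ?x)) w = ae_rep (n (y \<ominus>\<^bsub>E\<^esub> x)) w"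
      if "n \<in> Q" for n
      using B D x y y0E by (intro agree_seminorm[OF sem[OF that]]) auto
    have "agree (space M - D) (?z \<ominus>\<^bsub>E\<^esub> ?x) (y0 \<ominus>\<^bsub>E\<^esub> y0)"
      using B D x y y0E by (intro agree_minus agree_splice_outside) auto
    then have "agree (space M - D) (?z \<ominus>\<^bsub>E\<^esub> ?x) \<zero>\<^bsub>E\<^esub>"
      using y0E by (simp add: M.minus_eq M.r_neg)
    then have 2: "AE w in M. w \<in> space M - D \<longrightarrow> ae_rep (n (?z \<ominus>\<^bsub>E\<^esub> ?x)) w = ae_rep (n \<zero>\<^bsub>E\<^esub>) w"
      if "n \<in> Q" for n
      using B D x y y0E by (intro agree_seminorm[OF sem[OF that]]) auto
    have 0: "AE w in M. ae_rep (n \<zero>\<^bsub>E\<^esub>) w = 0" if "n \<in> Q" for n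
      using seminorm_scale[OF sem[OF that] M.zero_closed, of "\<lambda>_. 0"] by simp
    have "AE w in M. \<forall>n\<in>Q. w \<in> ?C \<longrightarrow> ae_rep (n (?z \<ominus>\<^bsub>E\<^esub> ?x)) w < \<epsilon>"
    proof (rule AE_finite_allI[OF Q(2)])
      fix n assume n: "n \<in> Q"
      from 1[OF n] 2[OF n] 0[OF n] G
      show "AE w in M. w \<in> ?C \<longrightarrow> ae_rep (n (?z \<ominus>\<^bsub>E\<^esub> ?x)) w < \<epsilon>"
        by eventually_elim (use Q(4) n in \<open>auto simp: G_def\<close>)
    qed
    then have "prob ?C \<le> prob {w \<in> space M. \<forall>n\<in>Q. ae_rep (n (?z \<ominus>\<^bsub>E\<^esub> ?x)) w < \<epsilon>}"
      using meas zE xE sets.sets_into_space[OF B(1)]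
      by (intro finite_measure_mono_AE) (auto elim!: AE_mp)
    with C have near1: "1 - \<delta> < prob {w \<in> space M. \<forall>n\<in>Q. ae_rep (n (?z \<ominus>\<^bsub>E\<^esub> ?x)) w < \<epsilon>}" by simp
    have "?C \<subseteq> {w \<in> space M. \<bar>?s w - ?r w\<bar> < \<epsilon>}"
      using B(2) Dsp Q(4) by auto
    then have "prob ?C \<le> prob {w \<in> space M. \<bar>?s w - ?r w\<bar> < \<epsilon>}"
      by (rule finite_measure_mono) measurable
    with C have near2: "1 - \<delta> < prob {w \<in> space M. \<bar>?s w - ?r w\<bar> < \<epsilon>}" by simp
    have s: "rv ?s" by measurable
    have "AE w in M. w \<in> B \<longrightarrow> F ?z w = F y w"
      using B y y0E by (intro agree_F agree_splice_inside) auto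
    moreover have "AE w in M. w \<in> space M - B \<longrightarrow> F ?z w = F y0 w"
      using B y y0E by (intro agree_F agree_splice_outside) auto
    ultimately have "AE w in M. F ?z w \<le> ereal (?s w)"
      using G F_dom[OF y0] AE_space by eventually_elim (auto simp: G_def)
    then show False using far[OF zE s near1 near2] by blast
  qed
  have empty: "{} \<in> \<B>" using y0E by (auto simp: \<B>_def)
  have union: "B \<union> C \<in> \<B>" if B: "B \<in> \<B>" and C: "C \<in> \<B>" for B C
  proof -
    from B obtain y where B: "B \<in> sets M" "B \<subseteq> D" and y: "y \<in> carrier E" "AE w in M. w \<in> B \<longrightarrow> G y w"
      by (auto simp: \<B>_def)
    from C obtain z where C: "C \<in> sets M" "C \<subseteq> D" and z: "z \<in> carrier E" "AE w in M. w \<in> C \<longrightarrow> G z w"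
      by (auto simp: \<B>_def)
    have yz: "splice B y z \<in> carrier E" using B y z by simp
    have "AE w in M. w \<in> B \<longrightarrow> G (splice B y z) w = G y w"
      using B y(1) z(1) yz by (intro agree_G agree_splice_inside) auto
    moreover have "AE w in M. w \<in> C - B \<longrightarrow> G (splice B y z) w = G z w"
      using B C y(1) z(1) yz by (intro agree_G agree_splice_outside) auto
    ultimately have "AE w in M. w \<in> B \<union> C \<longrightarrow> G (splice B y z) w"
      using y(2) z(2) by eventually_elim auto
    then show ?thesis using B C yz by (auto simp: \<B>_def)
  qed
  have "\<B> \<subseteq> sets M" by (auto simp: \<B>_def)
  then obtain C where C: "C \<in> sets M" "C \<subseteq> \<Union>\<B>" "prob C \<le> prob D - \<delta>"
    "\<And>B. B \<in> \<B> \<Longrightarrow> prob (B - C) = 0"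
    by (rule exhaustion[OF _ empty union small]) (assumption+, rule that)
  have CD: "C \<subseteq> D" using C(2) by (auto simp: \<B>_def)
  show thesis
  proof (rule that[of "D - C" Q \<epsilon>])
    show "0 < prob (D - C)" using C(1,3) CD D Q(5) by (simp add: finite_measure_Diff)
    fix y assume y: "y \<in> carrier E"
    have [measurable]: "F y \<in> borel_measurable M" by (rule F_measurable[OF y])
    have "{w \<in> space M. G y w} = {w \<in> space M. \<forall>n\<in>Q. ae_rep (n (y \<ominus>\<^bsub>E\<^esub> x)) w < \<epsilon>} \<inter> {w \<in> space M. F y w < ereal q}"
      by (auto simp: G_def)
    also have "\<dots> \<in> sets M" using meas x y by (intro sets.Int) auto
    finally have Gm: "{w \<in> space M. G y w} \<in> sets M" .
    \<comment> \<open>The whole event in \<open>D\<close> on which \<open>y\<close> violates the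
      claim is bad, with \<open>y\<close> as its own witness, hence null outside
      \<open>C\<close>.\<close>
    then have "D \<inter> {w \<in> space M. G y w} \<in> \<B>" using y D(1) by (auto simp: \<B>_def)
    then have "prob (D \<inter> {w \<in> space M. G y w} - C) = 0" by (rule C(4))
    then have "AE w in M. w \<notin> D \<inter> {w \<in> space M. G y w} - C"
      using Gm D(1) C(1) by (subst (asm) prob_eq_0) auto
    then show "AE w in M. w \<in> D - C \<longrightarrow> (\<forall>n\<in>Q. ae_rep (n (y \<ominus>\<^bsub>E\<^esub> x)) w < \<epsilon>) \<longrightarrow> ereal q \<le> F y w"
      using AE_space by eventually_elim (auto simp: G_def not_less)
  qed (use C(1) D(1) Q in auto)
qed

text \<open>The claim is that a cone with apex at height \<open>q\<close> over \<open>x\<close> lies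
  below \<open>f\<close> on \<open>A\<close>. Within \<epsilon>2 of \<open>x\<close> this is
  \<open>separation\<close>; beyond that distance the slope \<open>K\<close> is large enough to
  bring the cone below \<open>minorant\<close>.\<close>

lemma lower_support:
  assumes x: "x \<in> carrier E" and D: "D \<in> sets M" "0 < prob D"
    and above: "AE w in M. w \<in> D \<longrightarrow> ereal q < F x w"
  obtains A Q K where "A \<in> sets M" "A \<subseteq> D" "0 < prob A" "Q \<subseteq> P" "finite Q" "Q \<noteq> {}" "0 \<le> K"
    "\<And>y. y \<in> carrier E \<Longrightarrow>
      AE w in M. w \<in> A \<longrightarrow> ereal q \<le> F y w + ereal (K * (\<Sum>n\<in>Q. ae_rep (n (y \<ominus>\<^bsub>E\<^esub> x)) w))"
proof -
  obtain y0 where y0: "y0 \<in> L0_dom M E f" by (rule dom_nonempty)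
  note y0E = dom_closed[OF y0]
  have "(\<lambda>w. real_of_ereal (F y0 w)) \<in> borel_measurable M" using F_measurable[OF y0E] by measurable
  from bounded_on_positive_subset[OF D this]
  obtain k :: nat where k: "0 < prob {w \<in> D. \<bar>real_of_ereal (F y0 w)\<bar> < k}"
      "{w \<in> D. \<bar>real_of_ereal (F y0 w)\<bar> < k} \<in> sets M" .
  let ?D = "{w \<in> D. \<bar>real_of_ereal (F y0 w)\<bar> < k}"
  \<comment> \<open>On \<open>?D\<close> the value at \<open>y0\<close> lies strictly between
    \<open>-k\<close> and \<open>k\<close>: the lower end is the level for
    \<open>separation\<close>, the upper end enters the convexity estimate.\<close>
  have above1: "AE w in M. w \<in> ?D \<longrightarrow> ereal (- real k) < F y0 w"
    using F_dom[OF y0]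
  proof eventually_elim
    case (elim w)
    then show ?case by (cases "F y0 w") auto
  qed
  obtain A1 Q1 \<epsilon>1 where A1: "A1 \<in> sets M" "A1 \<subseteq> ?D" "0 < prob A1"
    and Q1: "Q1 \<subseteq> P" "finite Q1" "Q1 \<noteq> {}" "0 < \<epsilon>1"
    and sep1: "\<And>y. y \<in> carrier E \<Longrightarrow> AE w in M. w \<in> A1 \<longrightarrow>
      (\<forall>n\<in>Q1. ae_rep (n (y \<ominus>\<^bsub>E\<^esub> y0)) w < \<epsilon>1) \<longrightarrow> ereal (- real k) \<le> F y w"
    by (rule separation[OF y0E k(2,1) above1]) (rule that)
  have sem1: "\<And>n. n \<in> Q1 \<Longrightarrow> L0_seminorm M E n" using Q1 seminorms by blast
  define S where "S = (\<lambda>z w. \<Sum>n\<in>Q1. ae_rep (n z) w)"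
  have S_rv: "rv (S z)" if "z \<in> carrier E" for z
    unfolding S_def using seminorm_rv(2)[OF sem1 that] by (intro borel_measurable_sum) auto
  \<comment> \<open>The bound on the neighbourhood of \<open>y0\<close> becomes a global linear lower bound by convexity
    along the segment from \<open>y0\<close> to \<open>y\<close>.\<close>
  have minorant: "AE w in M. w \<in> A1 \<longrightarrow> ereal (- real k - 2 * real k / \<epsilon>1 * S (y \<ominus>\<^bsub>E\<^esub> y0) w) \<le> F y w"
    if y: "y \<in> carrier E" for y
  proof -
    have d: "y \<ominus>\<^bsub>E\<^esub> y0 \<in> carrier E" using y y0E by simp
    let ?S = "S (y \<ominus>\<^bsub>E\<^esub> y0)"
    \<comment> \<open>The coefficient pulls \<open>y\<close> towards \<open>y0\<close> until every
      seminorm of the difference is below \<epsilon>1. The maximum with \<open>0\<close> keeps it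
      positive and at most \<open>1\<close> everywhere, as \<open>?S\<close> is known to be
      nonnegative only almost everywhere.\<close>
    let ?t = "\<lambda>w. \<epsilon>1 / (\<epsilon>1 + max 0 (?S w))"
    let ?z = "?t \<star> y \<oplus>\<^bsub>E\<^esub> (\<lambda>w. 1 - ?t w) \<star> y0"
    have pos: "0 < \<epsilon>1 + max 0 (?S w)" for w using Q1(4) by (simp add: add_pos_nonneg)
    have t: "rv ?t" "\<And>w. 0 \<le> ?t w \<and> ?t w \<le> 1" "\<And>w. 0 < ?t w"
      using S_rv[OF d] Q1(4) pos by (auto simp: divide_le_eq_1 less_imp_le)
    have zE: "?z \<in> carrier E" using y y0E t by simp
    have "(\<lambda>w. 1 - ?t w) \<star> y0 = y0 \<oplus>\<^bsub>E\<^esub> \<ominus>\<^bsub>E\<^esub> (?t \<star> y0)"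
      using sc_add_left[of "\<lambda>_. 1" "\<lambda>w. - ?t w" y0] sc_minus[OF t(1) y0E] t y0E by simp
    then have "?z \<ominus>\<^bsub>E\<^esub> y0 = ?t \<star> y \<oplus>\<^bsub>E\<^esub> \<ominus>\<^bsub>E\<^esub> (?t \<star> y0)"
      using t y y0E by (simp add: M.minus_eq M.a_ac M.r_neg1 M.r_neg2 M.r_neg M.l_neg)
    also have "\<dots> = ?t \<star> (y \<ominus>\<^bsub>E\<^esub> y0)"
      using t y y0E sc_minus[OF t(1) y0E] sc_sc[OF t(1), of "\<lambda>_. -1" y0]
      by (simp add: M.minus_eq sc_add_right minus_as_scale)
    finally have zd: "?z \<ominus>\<^bsub>E\<^esub> y0 = ?t \<star> (y \<ominus>\<^bsub>E\<^esub> y0)" .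
    have nonneg: "AE w in M. \<forall>n\<in>Q1. 0 \<le> ae_rep (n (y \<ominus>\<^bsub>E\<^esub> y0)) w"
      using seminorm_nonneg[OF sem1 d] by (intro AE_finite_allI Q1) auto
    have scaled: "AE w in M. \<forall>n\<in>Q1. ae_rep (n (?z \<ominus>\<^bsub>E\<^esub> y0)) w = ?t w * ae_rep (n (y \<ominus>\<^bsub>E\<^esub> y0)) w"
    proof (rule AE_finite_allI[OF Q1(2)])
      fix n assume n: "n \<in> Q1"
      from seminorm_scale[OF sem1[OF n] d t(1)]
      show "AE w in M. ae_rep (n (?z \<ominus>\<^bsub>E\<^esub> y0)) w = ?t w * ae_rep (n (y \<ominus>\<^bsub>E\<^esub> y0)) w"
        unfolding zd
      proof eventually_elim
        case (elim w)
        then show ?case using t(2)[of w] by (simp only: abs_of_nonneg)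
      qed
    qed
    from sep1[OF zE] F_convex[OF y y0E t(1,2)] nonneg scaled F_dom[OF y0] F_not_minf[OF y]
    show ?thesis
    proof eventually_elim
      case (elim w)
      show ?case
      proof
        assume w: "w \<in> A1"
        have S0: "0 \<le> ?S w" unfolding S_def using elim(3) by (intro sum_nonneg) auto
        have near: "ae_rep (n (?z \<ominus>\<^bsub>E\<^esub> y0)) w < \<epsilon>1" if n: "n \<in> Q1" for n
        proof -
          have "ae_rep (n (y \<ominus>\<^bsub>E\<^esub> y0)) w \<le> ?S w"
            unfolding S_def using elim(3) Q1(2) n by (intro member_le_sum) auto
          then have "?t w * ae_rep (n (y \<ominus>\<^bsub>E\<^esub> y0)) w \<le> ?t w * ?S w"
            using t(3)[of w] by (intro mult_left_mono) auto
          also have "\<dots> < \<epsilon>1" using S0 Q1(4) by (simp add: field_simps)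
          finally show ?thesis using elim(4) n by simp
        qed
        with elim(1) w have "ereal (- real k) \<le> F ?z w" by blast
        with elim(2) have le: "ereal (- real k) \<le> ereal (?t w) * F y w + ereal (1 - ?t w) * F y0 w"
          by (rule order_trans[rotated])
        obtain b where b: "F y0 w = ereal b" using elim(5) by metis
        have bk: "b < k" using A1(2) w b by auto
        show "ereal (- real k - 2 * real k / \<epsilon>1 * ?S w) \<le> F y w"
        proof (cases "F y w")
          case (real a)
          have "- real k \<le> ?t w * a + (1 - ?t w) * b" using le real b by simp
          also have "\<dots> \<le> ?t w * a + (1 - ?t w) * k"
            using t(2)[of w] bk by (intro add_left_mono mult_left_mono) auto
          finally have "- real k \<le> ?t w * a + (1 - ?t w) * k" .
          \<comment> \<open>The convexity estimate is solved for \<open>a\<close>; with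
            \<open>c = ?t w\<close> the value \<open>k - 2 * k / c\<close> becomes
            \<open>- k - 2 * k / \<epsilon>1 * ?S w\<close>.\<close>
          moreover have "real k - 2 * real k / c \<le> a"
            if "0 < c" "- real k \<le> c * a + (1 - c) * k" for c
            using that by (simp add: field_simps)
          ultimately have "k - 2 * real k / ?t w \<le> a" using t(3)[of w] by blast
          moreover have "2 * real k / ?t w = 2 * real k + 2 * real k / \<epsilon>1 * ?S w"
            using S0 Q1(4) by (simp add: field_simps)
          ultimately show ?thesis using real by simp
        qed (use elim(6) in auto)
      qed
    qed
  qed
  have d0: "x \<ominus>\<^bsub>E\<^esub> y0 \<in> carrier E" using x y0E by simp
  \<comment> \<open>Where \<open>S (x - y0)\<close> is below \<open>L\<close>, recentring the
    minorant from \<open>y0\<close> to \<open>x\<close> costs only a constant multiple of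
    \<open>L\<close>.\<close>
  from bounded_on_positive_subset[OF A1(1,3) S_rv[OF d0]]
  obtain L :: nat where L: "0 < prob {w \<in> A1. \<bar>S (x \<ominus>\<^bsub>E\<^esub> y0) w\<bar> < L}"
      "{w \<in> A1. \<bar>S (x \<ominus>\<^bsub>E\<^esub> y0) w\<bar> < L} \<in> sets M" .
  let ?A = "{w \<in> A1. \<bar>S (x \<ominus>\<^bsub>E\<^esub> y0) w\<bar> < L}"
  have above2: "AE w in M. w \<in> ?A \<longrightarrow> ereal q < F x w"
    using above by eventually_elim (use A1(2) in auto)
  obtain A2 Q2 \<epsilon>2 where A2: "A2 \<in> sets M" "A2 \<subseteq> ?A" "0 < prob A2"
    and Q2: "Q2 \<subseteq> P" "finite Q2" "Q2 \<noteq> {}" "0 < \<epsilon>2"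
    and sep2: "\<And>y. y \<in> carrier E \<Longrightarrow> AE w in M. w \<in> A2 \<longrightarrow>
      (\<forall>n\<in>Q2. ae_rep (n (y \<ominus>\<^bsub>E\<^esub> x)) w < \<epsilon>2) \<longrightarrow> ereal q \<le> F y w"
    by (rule separation[OF x L(2,1) above2]) (rule that)
  define Q where "Q = Q1 \<union> Q2"
  have Q: "Q \<subseteq> P" "finite Q" "Q \<noteq> {}" using Q1 Q2 by (auto simp: Q_def)
  have sem: "\<And>n. n \<in> Q \<Longrightarrow> L0_seminorm M E n" using Q seminorms by blast
  define K1 where "K1 = 2 * real k / \<epsilon>1"
  have K1: "0 \<le> K1" using Q1(4) by (simp add: K1_def)
  \<comment> \<open>\<open>R\<close> covers the gap between \<open>q\<close> and the minorant
    recentred at \<open>x\<close>. Where some seminorm in \<open>Q2\<close> reaches \<epsilon>2, the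
    sum over \<open>Q\<close> does too, so the extra slope \<open>R / \<epsilon>2\<close>
    contributes at least \<open>R\<close>. The absolute value of \<open>q\<close> keeps
    \<open>R\<close> nonnegative.\<close>
  define R where "R = \<bar>q\<bar> + real k + K1 * real L"
  have R: "0 \<le> R" using K1 by (simp add: R_def)
  define K where "K = K1 + R / \<epsilon>2"
  have K: "0 \<le> K" using K1 R Q2(4) by (simp add: K_def)
  show thesis
  proof (rule that[OF A2(1) _ A2(3) Q K])
    show "A2 \<subseteq> D" using A1(2) A2(2) by blast
    fix y assume y: "y \<in> carrier E"
    let ?T = "\<lambda>w. \<Sum>n\<in>Q. ae_rep (n (y \<ominus>\<^bsub>E\<^esub> x)) w"
    have d: "y \<ominus>\<^bsub>E\<^esub> x \<in> carrier E" using x y by simp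
    have nonneg: "AE w in M. \<forall>n\<in>Q. 0 \<le> ae_rep (n (y \<ominus>\<^bsub>E\<^esub> x)) w"
      using seminorm_nonneg[OF sem d] by (intro AE_finite_allI Q) auto
    have tri: "AE w in M. \<forall>n\<in>Q1. ae_rep (n (y \<ominus>\<^bsub>E\<^esub> y0)) w \<le> ae_rep (n (y \<ominus>\<^bsub>E\<^esub> x)) w + ae_rep (n (x \<ominus>\<^bsub>E\<^esub> y0)) w"
    proof (rule AE_finite_allI[OF Q1(2)])
      fix n assume n: "n \<in> Q1"
      have "y \<ominus>\<^bsub>E\<^esub> y0 = (y \<ominus>\<^bsub>E\<^esub> x) \<oplus>\<^bsub>E\<^esub> (x \<ominus>\<^bsub>E\<^esub> y0)"
        using x y y0E by (simp add: M.minus_eq M.a_assoc M.r_neg1)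
      then show "AE w in M. ae_rep (n (y \<ominus>\<^bsub>E\<^esub> y0)) w \<le> ae_rep (n (y \<ominus>\<^bsub>E\<^esub> x)) w + ae_rep (n (x \<ominus>\<^bsub>E\<^esub> y0)) w"
        using seminorm_triangle[OF sem1[OF n] d d0] by simp
    qed
    from sep2[OF y] minorant[OF y] nonneg tri
    show "AE w in M. w \<in> A2 \<longrightarrow> ereal q \<le> F y w + ereal (K * ?T w)"
    proof eventually_elim
      case (elim w)
      show ?case
      proof
        assume w: "w \<in> A2"
        have T0: "0 \<le> ?T w" using elim(3) by (intro sum_nonneg) auto
        show "ereal q \<le> F y w + ereal (K * ?T w)"
        proof (cases "\<forall>n\<in>Q2. ae_rep (n (y \<ominus>\<^bsub>E\<^esub> x)) w < \<epsilon>2")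
          case True
          then have "ereal q \<le> F y w" using elim(1) w by blast
          moreover have "0 \<le> K * ?T w" using K T0 by simp
          ultimately show ?thesis by (metis add_increasing2 ereal_less_eq(5))
        next
          case False
          then obtain n where n: "n \<in> Q2" "\<epsilon>2 \<le> ae_rep (n (y \<ominus>\<^bsub>E\<^esub> x)) w" by (auto simp: not_less)
          have "ae_rep (n (y \<ominus>\<^bsub>E\<^esub> x)) w \<le> ?T w"
            using elim(3) Q(2) n(1) by (intro member_le_sum) (auto simp: Q_def)
          with n(2) have "\<epsilon>2 \<le> ?T w" by simp
          then have RT: "R \<le> R / \<epsilon>2 * ?T w"
            using mult_left_mono[of \<epsilon>2 "?T w" "R / \<epsilon>2"] R Q2(4) by simp
          have "S (y \<ominus>\<^bsub>E\<^esub> y0) w \<le> (\<Sum>n\<in>Q1. ae_rep (n (y \<ominus>\<^bsub>E\<^esub> x)) w + ae_rep (n (x \<ominus>\<^bsub>E\<^esub> y0)) w)"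
            unfolding S_def using elim(4) by (intro sum_mono) auto
          also have "\<dots> = (\<Sum>n\<in>Q1. ae_rep (n (y \<ominus>\<^bsub>E\<^esub> x)) w) + S (x \<ominus>\<^bsub>E\<^esub> y0) w"
            by (simp add: S_def sum.distrib)
          also have "\<dots> \<le> ?T w + L"
          proof (rule add_mono)
            show "(\<Sum>n\<in>Q1. ae_rep (n (y \<ominus>\<^bsub>E\<^esub> x)) w) \<le> ?T w"
              using elim(3) Q(2) by (intro sum_mono2) (auto simp: Q_def)
            show "S (x \<ominus>\<^bsub>E\<^esub> y0) w \<le> L" using A2(2) w by auto
          qed
          finally have "K1 * S (y \<ominus>\<^bsub>E\<^esub> y0) w \<le> K1 * ?T w + K1 * L"
            using K1 by (metis distrib_left mult_left_mono)
          then have "q - K * ?T w \<le> - real k - K1 * S (y \<ominus>\<^bsub>E\<^esub> y0) w"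
            using RT by (simp add: K_def R_def distrib_right)
          moreover have "ereal (- real k - K1 * S (y \<ominus>\<^bsub>E\<^esub> y0) w) \<le> F y w"
            using elim(2) w A2(2) by (auto simp: K1_def)
          ultimately have "ereal (q - K * ?T w) \<le> F y w"
            by (meson ereal_less_eq(3) order_trans)
          then show ?thesis by (cases "F y w") auto
        qed
      qed
    qed
  qed
qed

end

section \<open>Conjugates\<close>

lemma L0bar_diff:
  assumes "X \<in> ae_classes M" "Y \<in> ae_classes M"
  shows L0bar_diff_in: "ae_lift2 M (-) (of_L0 M X) Y \<in> ae_classes M"
    and L0bar_diff_rep: "AE w in M. ae_rep (ae_lift2 M (-) (of_L0 M X) Y) w = ereal (ae_rep X w) - ae_rep Y w"
proof -
  have X: "of_L0 M X \<in> ae_classes M" using assms by (intro ae_lift1_in) auto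
  show "ae_lift2 M (-) (of_L0 M X) Y \<in> ae_classes M"
    by (intro ae_lift2_in X assms borel_measurable_ereal_diff)
  have "AE w in M. ae_rep (ae_lift2 M (-) (of_L0 M X) Y) w = ae_rep (of_L0 M X) w - ae_rep Y w"
    by (intro ae_lift2_rep X assms borel_measurable_ereal_diff)
  moreover have "AE w in M. ae_rep (of_L0 M X) w = ereal (ae_rep X w)"
    using assms by (intro ae_lift1_rep) auto
  ultimately show "AE w in M. ae_rep (ae_lift2 M (-) (of_L0 M X) Y) w = ereal (ae_rep X w) - ae_rep Y w"
    by eventually_elim simp
qed

section \<open>The Fenchel-Young inequality and its converse\<close>

context lsc_convex_function
begin

lemma conjugate:
  assumes g: "g \<in> carrier E \<rightarrow> ae_classes M"
  shows conjugate_in: "el_conjugate M E f g \<in> ae_classes M"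
    and conjugate_upper: "x \<in> carrier E \<Longrightarrow>
      AE w in M. ereal (ae_rep (g x) w) - F x w \<le> ae_rep (el_conjugate M E f g) w"
    and conjugate_least: "u \<in> borel_measurable M \<Longrightarrow>
      (\<And>x. x \<in> carrier E \<Longrightarrow> AE w in M. ereal (ae_rep (g x) w) - F x w \<le> u w) \<Longrightarrow>
      AE w in M. ae_rep (el_conjugate M E f g) w \<le> u w"
proof -
  let ?A = "{ae_lift2 M (-) (of_L0 M (g x)) (f x) | x. x \<in> carrier E}"
  have gx: "g x \<in> ae_classes M" if "x \<in> carrier E" for x using g that by blast
  have A: "?A \<subseteq> ae_classes M" using L0bar_diff_in[OF gx f_in] by blast
  show "el_conjugate M E f g \<in> ae_classes M"
    unfolding el_conjugate_def by (rule L0bar_sup_closed[OF A])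
  show "AE w in M. ereal (ae_rep (g x) w) - F x w \<le> ae_rep (el_conjugate M E f g) w"
    if x: "x \<in> carrier E"
  proof -
    have "ae_lift2 M (-) (of_L0 M (g x)) (f x) \<in> ?A" using x by blast
    from L0bar_sup_upper[OF A this] L0bar_diff_rep[OF gx[OF x] f_in[OF x]]
    show ?thesis unfolding el_conjugate_def by eventually_elim simp
  qed
  show "AE w in M. ae_rep (el_conjugate M E f g) w \<le> u w"
    if u: "u \<in> borel_measurable M"
      and le: "\<And>x. x \<in> carrier E \<Longrightarrow> AE w in M. ereal (ae_rep (g x) w) - F x w \<le> u w"
    unfolding el_conjugate_def
  proof (rule L0bar_sup_least[OF A u])
    fix X assume "X \<in> ?A"
    then obtain x where x: "x \<in> carrier E" "X = ae_lift2 M (-) (of_L0 M (g x)) (f x)" by blast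
    from le[OF x(1)] L0bar_diff_rep[OF gx[OF x(1)] f_in[OF x(1)]]
    show "AE w in M. ae_rep X w \<le> u w" unfolding x(2) by eventually_elim simp
  qed
qed

lemma el_dual_into: "g \<in> el_dual M E P \<Longrightarrow> g \<in> carrier E \<rightarrow> ae_classes M"
  by (simp add: el_dual_def)

lemma biconjugate:
  assumes x: "x \<in> carrier E"
  shows biconjugate_in: "el_biconjugate M E P f x \<in> ae_classes M"
    and biconjugate_upper: "g \<in> el_dual M E P \<Longrightarrow>
      AE w in M. ereal (ae_rep (g x) w) - ae_rep (el_conjugate M E f g) w \<le> ae_rep (el_biconjugate M E P f x) w"
    and biconjugate_le: "AE w in M. ae_rep (el_biconjugate M E P f x) w \<le> F x w"
proof -
  let ?A = "{ae_lift2 M (-) (of_L0 M (g x)) (el_conjugate M E f g) | g. g \<in> el_dual M E P}"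
  have gx: "g x \<in> ae_classes M" if "g \<in> el_dual M E P" for g using el_dual_into[OF that] x by blast
  note cj = conjugate_in[OF el_dual_into]
  have A: "?A \<subseteq> ae_classes M" using L0bar_diff_in[OF gx cj] by blast
  show "el_biconjugate M E P f x \<in> ae_classes M"
    unfolding el_biconjugate_def by (rule L0bar_sup_closed[OF A])
  show "AE w in M. ereal (ae_rep (g x) w) - ae_rep (el_conjugate M E f g) w \<le> ae_rep (el_biconjugate M E P f x) w"
    if g: "g \<in> el_dual M E P"
  proof -
    have "ae_lift2 M (-) (of_L0 M (g x)) (el_conjugate M E f g) \<in> ?A" using g by blast
    from L0bar_sup_upper[OF A this] L0bar_diff_rep[OF gx[OF g] cj[OF g]]
    show ?thesis unfolding el_biconjugate_def by eventually_elim simp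
  qed
  show "AE w in M. ae_rep (el_biconjugate M E P f x) w \<le> F x w"
    unfolding el_biconjugate_def
  proof (rule L0bar_sup_least[OF A F_measurable[OF x]])
    fix X assume "X \<in> ?A"
    then obtain g where g: "g \<in> el_dual M E P" "X = ae_lift2 M (-) (of_L0 M (g x)) (el_conjugate M E f g)"
      by blast
    from L0bar_diff_rep[OF gx[OF g(1)] cj[OF g(1)]] conjugate_upper[OF el_dual_into[OF g(1)] x] F_not_minf[OF x]
    show "AE w in M. ae_rep X w \<le> F x w"
      unfolding g(2)
    proof eventually_elim
      case (elim w)
      then show ?case
        by (cases "F x w"; cases "ae_rep (el_conjugate M E f g) w") auto
    qed
  qed
qed

text \<open>The sandwich theorem is applied to the domain shifted by \<open>-x\<close>; the cone
  from \<open>lower_support\<close> supplies its nonnegativity hypothesis, and the linear map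
  obtained is an element of the dual whose value in the biconjugate supremum reaches the level
  \<open>q\<close> on \<open>A\<close>.\<close>

lemma biconjugate_ge:
  assumes x: "x \<in> carrier E"
  shows "AE w in M. F x w \<le> ae_rep (el_biconjugate M E P f x) w"
proof (rule ccontr)
  let ?B = "ae_rep (el_biconjugate M E P f x)"
  have [measurable]: "?B \<in> borel_measurable M" by (rule ae_class_rep(1)[OF biconjugate_in[OF x]])
  have [measurable]: "F x \<in> borel_measurable M" by (rule F_measurable[OF x])
  \<comment> \<open>Levels are rational so that the event where the inequality fails is a countable
    union of the \<open>D q\<close>; one of them then has positive probability.\<close>
  define D where "D = (\<lambda>q. {w \<in> space M. ?B w < ereal (real_of_rat q) \<and> ereal (real_of_rat q) < F x w})"
  have Ds: "D q \<in> sets M" for q unfolding D_def by measurable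
  assume notle: "\<not> (AE w in M. F x w \<le> ?B w)"
  obtain q where q: "0 < prob (D q)"
  proof (rule ccontr)
    assume "\<not> thesis"
    then have "prob (D q) = 0" for q using that[of q] measure_nonneg[of M "D q"] by linarith
    then have "AE w in M. w \<notin> D q" for q using prob_eq_0[OF Ds] by blast
    then have "AE w in M. \<forall>q. w \<notin> D q" by (simp add: AE_all_countable)
    then have "AE w in M. F x w \<le> ?B w"
      using AE_space
    proof eventually_elim
      case (elim w)
      show ?case
      proof (rule ccontr)
        assume "\<not> F x w \<le> ?B w"
        then obtain r where r: "?B w < ereal r" "ereal r < F x w"
          using ereal_dense2[of "?B w" "F x w"] by (auto simp: not_le)
        then obtain r' where r': "ereal r < ereal r'" "ereal r' < F x w"
          using ereal_dense2[of "ereal r" "F x w"] by blast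
        then obtain p where p: "r < real_of_rat p" "real_of_rat p < r'"
          using of_rat_dense[of r r'] by auto
        have "?B w < ereal (real_of_rat p)" using r(1) p(1) by (meson ereal_less(2) less_trans less_ereal.simps(1))
        moreover have "ereal (real_of_rat p) < F x w" using r'(2) p(2) by (meson less_trans less_ereal.simps(1))
        ultimately show False using elim by (auto simp: D_def)
      qed
    qed
    with notle show False by blast
  qed
  let ?q = "real_of_rat q"
  have above: "AE w in M. w \<in> D q \<longrightarrow> ereal ?q < F x w" by (auto simp: D_def)
  obtain A Q K where A: "A \<in> sets M" "A \<subseteq> D q" "0 < prob A"
    and Q: "Q \<subseteq> P" "finite Q" "Q \<noteq> {}" and K: "0 \<le> K"
    and supp: "\<And>y. y \<in> carrier E \<Longrightarrow>
      AE w in M. w \<in> A \<longrightarrow> ereal ?q \<le> F y w + ereal (K * (\<Sum>n\<in>Q. ae_rep (n (y \<ominus>\<^bsub>E\<^esub> x)) w))"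
    by (rule lower_support[OF x Ds q above]) (rule that)
  note [measurable] = A(1)
  have sem: "\<And>n. n \<in> Q \<Longrightarrow> L0_seminorm M E n" using Q seminorms by blast
  define T where "T = (\<lambda>z w. K * (\<Sum>n\<in>Q. ae_rep (n z) w))"
  have T_rv: "rv (T z)" if "z \<in> carrier E" for z
    unfolding T_def using seminorm_rv(2)[OF sem that]
    by (intro borel_measurable_times borel_measurable_sum) auto
  \<comment> \<open>Off \<open>A\<close> no bound is available. The factor
    \<open>indicator A\<close>, here and in \<open>h\<close>, makes both sides vanish there, so the
    hypotheses of \<open>sandwich\<close> hold trivially off \<open>A\<close>.\<close>
  define p where "p = (\<lambda>z w. indicator A w * T z w)"
  have p: "sublinear p"
    unfolding sublinear_def
  proof (intro conjI ballI allI impI)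
    show "rv (p z)" if "z \<in> carrier E" for z
      unfolding p_def using T_rv[OF that] by measurable
    fix y z assume yz: "y \<in> carrier E" "z \<in> carrier E"
    have "AE w in M. \<forall>n\<in>Q. ae_rep (n (y \<oplus>\<^bsub>E\<^esub> z)) w \<le> ae_rep (n y) w + ae_rep (n z) w"
      using sem yz by (intro AE_finite_allI Q seminorm_triangle)
    then show "AE w in M. p (y \<oplus>\<^bsub>E\<^esub> z) w \<le> p y w + p z w"
    proof eventually_elim
      case (elim w)
      have "(\<Sum>n\<in>Q. ae_rep (n (y \<oplus>\<^bsub>E\<^esub> z)) w) \<le> (\<Sum>n\<in>Q. ae_rep (n y) w + ae_rep (n z) w)"
        using elim by (intro sum_mono) auto
      then have "K * (\<Sum>n\<in>Q. ae_rep (n (y \<oplus>\<^bsub>E\<^esub> z)) w) \<le> T y w + T z w"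
        unfolding T_def using K by (simp add: sum.distrib mult_left_mono flip: distrib_left)
      then show ?case by (simp add: p_def T_def indicator_def)
    qed
  next
    fix t z assume t: "rv t" "\<forall>w. 0 \<le> t w" and z: "z \<in> carrier E"
    have "AE w in M. \<forall>n\<in>Q. ae_rep (n (t \<star> z)) w = \<bar>t w\<bar> * ae_rep (n z) w"
      using sem z t by (intro AE_finite_allI Q seminorm_scale)
    then show "AE w in M. p (t \<star> z) w \<le> t w * p z w"
    proof eventually_elim
      case (elim w)
      have "(\<Sum>n\<in>Q. ae_rep (n (t \<star> z)) w) = t w * (\<Sum>n\<in>Q. ae_rep (n z) w)"
        unfolding sum_distrib_left using elim t(2) by (intro sum.cong) auto
      then show ?case by (simp add: p_def T_def)
    qed
  qed
  \<comment> \<open>On points shifted into the domain \<open>F\<close> is finite almost everywhere,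
    so \<open>real_of_ereal\<close> in \<open>h\<close> loses nothing. The shift moves the centre of
    the seminorms from \<open>x\<close> to the null element.\<close>
  define C where "C = {y \<in> carrier E. x \<oplus>\<^bsub>E\<^esub> y \<in> L0_dom M E f}"
  define h where "h = (\<lambda>y w. indicator A w * (real_of_ereal (F (x \<oplus>\<^bsub>E\<^esub> y) w) - ?q))"
  have CE: "y \<in> carrier E" "x \<oplus>\<^bsub>E\<^esub> y \<in> L0_dom M E f" if "y \<in> C" for y
    using that by (auto simp: C_def)
  obtain y0 where y0: "y0 \<in> L0_dom M E f" by (rule dom_nonempty)
  have cancel: "x \<oplus>\<^bsub>E\<^esub> (y \<ominus>\<^bsub>E\<^esub> x) = y" "(x \<oplus>\<^bsub>E\<^esub> y) \<ominus>\<^bsub>E\<^esub> x = y" if "y \<in> carrier E" for y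
    using that x by (simp_all add: M.minus_eq M.a_lcomm[of x y] M.r_neg M.a_comm[of x y] M.a_assoc)
  have Cmem: "y \<ominus>\<^bsub>E\<^esub> x \<in> C" if "y \<in> L0_dom M E f" for y
    using that x dom_closed[OF that] by (simp add: C_def cancel)
  \<comment> \<open>The coefficients sum to \<open>1\<close>, so the shift by \<open>x\<close>
    passes through the combination.\<close>
  have comb: "x \<oplus>\<^bsub>E\<^esub> (t \<star> y \<oplus>\<^bsub>E\<^esub> (\<lambda>w. 1 - t w) \<star> z)
      = t \<star> (x \<oplus>\<^bsub>E\<^esub> y) \<oplus>\<^bsub>E\<^esub> (\<lambda>w. 1 - t w) \<star> (x \<oplus>\<^bsub>E\<^esub> z)"
    if t: "rv t" and y: "y \<in> carrier E" and z: "z \<in> carrier E" for t y z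
  proof -
    have t': "rv (\<lambda>w. 1 - t w)" using t by measurable
    have "x = t \<star> x \<oplus>\<^bsub>E\<^esub> (\<lambda>w. 1 - t w) \<star> x"
      using sc_add_left[OF t t' x] x by simp
    then have "x \<oplus>\<^bsub>E\<^esub> (t \<star> y \<oplus>\<^bsub>E\<^esub> (\<lambda>w. 1 - t w) \<star> z)
        = (t \<star> x \<oplus>\<^bsub>E\<^esub> (\<lambda>w. 1 - t w) \<star> x) \<oplus>\<^bsub>E\<^esub> (t \<star> y \<oplus>\<^bsub>E\<^esub> (\<lambda>w. 1 - t w) \<star> z)"
      by simp
    also have "\<dots> = t \<star> (x \<oplus>\<^bsub>E\<^esub> y) \<oplus>\<^bsub>E\<^esub> (\<lambda>w. 1 - t w) \<star> (x \<oplus>\<^bsub>E\<^esub> z)"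
      using t t' x y z by (simp add: sc_add_right M.a_ac)
    finally show ?thesis .
  qed
  have conv: "AE w in M. F (x \<oplus>\<^bsub>E\<^esub> (t \<star> y \<oplus>\<^bsub>E\<^esub> (\<lambda>w. 1 - t w) \<star> z)) w
      \<le> ereal (t w * real_of_ereal (F (x \<oplus>\<^bsub>E\<^esub> y) w) + (1 - t w) * real_of_ereal (F (x \<oplus>\<^bsub>E\<^esub> z) w))"
    if y: "y \<in> C" and z: "z \<in> C" and t: "rv t" "\<And>w. 0 \<le> t w \<and> t w \<le> 1" for t y z
  proof -
    have xy: "x \<oplus>\<^bsub>E\<^esub> y \<in> carrier E" "x \<oplus>\<^bsub>E\<^esub> z \<in> carrier E" using x CE y z by auto
    from F_convex[OF xy t] F_dom[OF CE(2)[OF y]] F_dom[OF CE(2)[OF z]]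
    show ?thesis
      unfolding comb[OF t(1) CE(1)[OF y] CE(1)[OF z]]
    proof eventually_elim
      case (elim w)
      obtain a b where "F (x \<oplus>\<^bsub>E\<^esub> y) w = ereal a" "F (x \<oplus>\<^bsub>E\<^esub> z) w = ereal b" using elim by metis
      with elim(1) show ?case by simp
    qed
  qed
  have C_convex: "t \<star> y \<oplus>\<^bsub>E\<^esub> (\<lambda>w. 1 - t w) \<star> z \<in> C"
    if y: "y \<in> C" and z: "z \<in> C" and t: "rv t" "\<And>w. 0 \<le> t w \<and> t w \<le> 1" for t y z
  proof -
    have "AE w in M. F (x \<oplus>\<^bsub>E\<^esub> (t \<star> y \<oplus>\<^bsub>E\<^esub> (\<lambda>w. 1 - t w) \<star> z)) w < \<infinity>"
      using conv[OF y z t] by eventually_elim auto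
    then show ?thesis using x CE(1)[OF y] CE(1)[OF z] t by (simp add: C_def L0_dom_def)
  qed
  obtain g where g: "linear g" "dominated g p" "\<And>y. y \<in> C \<Longrightarrow> AE w in M. g y w \<le> h y w"
  proof (rule sandwich[OF p, of C h])
    show "C \<subseteq> carrier E" by (auto simp: C_def)
    show "C \<noteq> {}" using Cmem[OF y0] by blast
    show "rv (h y)" if "y \<in> C" for y
    proof -
      have [measurable]: "F (x \<oplus>\<^bsub>E\<^esub> y) \<in> borel_measurable M" using CE[OF that] x by (intro F_measurable) auto
      show ?thesis unfolding h_def by measurable
    qed
    show "AE w in M. h (t \<star> y \<oplus>\<^bsub>E\<^esub> (\<lambda>w. 1 - t w) \<star> z) w \<le> t w * h y w + (1 - t w) * h z w"
      if y: "y \<in> C" and z: "z \<in> C" and t: "rv t" "\<And>w. 0 \<le> t w \<and> t w \<le> 1" for t y z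
    proof -
      have "t \<star> y \<oplus>\<^bsub>E\<^esub> (\<lambda>w. 1 - t w) \<star> z \<in> C" using y z t by (rule C_convex)
      from conv[OF y z t] F_dom[OF CE(2)[OF this]]
      show ?thesis
      proof eventually_elim
        case (elim w)
        let ?u = "x \<oplus>\<^bsub>E\<^esub> (t \<star> y \<oplus>\<^bsub>E\<^esub> (\<lambda>w. 1 - t w) \<star> z)"
        obtain c where c: "F ?u w = ereal c" using elim(2) by metis
        with elim(1) have "c \<le> t w * real_of_ereal (F (x \<oplus>\<^bsub>E\<^esub> y) w) + (1 - t w) * real_of_ereal (F (x \<oplus>\<^bsub>E\<^esub> z) w)"
          by simp
        then show ?case using c by (simp add: h_def indicator_def algebra_simps)
      qed
    qed
    \<comment> \<open>On \<open>A\<close> this is the bound from \<open>lower_support\<close> at the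
      point \<open>x + y\<close>, whose difference from \<open>x\<close> is
      \<open>y\<close>.\<close>
    show "AE w in M. 0 \<le> h y w + p (\<ominus>\<^bsub>E\<^esub> y) w" if y: "y \<in> C" for y
    proof -
      have yE: "y \<in> carrier E" "x \<oplus>\<^bsub>E\<^esub> y \<in> carrier E" using CE[OF y] x by auto
      have "AE w in M. \<forall>n\<in>Q. ae_rep (n (\<ominus>\<^bsub>E\<^esub> y)) w = ae_rep (n y) w"
        using sem yE by (intro AE_finite_allI Q seminorm_minus)
      with supp[OF yE(2)] F_dom[OF CE(2)[OF y]] show ?thesis
        unfolding cancel(2)[OF yE(1)]
      proof eventually_elim
        case (elim w)
        obtain c where c: "F (x \<oplus>\<^bsub>E\<^esub> y) w = ereal c" using elim(2) by metis
        have "T (\<ominus>\<^bsub>E\<^esub> y) w = T y w" using elim(3) by (simp add: T_def)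
        with elim(1) c show ?case by (auto simp: h_def p_def T_def indicator_def)
      qed
    qed
  qed (rule C_convex that; assumption)+
  let ?G = "\<lambda>x. ae_class M (g x)"
  have g_rv: "rv (g z)" if "z \<in> carrier E" for z using g(1) that by (simp add: linear_def)
  have G: "?G \<in> el_dual M E P"
  proof (rule linear_in_el_dual[OF g(1) Q K])
    fix z assume z: "z \<in> carrier E"
    have "AE w in M. \<forall>n\<in>Q. 0 \<le> ae_rep (n z) w"
      using sem z by (intro AE_finite_allI Q seminorm_nonneg)
    moreover have "AE w in M. g z w \<le> p z w" using g(2) z by (simp add: dominated_def)
    ultimately show "AE w in M. g z w \<le> K * (\<Sum>n\<in>Q. ae_rep (n z) w)"
    proof eventually_elim
      case (elim w)
      have "0 \<le> K * (\<Sum>n\<in>Q. ae_rep (n z) w)" using elim(1) K by (intro mult_nonneg_nonneg sum_nonneg) auto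
      with elim(2) show ?case by (cases "w \<in> A") (simp_all add: p_def T_def)
    qed
  qed
  have G_rep: "AE w in M. ae_rep (?G z) w = g z w" if "z \<in> carrier E" for z
    using g_rv[OF that] by (rule ae_rep_class)
  have dom_bound: "AE w in M. w \<in> A \<longrightarrow> ereal (g y w) - F y w \<le> ereal (g x w - ?q)"
    if y: "y \<in> L0_dom M E f" for y
  proof -
    have yE: "y \<in> carrier E" by (rule dom_closed[OF y])
    have "AE w in M. g (x \<oplus>\<^bsub>E\<^esub> (y \<ominus>\<^bsub>E\<^esub> x)) w = g x w + g (y \<ominus>\<^bsub>E\<^esub> x) w"
      using g(1) x yE by (simp add: linear_def)
    with g(3)[OF Cmem[OF y]] F_dom[OF y] show ?thesis
      unfolding cancel(1)[OF yE] h_def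
    proof eventually_elim
      case (elim w)
      obtain c where "F y w = ereal c" using elim(2) by metis
      with elim(1,3) show ?case by (auto simp: indicator_def)
    qed
  qed
  \<comment> \<open>Where \<open>f y\<close> is infinite the inequality is trivial, so \<open>y\<close> may be replaced there by \<open>y0\<close>.\<close>
  have bound: "AE w in M. w \<in> A \<longrightarrow> ereal (g y w) - F y w \<le> ereal (g x w - ?q)"
    if y: "y \<in> carrier E" for y
  proof -
    let ?B = "{w \<in> space M. F y w < \<infinity>}"
    have B: "?B \<in> sets M" using F_measurable[OF y] by measurable
    let ?z = "splice ?B y y0"
    have y0E: "y0 \<in> carrier E" by (rule dom_closed[OF y0])
    have zE: "?z \<in> carrier E" using B y y0E by simp
    have in_B: "AE w in M. w \<in> ?B \<longrightarrow> F ?z w = F y w"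
      using B y y0E zE by (intro agree_F agree_splice_inside) auto
    have "AE w in M. w \<in> space M - ?B \<longrightarrow> F ?z w = F y0 w"
      using B y y0E zE by (intro agree_F agree_splice_outside) auto
    moreover have "AE w in M. F y0 w < \<infinity>" using y0 by (simp add: L0_dom_def)
    ultimately have "AE w in M. F ?z w < \<infinity>" using in_B AE_space by eventually_elim auto
    then have "?z \<in> L0_dom M E f" using zE by (simp add: L0_dom_def)
    from dom_bound[OF this] in_B
    have "AE w in M. w \<in> A \<longrightarrow> w \<in> ?B \<longrightarrow> ereal (g ?z w) - F y w \<le> ereal (g x w - ?q)"
      by eventually_elim auto
    moreover have "AE w in M. w \<in> ?B \<longrightarrow> g ?z w = g y w"
      using B y y0E zE by (intro agree_linear[OF g(1)] agree_splice_inside) auto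
    ultimately show ?thesis using AE_space by eventually_elim (auto simp: less_top[symmetric])
  qed
  \<comment> \<open>Off \<open>A\<close> nothing is known of the conjugate, hence the trivial bound
    \<infinity>; only values on \<open>A\<close> enter the contradiction.\<close>
  have "AE w in M. ae_rep (el_conjugate M E f ?G) w \<le> (if w \<in> A then ereal (g x w - ?q) else \<infinity>)"
  proof (rule conjugate_least[OF el_dual_into[OF G]])
    show "(\<lambda>w. if w \<in> A then ereal (g x w - ?q) else \<infinity>) \<in> borel_measurable M"
      using g_rv[OF x] by measurable
    fix y assume y: "y \<in> carrier E"
    from bound[OF y] G_rep[OF y]
    show "AE w in M. ereal (ae_rep (?G y) w) - F y w \<le> (if w \<in> A then ereal (g x w - ?q) else \<infinity>)"
      by eventually_elim auto
  qed
  \<comment> \<open>On \<open>A\<close> the level \<open>q\<close> is at most \<open>g x\<close>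
    minus the conjugate, hence at most \<open>?B\<close>; but \<open>A\<close> lies in
    \<open>D q\<close>, where \<open>?B\<close> is below \<open>q\<close>.\<close>
  with biconjugate_upper[OF x G] G_rep[OF x] have "AE w in M. w \<notin> A"
  proof eventually_elim
    case (elim w)
    show ?case
    proof
      assume w: "w \<in> A"
      then have "ae_rep (el_conjugate M E f ?G) w \<le> ereal (g x w - ?q)" using elim by simp
      then have "ereal ?q \<le> ereal (g x w) - ae_rep (el_conjugate M E f ?G) w"
        by (cases "ae_rep (el_conjugate M E f ?G) w") auto
      also have "\<dots> \<le> ?B w" using elim by simp
      also have "\<dots> < ereal ?q" using A(2) w by (auto simp: D_def)
      finally show False by simp
    qed
  qed
  then have "prob A = 0" by (subst prob_eq_0[OF A(1)])
  with A(3) show False by simp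
qed

theorem biconjugate_eq:
  assumes x: "x \<in> carrier E"
  shows "el_biconjugate M E P f x = f x"
proof -
  have "ae_class M (ae_rep (el_biconjugate M E P f x)) = ae_class M (F x)"
  proof (rule ae_class_eqI)
    from biconjugate_le[OF x] biconjugate_ge[OF x]
    show "AE w in M. ae_rep (el_biconjugate M E P f x) w = F x w" by eventually_elim auto
  qed (intro ae_class_rep(1) biconjugate_in f_in x)+
  then show ?thesis
    using ae_class_rep(2)[OF biconjugate_in[OF x]] ae_class_rep(2)[OF f_in[OF x]] by simp
qed

end

theorem theorem5p3:
  fixes M :: "'w measure"
    and E :: "(('w \<Rightarrow> real) set, 'e, 'm) module_scheme"
    and P :: "('e \<Rightarrow> ('w \<Rightarrow> real) set) set"
    and f :: "'e \<Rightarrow> ('w \<Rightarrow> ereal) set"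
  assumes "random_locally_convex_module M E P"
    and "f \<in> carrier E \<rightarrow> carrier (L0bar M)"
    and "L0_proper M E f"
    and "L0_convex M E f"
    and "el_lsc M E P f"
  shows "\<forall>x\<in>carrier E. el_biconjugate M E P f x = f x"
proof -
  interpret lsc_convex_function M E P f
    using assms by (intro lsc_convex_function.intro lsc_convex_function_axioms.intro)
  show ?thesis using biconjugate_eq by blast
qed

end
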